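(* Let $1<p<\infty$, $q,L,\theta>0$, $a\in(0,1)$ and assume that $u$ is a weak supersolution of $\partial_t(|u|^{q-1}u)+\mathcal{L}u=0$ in $\Omega\times(0,T)$. Assume that $\mu_-\in\mathbb{R}$ satisfies $$\mu_-\le\operatorname*{ess\,inf}_{\mathbb{R}^n\times(0,T)}u$$ and let $\mathcal{Q}^-(x_0,t_0;r,\theta)\Subset\Omega\times(0,T)$. Then there exists a constant $\tau\in(0,1)$, depending only on $a,L,\mu_-,\theta$ and the data $n,p,q,s,\Lambda$, such that if $$|\{u\le\mu_-+L\}\cap\mathcal{Q}^-(x_0,t_0;r,\theta)|\le\tau\,|\mathcal{Q}^-(x_0,t_0;r,\theta)|,$$ then $$u\ge\mu_-+aL\quad\text{a.e. in }\mathcal{Q}^-\bigl(x_0,t_0;\tfrac{3r}{4},\theta\bigr).$$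
   Context: Setting. $\Omega\subset\mathbb{R}^n$ is a bounded domain, $T>0$, $1<p<\infty$, $q>0$, $s\in(0,1)$, $\Lambda\ge 1$. The kernel $K(x,y,t)$ is measurable, symmetric in $x$ and $y$, and satisfies $\frac{\Lambda^{-1}}{|x-y|^{n+ps}}\le K(x,y,t)\le\frac{\Lambda}{|x-y|^{n+ps}}$ for almost every $x,y\in\mathbb{R}^n$, uniformly in $t\in(0,T)$. The operator is $\mathcal{L}u(x,t)=\mathrm{P.V.}\int_{\mathbb{R}^n}|u(x,t)-u(y,t)|^{p-2}(u(x,t)-u(y,t))K(x,y,t)\,dy$. Write $\mathcal{A}(u(x,y,t))=|u(x,t)-u(y,t)|^{p-2}(u(x,t)-u(y,t))$ and $d\mu=K(x,y,t)\,dx\,dy$. Function spaces. For an open set $D\subset\mathbb{R}^n$, $W^{s,p}(D)$ is the space of $u\in L^p(D)$ with $\frac{|u(x)-u(y)|}{|x-y|^{n/p+s}}\in L^p(D\times D)$, with norm $\|u\|_{W^{s,p}(D)}=\big(\int_D|u|^p\,dx+\int_D\int_D\frac{|u(x)-u(y)|^p}{|x-y|^{n+ps}}\,dx\,dy\big)^{1/p}$, and $W_0^{s,p}(D)=\{u\in W^{s,p}(\mathbb{R}^n):u=0\text{ in }\mathbb{R}^n\setminus D\}$. $L^p(0,T;W^{s,p}(D))$ consists of measurable $u$ on $D\times(0,T)$ with $\int_0^T\|u(\cdot,t)\|_{W^{s,p}(D)}^p\,dt<\infty$; local versions require this on every $\Omega'\times[t_1,t_2]\Subset\Omega\times(0,T)$.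 Weak supersolution. A function $u:\mathbb{R}^n\times(0,T)\to\mathbb{R}$, $u\in L^\infty(0,T;L^\infty(\mathbb{R}^n))$, is a weak supersolution of $\partial_t(|u|^{q-1}u)+\mathcal{L}u=0$ in $\Omega\times(0,T)$ if $u\in L^{q+1}_{\mathrm{loc}}(0,T;L^{q+1}_{\mathrm{loc}}(\Omega))\cap L^p_{\mathrm{loc}}(0,T;W^{s,p}_{\mathrm{loc}}(\Omega))$ and for every $\Omega'\times[t_1,t_2]\Subset\Omega\times(0,T)$ and every nonnegative test function $\phi\in W^{1,q+1}_{\mathrm{loc}}(0,T;L^{q+1}(\Omega'))\cap L^p_{\mathrm{loc}}(0,T;W_0^{s,p}(\Omega'))$, $$\int_{t_1}^{t_2}\int_{\mathbb{R}^n}\int_{\mathbb{R}^n}\mathcal{A}(u(x,y,t))(\phi(x,t)-\phi(y,t))\,d\mu\,dt-\int_{t_1}^{t_2}\int_{\Omega'}|u|^{q-1}u\,\partial_t\phi\,dx\,dt+\int_{\Omega'}|u(x,t_2)|^{q-1}u(x,t_2)\phi(x,t_2)\,dx-\int_{\Omega'}|u(x,t_1)|^{q-1}u(x,t_1)\phi(x,t_1)\,dx\ge 0.$$ The boundary terms at $t_1$ and $t_2$ are understood as $\lim_{h\to0}\frac1h\int_{t_1}^{t_1+h}\int_{\Omega'}|u|^{q-1}u\,\phi\,dx\,dt$ and $\lim_{h\to0}\frac1h\int_{t_2-h}^{t_2}\int_{\Omega'}|u|^{q-1}u\,\phi\,dx\,dt$, respectively. Cylinders. For $r,\theta>0$ and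 $(x_0,t_0)\in\mathbb{R}^n\times\mathbb{R}$, $\mathcal{Q}^-(x_0,t_0;r,\theta)=B_r(x_0)\times(t_0-\theta r^{sp},t_0]$, where $B_r(x_0)$ is the open ball. $|E|$ denotes the Lebesgue measure of $E\subset\mathbb{R}^{n+1}$. *)

theory Defs
  imports "HOL-Analysis.Analysis" "HOL-Probability.Essential_Supremum"
begin

text \<open>
  Space is an arbitrary Euclidean space \<open>'a\<close> of dimension \<open>n = DIM('a)\<close>.
  "Measurable" means Lebesgue measurable. Functions of space and time are curried,
  \<open>u x t\<close>; only their values for \<open>0 < t < T\<close> matter. Real powers are taken
  with \<open>powr\<close>, where \<open>0 powr a = 0\<close>, so that \<open>\<bar>v\<bar> powr (m - 1) * v\<close> is the
  usual odd power \<open>|v|^(m-1) v\<close>, with value \<open>0\<close> at \<open>v = 0\<close>, also for \<open>m < 1\<close>.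
\<close>

definition compactly_contained :: "'b::topological_space set \<Rightarrow> 'b set \<Rightarrow> bool"
    (infix "\<Subset>" 50)
  where "S \<Subset> U \<longleftrightarrow> compact (closure S) \<and> closure S \<subseteq> U"

definition bounded_domain :: "'a::euclidean_space set \<Rightarrow> bool"
  where "bounded_domain \<Omega> \<longleftrightarrow> \<Omega> \<noteq> {} \<and> open \<Omega> \<and> connected \<Omega> \<and> bounded \<Omega>"

definition signed_power :: "real \<Rightarrow> real \<Rightarrow> real"
  where "signed_power m v = \<bar>v\<bar> powr (m - 1) * v"

definition admissible_kernel ::
    "real \<Rightarrow> real \<Rightarrow> real \<Rightarrow> real \<Rightarrow> ('a::euclidean_space \<Rightarrow> 'a \<Rightarrow> real \<Rightarrow> real) \<Rightarrow> bool"
  where "admissible_kernel p s \<Lambda> T K \<longleftrightarrow>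
    (\<lambda>(x, y, t). K x y t) \<in> borel_measurable (lebesgue_on (UNIV \<times> UNIV \<times> {0<..<T})) \<and>
    (\<forall>x y. \<forall>t\<in>{0<..<T}. K x y t = K y x t) \<and>
    (\<forall>t\<in>{0<..<T}. AE (x, y) in lebesgue.
       (1 / \<Lambda>) / norm (x - y) powr (real DIM('a) + p * s) \<le> K x y t \<and>
       K x y t \<le> \<Lambda> / norm (x - y) powr (real DIM('a) + p * s))"

text \<open>
  Norms enter only through their \<open>p\<close>-th powers, which are given as extended
  nonnegative reals. The diagonal of \<open>D \<times> D\<close> is a null set, so
  the convention \<open>0 / 0 = 0\<close> in the Gagliardo integrand is harmless.
\<close>

definition Lp_norm_pow :: "real \<Rightarrow> 'a::euclidean_space set \<Rightarrow> ('a \<Rightarrow> real) \<Rightarrow> ennreal"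
  where "Lp_norm_pow p D v = (\<integral>\<^sup>+x\<in>D. ennreal (\<bar>v x\<bar> powr p) \<partial>lebesgue)"

definition Wsp_norm_pow ::
    "real \<Rightarrow> real \<Rightarrow> 'a::euclidean_space set \<Rightarrow> ('a \<Rightarrow> real) \<Rightarrow> ennreal"
  where "Wsp_norm_pow s p D v =
    Lp_norm_pow p D v +
    (\<integral>\<^sup>+z\<in>D \<times> D. ennreal (\<bar>v (fst z) - v (snd z)\<bar> powr p /
        norm (fst z - snd z) powr (real DIM('a) + p * s)) \<partial>lebesgue)"

definition Wsp :: "real \<Rightarrow> real \<Rightarrow> 'a::euclidean_space set \<Rightarrow> ('a \<Rightarrow> real) set"
  where "Wsp s p D = {v. v \<in> borel_measurable (lebesgue_on D) \<and> Wsp_norm_pow s p D v < \<infinity>}"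

definition Wsp0 :: "real \<Rightarrow> real \<Rightarrow> 'a::euclidean_space set \<Rightarrow> ('a \<Rightarrow> real) set"
  where "Wsp0 s p D = {v \<in> Wsp s p UNIV. AE x in lebesgue. x \<notin> D \<longrightarrow> v x = 0}"

text \<open>
  Containment \<open>\<Omega>' \<times> [t1,t2] \<Subset> \<Omega> \<times> (0,T)\<close> is written factor by factor below, since the
  product form would leave \<open>t1\<close>, \<open>t2\<close> unconstrained when \<open>\<Omega>'\<close> is empty.

  \<open>space_time_Lp N D I\<close> is \<open>L^p(I; X(D))\<close>, where \<open>N v\<close> is the \<open>p\<close>-th power of
  the norm of \<open>v\<close> in \<open>X(D)\<close>.
\<close>

definition space_time_Lp ::
    "(('a::euclidean_space \<Rightarrow> real) \<Rightarrow> ennreal) \<Rightarrow> 'a set \<Rightarrow> real set \<Rightarrow> ('a \<Rightarrow> real \<Rightarrow> real) set"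
  where "space_time_Lp N D I =
    {u. (\<lambda>(x, t). u x t) \<in> borel_measurable (lebesgue_on (D \<times> I)) \<and>
        (\<integral>\<^sup>+t\<in>I. N (\<lambda>x. u x t) \<partial>lebesgue) < \<infinity>}"

definition Linf_Linf :: "real \<Rightarrow> ('a::euclidean_space \<Rightarrow> real \<Rightarrow> real) set"
  where "Linf_Linf T =
    {u. (\<lambda>(x, t). u x t) \<in> borel_measurable (lebesgue_on (UNIV \<times> {0<..<T})) \<and>
        (\<exists>M. AE t in lebesgue. t \<in> {0<..<T} \<longrightarrow> (AE x in lebesgue. \<bar>u x t\<bar> \<le> M))}"

definition Lr_loc_Lr_loc ::
    "real \<Rightarrow> real \<Rightarrow> 'a::euclidean_space set \<Rightarrow> ('a \<Rightarrow> real \<Rightarrow> real) set"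
  where "Lr_loc_Lr_loc r T \<Omega> =
    {u. \<forall>\<Omega>' t1 t2. open \<Omega>' \<and> \<Omega>' \<Subset> \<Omega> \<and> 0 < t1 \<and> t1 < t2 \<and> t2 < T \<longrightarrow>
          u \<in> space_time_Lp (Lp_norm_pow r \<Omega>') \<Omega>' {t1..t2}}"

definition Lp_loc_Wsp_loc ::
    "real \<Rightarrow> real \<Rightarrow> real \<Rightarrow> 'a::euclidean_space set \<Rightarrow> ('a \<Rightarrow> real \<Rightarrow> real) set"
  where "Lp_loc_Wsp_loc s p T \<Omega> =
    {u. \<forall>\<Omega>' t1 t2. open \<Omega>' \<and> \<Omega>' \<Subset> \<Omega> \<and> 0 < t1 \<and> t1 < t2 \<and> t2 < T \<longrightarrow>
          u \<in> space_time_Lp (Wsp_norm_pow s p \<Omega>') \<Omega>' {t1..t2}}"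

definition Lr_loc_Lr ::
    "real \<Rightarrow> real \<Rightarrow> 'a::euclidean_space set \<Rightarrow> ('a \<Rightarrow> real \<Rightarrow> real) set"
  where "Lr_loc_Lr r T D =
    {u. \<forall>t1 t2. 0 < t1 \<and> t1 < t2 \<and> t2 < T \<longrightarrow>
          u \<in> space_time_Lp (Lp_norm_pow r D) D {t1..t2}}"

definition Lp_loc_Wsp0 ::
    "real \<Rightarrow> real \<Rightarrow> real \<Rightarrow> 'a::euclidean_space set \<Rightarrow> ('a \<Rightarrow> real \<Rightarrow> real) set"
  where "Lp_loc_Wsp0 s p T D =
    {u. (AE t in lebesgue. t \<in> {0<..<T} \<longrightarrow> (\<lambda>x. u x t) \<in> Wsp0 s p D) \<and>
        (\<forall>t1 t2. 0 < t1 \<and> t1 < t2 \<and> t2 < T \<longrightarrow>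
          u \<in> space_time_Lp (Wsp_norm_pow s p UNIV) UNIV {t1..t2})}"

definition test_functions_1d :: "real \<Rightarrow> (real \<Rightarrow> real) set"
  where "test_functions_1d T =
    {\<eta>. (\<forall>k t. ((deriv ^^ k) \<eta>) differentiable (at t)) \<and> {t. \<eta> t \<noteq> 0} \<Subset> {0<..<T}}"

text \<open>
  \<open>\<psi>\<close> is the weak time derivative of \<open>\<phi>\<close> on \<open>D \<times> (0,T)\<close>, in the sense of
  functions of time with values in \<open>L^r(D)\<close>: the two sides below are the Bochner
  integrals, and their equality as elements of \<open>L^r(D)\<close> is equality for a.e. \<open>x \<in> D\<close>.
\<close>

definition weak_time_derivative ::
    "real \<Rightarrow> 'a::euclidean_space set \<Rightarrow> ('a \<Rightarrow> real \<Rightarrow> real) \<Rightarrow> ('a \<Rightarrow> real \<Rightarrow> real) \<Rightarrow> bool"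
  where "weak_time_derivative T D \<phi> \<psi> \<longleftrightarrow>
    (\<forall>\<eta>\<in>test_functions_1d T. AE x in lebesgue. x \<in> D \<longrightarrow>
       (LINT t:{0<..<T}|lebesgue. \<phi> x t * deriv \<eta> t) =
       - (LINT t:{0<..<T}|lebesgue. \<psi> x t * \<eta> t))"

text \<open>\<open>\<phi> \<in> W^{1,r}_loc(0,T; L^r(D))\<close> with time derivative \<open>\<psi>\<close>.\<close>

definition W1r_loc_Lr ::
    "real \<Rightarrow> real \<Rightarrow> 'a::euclidean_space set \<Rightarrow> ('a \<Rightarrow> real \<Rightarrow> real) \<Rightarrow> ('a \<Rightarrow> real \<Rightarrow> real) \<Rightarrow> bool"
  where "W1r_loc_Lr r T D \<phi> \<psi> \<longleftrightarrow>
    \<phi> \<in> Lr_loc_Lr r T D \<and> \<psi> \<in> Lr_loc_Lr r T D \<and> weak_time_derivative T D \<phi> \<psi>"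

definition nonlocal_energy ::
    "real \<Rightarrow> ('a::euclidean_space \<Rightarrow> 'a \<Rightarrow> real \<Rightarrow> real) \<Rightarrow> ('a \<Rightarrow> real \<Rightarrow> real) \<Rightarrow>
     ('a \<Rightarrow> real \<Rightarrow> real) \<Rightarrow> real \<Rightarrow> real \<Rightarrow> real"
  where "nonlocal_energy p K u \<phi> t1 t2 =
    (LINT (x, y, t):UNIV \<times> UNIV \<times> {t1..t2}|lebesgue.
       signed_power (p - 1) (u x t - u y t) * (\<phi> x t - \<phi> y t) * K x y t)"

text \<open>
  The boundary terms are the limits \<open>b1\<close>, \<open>b2\<close> of one-sided time averages; their
  existence is part of the definition. All other integrals converge absolutely under
  the stated integrability of \<open>u\<close>, \<open>\<phi>\<close>, \<open>\<psi>\<close> and the kernel bounds.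
\<close>

definition weak_supersolution ::
    "real \<Rightarrow> real \<Rightarrow> real \<Rightarrow> ('a::euclidean_space \<Rightarrow> 'a \<Rightarrow> real \<Rightarrow> real) \<Rightarrow> 'a set \<Rightarrow> real \<Rightarrow>
     ('a \<Rightarrow> real \<Rightarrow> real) \<Rightarrow> bool"
  where "weak_supersolution p q s K \<Omega> T u \<longleftrightarrow>
    u \<in> Linf_Linf T \<and>
    u \<in> Lr_loc_Lr_loc (q + 1) T \<Omega> \<and>
    u \<in> Lp_loc_Wsp_loc s p T \<Omega> \<and>
    (\<forall>\<Omega>' t1 t2 \<phi> \<psi>.
       open \<Omega>' \<and> \<Omega>' \<Subset> \<Omega> \<and> 0 < t1 \<and> t1 < t2 \<and> t2 < T \<and>
       W1r_loc_Lr (q + 1) T \<Omega>' \<phi> \<psi> \<and> \<phi> \<in> Lp_loc_Wsp0 s p T \<Omega>' \<and>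
       (AE (x, t) in lebesgue. t \<in> {0<..<T} \<longrightarrow> 0 \<le> \<phi> x t) \<longrightarrow>
       (\<exists>b1 b2.
          ((\<lambda>h. (1 / h) * (LINT (x, t):\<Omega>' \<times> {t1..t1 + h}|lebesgue. signed_power q (u x t) * \<phi> x t))
             \<longlongrightarrow> b1) (at_right 0) \<and>
          ((\<lambda>h. (1 / h) * (LINT (x, t):\<Omega>' \<times> {t2 - h..t2}|lebesgue. signed_power q (u x t) * \<phi> x t))
             \<longlongrightarrow> b2) (at_right 0) \<and>
          nonlocal_energy p K u \<phi> t1 t2
            - (LINT (x, t):\<Omega>' \<times> {t1..t2}|lebesgue. signed_power q (u x t) * \<psi> x t)
            + b2 - b1 \<ge> 0))"

definition essinf :: "'b measure \<Rightarrow> ('b \<Rightarrow> real) \<Rightarrow> ereal"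
  where "essinf M f = - esssup M (\<lambda>z. - ereal (f z))"

definition Q_minus ::
    "real \<Rightarrow> real \<Rightarrow> 'a::euclidean_space \<Rightarrow> real \<Rightarrow> real \<Rightarrow> real \<Rightarrow> ('a \<times> real) set"
  where "Q_minus s p x0 t0 r \<theta> = ball x0 r \<times> {t0 - \<theta> * r powr (s * p)<..t0}"

end

theory Submission imports Defs begin

text \<open>
  De Giorgi iteration on the truncations \<open>w = (k - u)\<^sup>+\<close>. The weak formulation is tested with the
  Steklov average in time of \<open>\<eta>(t) \<zeta>(x)^p w(x,t)\<close>, where the time cutoff \<open>\<eta>\<close> vanishes outside the
  cylinder, so that the boundary terms disappear. The Bregman divergence of \<open>\<bar>v\<bar>^(q+1)/(q+1)\<close> between
  \<open>k\<close> and \<open>u\<close> turns the time differences into a telescoping sum.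

  No Sobolev embedding is needed. Of the Gagliardo energy only the pairs \<open>(x,y)\<close> with \<open>w(x) > 0\<close> and
  \<open>w(y) = 0\<close> are kept; they already give \<open>\<integral>w^p \<le> C \<bar>{w > 0}\<bar>^(sp/n)\<close> times the energy on each time
  slice. The energy estimate at the preceding level bounds the measure of almost every slice
  \<open>{w(\<cdot>,t) > 0}\<close>, and the exponent \<open>1 + sp/n > 1\<close> results. Since \<open>\<mu> \<le> u\<close> holds on all of space, there
  is no tail term.
\<close>

section \<open>Elementary inequalities\<close>

text \<open>\<tau> has to be fixed before the solution is known, so no constant may contain the
  bound \<open>M\<close> of |u|. This succeeds because the truncation energy is evaluated only where
  u lies between \<mu> and k \<le> \<mu> + L, so that |\<mu>| + L governs its size; \<open>M\<close>
  serves for integrability and for limits h \<rightarrow> 0 alone.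

  How the divergence compares with powers of w depends on q and on where 0 lies relative to
  [\<mu>, \<mu> + L]. The comparison is avoided by lowering the level twice in each step. After the
  first drop the divergence has a positive lower bound on the smaller set, so the time term bounds
  the measure of slices; after the second drop w itself has a lower bound, so the kept energy bounds
  a measure. The iteration thus runs on measures of sublevel sets only, at the price of powers of
  4^j, which the exponent above 1 absorbs.

  The energy of u is finite only locally and the kernel is singular on the diagonal. The supports of
  the cutoffs therefore stay inside radius 7r/8, which leaves a margin r - R when the Steklov
  average is removed.\<close>

lemma signed_power_nonneg_eq: "0 \<le> v \<Longrightarrow> 0 < m \<Longrightarrow> signed_power m v = v powr m"
  unfolding signed_power_def by (cases "v = 0") (auto simp: powr_mult_base[symmetric] powr_diff)

lemma signed_power_minus: "signed_power m (- v) = - signed_power m v"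
  by (simp add: signed_power_def)

lemma abs_signed_power: "0 < m \<Longrightarrow> \<bar>signed_power m v\<bar> = \<bar>v\<bar> powr m"
  by (cases "v = 0") (auto simp: signed_power_def abs_mult powr_diff)

lemma signed_power_nonneg: "0 \<le> v \<Longrightarrow> 0 \<le> signed_power m v"
  by (simp add: signed_power_def)

lemma signed_power_mono:
  assumes m: "0 < m" and "a \<le> b" shows "signed_power m a \<le> signed_power m b"
proof -
  have pos: "signed_power m a \<le> signed_power m b" if "0 \<le> a" "a \<le> b" for a b
    using that m by (simp add: signed_power_nonneg_eq powr_mono2)
  consider "0 \<le> a" | "b \<le> 0" | "a \<le> 0" "0 \<le> b" by linarith
  then show ?thesis
  proof cases
    case 1 then show ?thesis using pos assms by blast
  next
    case 2 then show ?thesis using pos[of "-b" "-a"] assms by (simp add: signed_power_minus)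
  next
    case 3 then show ?thesis
      using signed_power_nonneg[of b m] signed_power_nonneg[of "-a" m] by (simp add: signed_power_minus)
  qed
qed

text \<open>Concavity of the power: its graph lies below the tangent at 1. Writing the power as
  \<open>exp\<close> of a convex combination of \<open>ln l\<close> and 0 reduces this to convexity
  of \<open>exp\<close>.\<close>

lemma powr_tangent_le:
  assumes q: "0 < q" "q \<le> 1" and l: "0 \<le> (l::real)" "l \<le> 1"
  shows "l powr q \<le> 1 - q * (1 - l)"
proof (cases "l = 0")
  case False
  then have "0 < l" using l by simp
  then have "l powr q = exp (q * ln l + (1 - q) * 0)" by (simp add: powr_def)
  also have "\<dots> \<le> q * exp (ln l) + (1 - q) * exp 0"
    using convex_onD[OF exp_convex, of q 0 "ln l"] q by (simp add: algebra_simps)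
  finally show ?thesis using \<open>0 < l\<close> by (simp add: algebra_simps)
qed (use q in auto)

text \<open>One lower bound for both regimes: for q > 1 the slope of the power vanishes at 0, for q
  < 1 it fades at infinity, whence the exponent q + 1 and the upper bound M. With l = a/b the point
  is 1 - \<open>l powr q\<close> \<ge> min 1 q * (1 - l). Besides levels of u, it also controls
  differences of powers of radii in \<open>energy_factor_scaled\<close>.\<close>

lemma powr_diff_ge:
  assumes q: "0 < q" and ab: "0 \<le> a" "a < b" "b \<le> M"
  shows "min 1 q * (b - a) powr (q + 1) / M \<le> b powr q - (a::real) powr q"
proof -
  define l where "l = a / b"
  have b: "0 < b" "0 < M" using ab by auto
  have l: "0 \<le> l" "l < 1" "a = l * b" using ab b by (auto simp: l_def)
  have "l powr q \<le> 1 - min 1 q * (1 - l)"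
  proof (cases "q \<le> 1")
    case True then show ?thesis using powr_tangent_le[of q l] q l by simp
  next
    case False
    then have "l powr q \<le> l powr 1"
      using l by (intro powr_mono') auto
    then show ?thesis using False l by simp
  qed
  then have "min 1 q * (1 - l) * b powr q \<le> (1 - l powr q) * b powr q"
    by (intro mult_right_mono) auto
  also have "\<dots> = b powr q - a powr q"
    using l b by (simp add: powr_mult algebra_simps)
  finally have 1: "min 1 q * (1 - l) * b powr q \<le> b powr q - a powr q" .
  have "(b - a) powr (q + 1) / M = (b - a) * (b - a) powr q / M"
    using ab by (simp add: powr_add)
  also have "\<dots> \<le> (b - a) * b powr q / b"
    using ab b q by (intro frac_le mult_left_mono powr_mono2) auto
  also have "\<dots> = (1 - l) * b powr q" using b by (simp add: l_def field_simps)
  finally have "min 1 q * ((b - a) powr (q + 1) / M) \<le> min 1 q * ((1 - l) * b powr q)"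
    using q by (intro mult_left_mono) auto
  then show ?thesis using 1 by (simp add: mult.assoc)
qed

text \<open>If a and b have opposite signs, the larger of -a and b is at least half of b - a, so the
  one-sided bound on that part suffices; this is why the length is halved.\<close>

lemma signed_power_diff_ge:
  assumes q: "0 < q" and ab: "a < b" "\<bar>a\<bar> \<le> M" "\<bar>b\<bar> \<le> M"
  shows "min 1 q * ((b - a) / 2) powr (q + 1) / M \<le> signed_power q b - signed_power q a"
proof -
  have M: "0 < M" using ab by linarith
  have pos: "min 1 q * ((b - a) / 2) powr (q + 1) / M \<le> signed_power q b - signed_power q a"
    if "0 \<le> a" "a < b" "b \<le> M" for a b
  proof -
    have "min 1 q * ((b - a) / 2) powr (q + 1) / M \<le> min 1 q * (b - a) powr (q + 1) / M"
      using that q M by (intro divide_right_mono mult_left_mono powr_mono2) auto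
    also have "\<dots> \<le> signed_power q b - signed_power q a"
      using powr_diff_ge[of q a b M] that q by (simp add: signed_power_nonneg_eq)
    finally show ?thesis .
  qed
  consider "0 \<le> a" | "b \<le> 0" | "a < 0" "0 < b" "- a \<le> b" | "a < 0" "0 < b" "b \<le> -a" by linarith
  then show ?thesis
  proof cases
    case 1 then show ?thesis using pos[of a b] ab by auto
  next
    case 2 then show ?thesis using pos[of "-b" "-a"] ab by (auto simp: signed_power_minus)
  next
    case 3
    have "min 1 q * ((b - a) / 2) powr (q + 1) / M \<le> min 1 q * (b - 0) powr (q + 1) / M"
      using 3 q M by (intro divide_right_mono mult_left_mono powr_mono2) auto
    also have "\<dots> \<le> signed_power q b"
      using powr_diff_ge[of q 0 b M] 3 ab q by (simp add: signed_power_nonneg_eq)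
    finally show ?thesis using signed_power_nonneg[of "-a" q] 3 by (simp add: signed_power_minus)
  next
    case 4
    have "min 1 q * ((b - a) / 2) powr (q + 1) / M \<le> min 1 q * (- a - 0) powr (q + 1) / M"
      using 4 q M by (intro divide_right_mono mult_left_mono powr_mono2) auto
    also have "\<dots> \<le> signed_power q (-a)"
      using powr_diff_ge[of q 0 "-a" M] 4 ab q by (simp add: signed_power_nonneg_eq)
    finally show ?thesis using signed_power_nonneg[of b q] 4 by (simp add: signed_power_minus)
  qed
qed

section \<open>The convex primitive and its Bregman divergence\<close>

definition power_primitive :: "real \<Rightarrow> real \<Rightarrow> real"
  where "power_primitive q v = \<bar>v\<bar> powr (q + 1) / (q + 1)"

text \<open>The subgradient inequality of the convex primitive, with slope
  \<open>signed_power q b\<close>. It is Young's inequality with the conjugate exponents q + 1 and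
  (q + 1)/q.\<close>

lemma power_primitive_convex:
  assumes q: "0 < q"
  shows "signed_power q b * (a - b) \<le> power_primitive q a - power_primitive q b"
proof -
  have "\<bar>a\<bar> * (\<bar>b\<bar> powr q) \<le> \<bar>a\<bar> powr (q + 1) / (q + 1) + (\<bar>b\<bar> powr q) powr ((q + 1) / q) / ((q + 1) / q)"
    using q by (intro Youngs_inequality) (auto simp: field_simps)
  moreover have "(\<bar>b\<bar> powr q) powr ((q + 1) / q) / ((q + 1) / q) = \<bar>b\<bar> powr (q + 1) - \<bar>b\<bar> powr (q + 1) / (q + 1)"
  proof -
    have "(\<bar>b\<bar> powr q) powr ((q + 1) / q) = \<bar>b\<bar> powr (q + 1)" using q by (simp add: powr_powr)
    then show ?thesis using q by (simp add: field_simps)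
  qed
  moreover have "signed_power q b * a \<le> \<bar>a\<bar> * (\<bar>b\<bar> powr q)"
    using abs_signed_power[OF q, of b] by (metis abs_ge_self abs_mult mult.commute)
  moreover have "signed_power q b * b = \<bar>b\<bar> powr (q + 1)"
    by (cases "b = 0") (auto simp: signed_power_def powr_diff powr_add abs_if)
  ultimately show ?thesis by (simp add: power_primitive_def algebra_simps)
qed

text \<open>For v < k this is the integral over [v, k] of \<open>signed_power q\<close> minus its
  value at v. Formally its time derivative along v is -(d/dt \<open>signed_power q v\<close>) * (k -
  v), which is the time term produced by testing with the truncation (k - v)^+.\<close>

definition truncation_energy :: "real \<Rightarrow> real \<Rightarrow> real \<Rightarrow> real"
  where "truncation_energy q k v =
    (if v < k then power_primitive q k - power_primitive q v - signed_power q v * (k - v) else 0)"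

lemma truncation_energy_nonneg: "0 < q \<Longrightarrow> 0 \<le> truncation_energy q k v"
  using power_primitive_convex[of q v k] by (simp add: truncation_energy_def)

text \<open>A discrete chain rule, in which a is the later and b the earlier value. For a, b < k the
  two sides differ by the divergence between a and b, which is nonnegative by
  \<open>power_primitive_convex\<close>; for b \<ge> k monotonicity allows b to be replaced by
  k.\<close>

lemma truncation_energy_chain:
  assumes q: "0 < q"
  shows "(signed_power q a - signed_power q b) * max 0 (k - a) \<le> truncation_energy q k b - truncation_energy q k a"
proof (cases "a < k")
  case True
  show ?thesis
  proof (cases "b < k")
    case True
    with \<open>a < k\<close> show ?thesis using power_primitive_convex[OF q, of b a]
      by (simp add: truncation_energy_def algebra_simps)
  next
    case False
    have "signed_power q k \<le> signed_power q b" using False q by (simp add: signed_power_mono)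
    then have "signed_power q k * (k - a) \<le> signed_power q b * (k - a)"
      using \<open>a < k\<close> by (intro mult_right_mono) auto
    with \<open>a < k\<close> False show ?thesis using power_primitive_convex[OF q, of k a]
      by (simp add: truncation_energy_def algebra_simps)
  qed
next
  case False
  then have "truncation_energy q k a = 0" "max 0 (k - a) = 0" by (auto simp: truncation_energy_def)
  then show ?thesis using truncation_energy_nonneg[OF q, of k b] by simp
qed

lemma truncation_energy_le:
  assumes q: "0 < q" and "\<bar>v\<bar> \<le> M" "\<bar>k\<bar> \<le> M"
  shows "truncation_energy q k v \<le> 4 * M * M powr q"
proof (cases "v < k")
  case True
  have M: "0 \<le> M" using assms by linarith
  have "truncation_energy q k v \<le> (signed_power q k - signed_power q v) * (k - v)"
    using power_primitive_convex[OF q, of k v] True by (simp add: truncation_energy_def algebra_simps)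
  also have "\<dots> \<le> (M powr q + M powr q) * (M + M)"
  proof (intro mult_mono)
    have "\<bar>signed_power q k\<bar> \<le> M powr q" "\<bar>signed_power q v\<bar> \<le> M powr q"
      using assms by (auto simp: abs_signed_power intro!: powr_mono2)
    then show "signed_power q k - signed_power q v \<le> M powr q + M powr q" by linarith
  qed (use assms True in auto)
  finally show ?thesis by (simp add: algebra_simps)
qed (use assms in \<open>simp add: truncation_energy_def\<close>)

text \<open>Cutting at the midpoint m of v and k: the slope increases by a definite amount between v
  and m, and this increase acts over the remaining half [m, k]. The first factor costs the power q +
  1 of the gap, the second one more.\<close>

lemma truncation_energy_ge:
  assumes q: "0 < q" and v: "\<bar>v\<bar> \<le> M" "\<bar>k\<bar> \<le> M" and d: "0 < d" "v \<le> k - d"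
  shows "min 1 q * (d / 4) powr (q + 2) / M \<le> truncation_energy q k v"
proof -
  define m where "m = (v + k) / 2"
  have M: "0 < M" using v d by linarith
  have "(signed_power q m - signed_power q v) * (k - v) / 2 \<le> truncation_energy q k v"
    using power_primitive_convex[OF q, of m k] power_primitive_convex[OF q, of v m] d
    by (simp add: truncation_energy_def m_def field_simps)
  moreover have "min 1 q * ((m - v) / 2) powr (q + 1) / M \<le> signed_power q m - signed_power q v"
    using v d by (intro signed_power_diff_ge q) (auto simp: m_def)
  moreover have "min 1 q * (d / 4) powr (q + 1) / M \<le> min 1 q * ((m - v) / 2) powr (q + 1) / M"
    using q M d by (intro divide_right_mono mult_left_mono powr_mono2) (auto simp: m_def)
  ultimately have "(min 1 q * (d / 4) powr (q + 1) / M) * (d / 4) \<le> (signed_power q m - signed_power q v) * ((k - v) / 2)"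
    using d q M v by (intro mult_mono) (auto simp: m_def intro!: signed_power_mono)
  then show ?thesis
    using \<open>(signed_power q m - signed_power q v) * (k - v) / 2 \<le> truncation_energy q k v\<close> d
    by (simp add: powr_add field_simps power2_eq_square)
qed

text \<open>Only a positive left side needs an estimate, and by wy \<le> wx it forces zx < zy. If zx
  is far below zy, then zy itself is at most 2 |zx - zy| and crude bounds do. Otherwise the two
  cutoff values are comparable, and positivity bounds the jump d = wx - wy in terms of |zx - zy|.
  The exponent p on the cutoff makes the powers match: \<open>zy powr (p - 1)\<close> pairs with
  \<open>d powr (p - 1)\<close>.\<close>

lemma signed_power_product_core:
  fixes p zx zy wx wy L :: real
  assumes p: "1 < p" and z: "0 \<le> zx" "zx \<le> 1" "0 \<le> zy" "zy \<le> 1"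
    and w: "0 \<le> wy" "wy \<le> wx" "wx \<le> L"
  shows "(wx - wy) powr (p - 1) * (wy * zy powr p - wx * zx powr p) \<le> ((2 powr p * p) * L * \<bar>zx - zy\<bar>) powr p"
    (is "?T \<le> ?R")
proof (cases "?T \<le> 0")
  case True then show ?thesis by (meson order_trans powr_ge_zero)
next
  case False
  define d where "d = wx - wy"
  define e where "e = zy - zx"
  have d: "0 < d" using False w p by (cases "wx = wy") (auto simp: d_def)
  have L: "0 < L" using d w unfolding d_def by linarith
  have C1: "1 \<le> 2 powr p" using p by (simp add: ge_one_powr_ge_zero)
  have C2: "2 \<le> 2 powr p" using powr_mono[of 1 p 2] p by simp
  have C: "2 powr p \<le> 2 powr p * p" "2 \<le> 2 powr p * p" "p \<le> 2 powr p * p"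
    using p C1 C2 mult_mono[of 1 "2 powr p" p p] mult_mono[of 2 "2 powr p" 1 p] by auto
  have zz: "zx < zy"
  proof (rule ccontr)
    assume "\<not> zx < zy"
    then have "wy * zy powr p \<le> wx * zx powr p"
      using z w p by (intro mult_mono powr_mono2) auto
    then show False using False by (simp add: mult_nonneg_nonpos)
  qed
  then have e: "0 < e" "\<bar>zx - zy\<bar> = e" "0 < zy" using z by (auto simp: e_def)
  show ?thesis
  proof (cases "zx < zy / 2")
    case True
    have "?T \<le> d powr (p - 1) * (wy * zy powr p)"
      unfolding d_def using w by (intro mult_left_mono) auto
    also have "\<dots> \<le> L powr (p - 1) * (L * (2 * e) powr p)"
      using w L p True z by (intro mult_mono powr_mono2) (auto simp: d_def e_def)
    also have "\<dots> = (2 * L * e) powr p"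
      using L e by (simp add: powr_diff powr_mult)
    also have "\<dots> \<le> ?R"
      unfolding e(2) using L e p C by (intro powr_mono2 mult_right_mono) auto
    finally show ?thesis .
  next
    case z2: False
    have mvt: "zy powr p - zx powr p \<le> p * zy powr (p - 1) * e"
    proof -
      have "0 < zx" using z2 e by linarith
      then have "\<exists>\<xi>>zx. \<xi> < zy \<and> zy powr p - zx powr p = (zy - zx) * (p * \<xi> powr (p - 1))"
        using zz by (intro MVT2) (auto intro!: derivative_eq_intros simp: powr_diff field_simps)
      then obtain \<xi> where \<xi>: "zx < \<xi>" "\<xi> < zy" "zy powr p - zx powr p = (zy - zx) * (p * \<xi> powr (p - 1))" by blast
      then have "zy powr p - zx powr p \<le> (zy - zx) * (p * zy powr (p - 1))"
        using z p zz by (auto intro!: mult_left_mono powr_mono2)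
      then show ?thesis by (simp add: e_def algebra_simps)
    qed
    have T: "?T = d powr (p - 1) * (wy * (zy powr p - zx powr p) - d * zx powr p)"
      by (simp add: d_def algebra_simps)
    \<comment> \<open>Positivity of the left side says that d * \<open>zx powr p\<close> is less
      than wy * (\<open>zy powr p\<close> - \<open>zx powr p\<close>). After division by
      \<open>zy powr (p - 1)\<close> this bounds d * zy.\<close>
    have "d * (zy / 2) powr p \<le> d * zx powr p"
      using d z2 e p by (intro mult_left_mono powr_mono2) auto
    also have "\<dots> < wy * (zy powr p - zx powr p)"
      using False unfolding T by (simp add: not_le zero_less_mult_iff)
    also have "\<dots> \<le> L * (p * zy powr (p - 1) * e)"
      using mvt w L p zz z by (intro mult_mono) (auto intro!: powr_mono2)
    finally have "d * (zy / 2) powr p < L * (p * zy powr (p - 1) * e)" .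
    then have "d * zy \<le> (2 powr p * p) * L * e"
      using e by (simp add: powr_divide powr_diff field_simps)
    then have X: "(d * zy) powr (p - 1) \<le> ((2 powr p * p) * L * e) powr (p - 1)"
      using d e p by (intro powr_mono2) auto
    have "?T \<le> d powr (p - 1) * (wy * (zy powr p - zx powr p))"
      unfolding T using d by (intro mult_left_mono) auto
    also have "\<dots> \<le> d powr (p - 1) * (L * (p * zy powr (p - 1) * e))"
      using mvt w L p zz z d by (intro mult_left_mono mult_mono) (auto intro!: powr_mono2)
    also have "\<dots> = (d * zy) powr (p - 1) * (p * L * e)"
      using d e by (simp add: powr_mult)
    also have "\<dots> \<le> ((2 powr p * p) * L * e) powr (p - 1) * ((2 powr p * p) * L * e)"
      using X p L e C by (intro mult_mono X mult_right_mono) auto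
    also have "\<dots> = ?R" using p L e by (simp add: powr_diff)
    finally show ?thesis .
  qed
qed

text \<open>The first summand on the left is the only part of the energy the iteration needs: it is
  already coercive, because a function with small support pays for the jump to zero.\<close>

lemma caccioppoli_pointwise:
  fixes k a b zx zy L p :: real
  assumes p: "1 < p" and z: "0 \<le> zx" "zx \<le> 1" "0 \<le> zy" "zy \<le> 1"
    and ab: "k - a \<le> L" "k - b \<le> L"
  shows "(if a < k \<and> 0 < zx \<and> \<not> (b < k \<and> 0 < zy) then ((k - a) * zx) powr p else 0)
      + signed_power (p - 1) (a - b) * (max 0 (k - a) * zx powr p - max 0 (k - b) * zy powr p)
    \<le> (if (a < k \<and> 0 < zx) \<or> (b < k \<and> 0 < zy)
        then 2 * ((2 powr p * p) * L * \<bar>zx - zy\<bar>) powr p else 0)"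
proof -
  let ?C = "2 powr p * p"
  have C: "1 \<le> ?C" using p mult_mono[of 1 "2 powr p" 1 p] by (auto simp: ge_one_powr_ge_zero)
  define R where "R = (?C * L * \<bar>zx - zy\<bar>) powr p"
  have R: "0 \<le> R" by (simp add: R_def)
  show ?thesis
  proof (cases "a < k"; cases "b < k")
    assume a: "a < k" and b: "b < k"
    have L: "0 < L" using a ab by linarith
    have core: "signed_power (p - 1) (a - b) * ((k - a) * zx powr p - (k - b) * zy powr p) \<le> R"
    proof (cases "a \<le> b")
      case True
      have "signed_power (p - 1) (a - b) = - ((b - a) powr (p - 1))"
        using signed_power_minus[of "p - 1" "b - a"] True p by (simp add: signed_power_nonneg_eq)
      then show ?thesis
        using signed_power_product_core[of p zx zy "k - b" "k - a" L] assms a b True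
        unfolding R_def by (simp add: algebra_simps)
    next
      case False
      have "signed_power (p - 1) (a - b) = (a - b) powr (p - 1)"
        using False p by (simp add: signed_power_nonneg_eq)
      then show ?thesis
        using signed_power_product_core[of p zy zx "k - a" "k - b" L] assms a b False
        unfolding R_def by (simp add: algebra_simps abs_minus_commute)
    qed
    \<comment> \<open>With both values below k the kept summand is active only for zy = 0, and then
      |zx - zy| = zx. It costs a second copy of R, hence the factor 2 in the statement.\<close>
    have good: "((k - a) * zx) powr p \<le> R" if "zy = 0"
    proof -
      have "(k - a) * zx \<le> L * zx" using ab z by (intro mult_right_mono) auto
      also have "\<dots> = 1 * (L * \<bar>zx - zy\<bar>)" using that z by simp
      also have "\<dots> \<le> ?C * (L * \<bar>zx - zy\<bar>)" using C L by (intro mult_right_mono) auto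
      finally show ?thesis unfolding R_def using z a p by (intro powr_mono2) (auto simp: mult.assoc)
    qed
    show ?thesis
    proof (cases "0 < zx \<or> 0 < zy")
      case True
      then show ?thesis
        using a b core good z R unfolding R_def[symmetric] by (auto simp: not_less max_def)
    next
      case False
      then have "zx = 0" "zy = 0" using z by auto
      then show ?thesis using p by simp
    qed
  next
    assume a: "a < k" and b: "\<not> b < k"
    have sp: "signed_power (p - 1) (a - b) = - ((b - a) powr (p - 1))"
      using signed_power_minus[of "p - 1" "b - a"] a b p by (simp add: signed_power_nonneg_eq)
    \<comment> \<open>Here lies the coercivity: b is at least k, so b - a \<ge> k - a and the energy
      itself dominates the kept summand.\<close>
    have "((k - a) * zx) powr p = (k - a) powr (p - 1) * ((k - a) * zx powr p)"
      using a z by (simp add: powr_mult powr_diff)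
    also have "\<dots> \<le> (b - a) powr (p - 1) * ((k - a) * zx powr p)"
      using a b p by (intro mult_right_mono powr_mono2) auto
    finally show ?thesis using a b R sp z unfolding R_def[symmetric]
      by (auto simp: max_def mult_nonneg_nonneg)
  next
    assume a: "\<not> a < k" and b: "b < k"
    have "0 \<le> signed_power (p - 1) (a - b) * ((k - b) * zy powr p)"
      using a b by (intro mult_nonneg_nonneg signed_power_nonneg) auto
    then show ?thesis using a b R unfolding R_def[symmetric] by (auto simp: max_def)
  next
    assume a: "\<not> a < k" and b: "\<not> b < k"
    then show ?thesis by (auto simp: max_def)
  qed
qed

text \<open>The induction carries Y j \<le> A * g^j with g = \<open>b powr (- 1 / al)\<close>: the
  factor \<open>(g ^ j) powr al\<close> cancels the growing b^j, and A is chosen so that C *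
  \<open>A powr al\<close> = g supplies the next power of g.\<close>

lemma fast_geometric_convergence:
  fixes Y :: "nat \<Rightarrow> real"
  assumes C: "0 < C" and b: "1 < b" and al: "0 < al"
    and Y: "\<And>j. 0 \<le> Y j" and step: "\<And>j. Y (Suc j) \<le> C * b ^ j * Y j powr (1 + al)"
    and Y0: "Y 0 \<le> C powr (- 1 / al) * b powr (- 1 / al\<^sup>2)"
  shows "Y \<longlonglongrightarrow> 0"
proof -
  define A where "A = C powr (- 1 / al) * b powr (- 1 / al\<^sup>2)"
  define g where "g = b powr (- 1 / al)"
  have A: "0 < A" using C b by (simp add: A_def)
  have g: "0 < g" "g < 1" using b al by (auto simp: g_def powr_less_one)
  have Aal: "A powr al = g / C"
  proof -
    have "A powr al = (C powr (- 1 / al)) powr al * (b powr (- 1 / al\<^sup>2)) powr al"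
      unfolding A_def by (simp add: powr_mult)
    also have "(C powr (- 1 / al)) powr al = C powr (-1)" using al by (simp add: powr_powr)
    also have "(b powr (- 1 / al\<^sup>2)) powr al = g" using al by (simp add: powr_powr g_def power2_eq_square)
    finally show ?thesis using C by (simp add: powr_minus field_simps)
  qed
  have gal: "(g ^ j) powr al = inverse (b ^ j)" for j
  proof -
    have "(g ^ j) powr al = (g powr real j) powr al" using g by (simp add: powr_realpow)
    also have "\<dots> = b powr (- real j)" using al by (simp add: g_def powr_powr)
    finally show ?thesis using b by (simp add: powr_minus powr_realpow)
  qed
  have "Y j \<le> A * g ^ j" for j
  proof (induction j)
    case 0 then show ?case using Y0 by (simp add: A_def)
  next
    case (Suc j)
    have "Y (Suc j) \<le> C * b ^ j * Y j powr (1 + al)" by (rule step)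
    also have "\<dots> \<le> C * b ^ j * (A * g ^ j) powr (1 + al)"
      using Suc Y C b al by (intro mult_left_mono powr_mono2) auto
    also have "(A * g ^ j) powr (1 + al) = (A * g ^ j) * (A powr al * (g ^ j) powr al)"
      using A g by (simp add: powr_add powr_mult)
    also have "C * b ^ j * \<dots> = A * g ^ Suc j"
      unfolding Aal gal using C b by (simp add: field_simps)
    finally show ?case .
  qed
  moreover have "(\<lambda>j. A * g ^ j) \<longlonglongrightarrow> 0"
    using g by (intro tendsto_mult_right_zero LIMSEQ_power_zero) auto
  ultimately show ?thesis
    using Y by (intro tendsto_sandwich[of "\<lambda>_. 0" Y _ "\<lambda>j. A * g ^ j"]) auto
qed

section \<open>Measurability and Tonelli's theorem for curried functions\<close>

lemma measurable_compose2:
  assumes f: "case_prod f \<in> borel_measurable (borel \<Otimes>\<^sub>M borel)"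
    and g: "g \<in> M \<rightarrow>\<^sub>M borel" and h: "h \<in> M \<rightarrow>\<^sub>M borel"
  shows "(\<lambda>w. f (g w) (h w)) \<in> borel_measurable M"
  using measurable_compose[OF measurable_Pair[OF g h] f] by simp

text \<open>Like its binary form, this is instantiated with one fixed function and then declared
  \<open>measurable\<close>, so that measurability of expressions in curried U, G and \<kappa> is
  decided automatically.\<close>

lemma measurable_compose3:
  assumes f: "(\<lambda>(x, y, t). f x y t) \<in> borel_measurable (borel \<Otimes>\<^sub>M borel \<Otimes>\<^sub>M borel)"
    and g: "g \<in> M \<rightarrow>\<^sub>M borel" and h: "h \<in> M \<rightarrow>\<^sub>M borel" and k: "k \<in> M \<rightarrow>\<^sub>M borel"
  shows "(\<lambda>w. f (g w) (h w) (k w)) \<in> borel_measurable M"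
  using measurable_compose[OF measurable_Pair[OF g measurable_Pair[OF h k]] f] by simp

lemma nn_integral_lborel_pair:
  fixes f :: "'b::euclidean_space \<Rightarrow> 'c::euclidean_space \<Rightarrow> ennreal"
  assumes "case_prod f \<in> borel_measurable (borel \<Otimes>\<^sub>M borel)"
  shows "(\<integral>\<^sup>+z. f (fst z) (snd z) \<partial>lborel) = (\<integral>\<^sup>+x. \<integral>\<^sup>+y. f x y \<partial>lborel \<partial>lborel)"
    and "(\<integral>\<^sup>+z. f (fst z) (snd z) \<partial>lborel) = (\<integral>\<^sup>+y. \<integral>\<^sup>+x. f x y \<partial>lborel \<partial>lborel)"
proof -
  have f: "case_prod f \<in> borel_measurable (lborel \<Otimes>\<^sub>M lborel)" using assms by simp
  show "(\<integral>\<^sup>+z. f (fst z) (snd z) \<partial>lborel) = (\<integral>\<^sup>+x. \<integral>\<^sup>+y. f x y \<partial>lborel \<partial>lborel)"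
    using lborel.nn_integral_fst[OF f] by (simp add: lborel_prod[symmetric] case_prod_beta')
  show "(\<integral>\<^sup>+z. f (fst z) (snd z) \<partial>lborel) = (\<integral>\<^sup>+y. \<integral>\<^sup>+x. f x y \<partial>lborel \<partial>lborel)"
    using lborel_pair.nn_integral_snd[OF f] by (simp add: lborel_prod[symmetric] case_prod_beta')
qed

lemma nn_integral_lborel_swap:
  fixes f :: "'b::euclidean_space \<Rightarrow> 'c::euclidean_space \<Rightarrow> ennreal"
  assumes "case_prod f \<in> borel_measurable (borel \<Otimes>\<^sub>M borel)"
  shows "(\<integral>\<^sup>+x. \<integral>\<^sup>+y. f x y \<partial>lborel \<partial>lborel) = (\<integral>\<^sup>+y. \<integral>\<^sup>+x. f x y \<partial>lborel \<partial>lborel)"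
  using nn_integral_lborel_pair[OF assms] by simp

lemma nn_integral_lborel_triple:
  fixes f :: "'b::euclidean_space \<Rightarrow> 'c::euclidean_space \<Rightarrow> 'd::euclidean_space \<Rightarrow> ennreal"
  assumes m: "(\<lambda>(x, y, t). f x y t) \<in> borel_measurable (borel \<Otimes>\<^sub>M borel \<Otimes>\<^sub>M borel)"
  shows "(\<integral>\<^sup>+(x, y, t). f x y t \<partial>lborel) = (\<integral>\<^sup>+x. \<integral>\<^sup>+y. \<integral>\<^sup>+t. f x y t \<partial>lborel \<partial>lborel \<partial>lborel)"
    and "(\<integral>\<^sup>+(x, y, t). f x y t \<partial>lborel) = (\<integral>\<^sup>+t. \<integral>\<^sup>+x. \<integral>\<^sup>+y. f x y t \<partial>lborel \<partial>lborel \<partial>lborel)"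
    and "(\<integral>\<^sup>+(x, y, t). f x y t \<partial>lborel) = (\<integral>\<^sup>+y. \<integral>\<^sup>+x. \<integral>\<^sup>+t. f x y t \<partial>lborel \<partial>lborel \<partial>lborel)"
proof -
  note [measurable] = measurable_compose3[OF m]
  have "(\<integral>\<^sup>+(x, y, t). f x y t \<partial>lborel) = (\<integral>\<^sup>+x. \<integral>\<^sup>+z. f x (fst z) (snd z) \<partial>lborel \<partial>lborel)"
    using nn_integral_lborel_pair(1)[of "\<lambda>x z. f x (fst z) (snd z)"]
    by (simp add: case_prod_beta' borel_prod[symmetric])
  also have "\<dots> = (\<integral>\<^sup>+x. \<integral>\<^sup>+y. \<integral>\<^sup>+t. f x y t \<partial>lborel \<partial>lborel \<partial>lborel)"
    by (subst nn_integral_lborel_pair(1)) auto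
  finally show 1: "(\<integral>\<^sup>+(x, y, t). f x y t \<partial>lborel) = (\<integral>\<^sup>+x. \<integral>\<^sup>+y. \<integral>\<^sup>+t. f x y t \<partial>lborel \<partial>lborel \<partial>lborel)" .
  note 1
  also have "(\<integral>\<^sup>+x. \<integral>\<^sup>+y. \<integral>\<^sup>+t. f x y t \<partial>lborel \<partial>lborel \<partial>lborel) = (\<integral>\<^sup>+x. \<integral>\<^sup>+t. \<integral>\<^sup>+y. f x y t \<partial>lborel \<partial>lborel \<partial>lborel)"
    by (intro nn_integral_cong nn_integral_lborel_swap) simp
  also have "\<dots> = (\<integral>\<^sup>+t. \<integral>\<^sup>+x. \<integral>\<^sup>+y. f x y t \<partial>lborel \<partial>lborel \<partial>lborel)"
    by (intro nn_integral_lborel_swap) simp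
  finally show "(\<integral>\<^sup>+(x, y, t). f x y t \<partial>lborel) = (\<integral>\<^sup>+t. \<integral>\<^sup>+x. \<integral>\<^sup>+y. f x y t \<partial>lborel \<partial>lborel \<partial>lborel)" .
  show "(\<integral>\<^sup>+(x, y, t). f x y t \<partial>lborel) = (\<integral>\<^sup>+y. \<integral>\<^sup>+x. \<integral>\<^sup>+t. f x y t \<partial>lborel \<partial>lborel \<partial>lborel)"
    unfolding 1 by (intro nn_integral_lborel_swap) simp
qed

lemma nn_integral_lborel_affine:
  fixes f :: "'a::euclidean_space \<Rightarrow> ennreal"
  assumes [measurable]: "f \<in> borel_measurable borel" and c: "c \<noteq> 0"
  shows "(\<integral>\<^sup>+x. f x \<partial>lborel) = ennreal (\<bar>c\<bar> ^ DIM('a)) * (\<integral>\<^sup>+x. f (t + c *\<^sub>R x) \<partial>lborel)"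
  by (subst lborel_affine[OF c, of t])
     (simp add: nn_integral_density nn_integral_distr nn_integral_cmult)

lemma nn_integral_lborel_shift:
  fixes f :: "'a::euclidean_space \<Rightarrow> ennreal"
  assumes "f \<in> borel_measurable borel"
  shows "(\<integral>\<^sup>+x. f (x + t) \<partial>lborel) = (\<integral>\<^sup>+x. f x \<partial>lborel)"
  using nn_integral_lborel_affine[OF assms, of 1 t] by (simp add: add.commute)

lemma nn_integral_lborel_reflect:
  fixes f :: "'a::euclidean_space \<Rightarrow> ennreal"
  assumes "f \<in> borel_measurable borel"
  shows "(\<integral>\<^sup>+x. f (t - x) \<partial>lborel) = (\<integral>\<^sup>+x. f x \<partial>lborel)"
  using nn_integral_lborel_affine[OF assms, of "-1" t] by simp

section \<open>The Gagliardo kernel\<close>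

lemma le_suminf_ennreal: "f k \<le> (\<Sum>i. f i :: ennreal)"
  using sum_le_suminf[of f "{k}"] by (simp add: summableI)

text \<open>Dyadic shells. Each shell is enlarged to a ball, whose volume is explicit; the resulting
  geometric series have ratio \<open>2 powr (- g)\<close> at infinity and
  \<open>2 powr (- (p - g))\<close> at the origin, which is where 0 < g < p enters.\<close>

lemma truncated_kernel_finite:
  fixes p g :: real
  assumes g: "0 < g" "g < p"
  shows "(\<integral>\<^sup>+(z::'a::euclidean_space). ennreal (min 1 (norm z powr p) / norm z powr (real DIM('a) + g)) \<partial>lborel) < \<infinity>"
proof -
  define n where "n = real DIM('a)"
  have n: "0 < n" by (simp add: n_def)
  define f where "f z = min 1 (norm z powr p) / norm z powr (n + g)" for z :: 'a
  define a where "a k = 2 powr (- real k * (n + g))" for k :: nat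
  \<comment> \<open>The bound for \<open>norm z powr (p - g - n)\<close> on 2^-(k+1) < norm z \<le>
    2^-k takes the outer radius for the exponent p - g and the inner one for -n, so p - g - n may
    have either sign.\<close>
  define b where "b k = 2 powr (- real k * (p - g)) * 2 powr ((real k + 1) * n)" for k :: nat
  define F where "F k z = ennreal (a k) * indicator (cball 0 (2 ^ (k + 1))) z + ennreal (b k) * indicator (cball 0 (1 / 2 ^ k)) z"
    for k and z :: 'a
  have [measurable]: "cball (0::'a) R \<in> sets borel" for R by simp
  have [measurable]: "F k \<in> borel_measurable lborel" for k unfolding F_def by measurable
  have vol: "emeasure lborel (cball (0::'a) R) = ennreal (unit_ball_vol n * R powr n)" if "0 < R" for R
    using that emeasure_cball[of R "0::'a"] by (simp add: n_def powr_realpow)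
  have pw: "(2::real) powr (real k) = 2 ^ k" for k by (simp add: powr_realpow)
  have ptw: "ennreal (f z) \<le> (\<Sum>k. F k z)" for z
  proof (cases "z = 0")
    case True then show ?thesis using n g by (simp add: f_def)
  next
    case False
    define N where "N = norm z"
    have N: "0 < N" using False by (simp add: N_def)
    show ?thesis
    proof (cases "1 \<le> N")
      case True
      define k where "k = nat \<lfloor>log 2 N\<rfloor>"
      have "0 \<le> \<lfloor>log 2 N\<rfloor>" using True by simp
      then have "\<lfloor>log 2 N\<rfloor> = int k" by (simp add: k_def)
      then have k: "2 powr real k \<le> N" "N < 2 powr (real k + 1)"
        using floor_log_eq_powr_iff[of N 2 "int k"] N by auto
      have "f z \<le> 1 / N powr (n + g)"
        unfolding f_def N_def[symmetric] by (intro divide_right_mono) auto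
      also have "\<dots> \<le> 1 / (2 powr real k) powr (n + g)"
        using k n g by (intro divide_left_mono powr_mono2 mult_pos_pos) (auto simp: N)
      also have "\<dots> = a k" by (simp add: a_def powr_powr powr_minus_divide)
      finally have "ennreal (f z) \<le> ennreal (a k)" by (intro ennreal_leI)
      moreover have "z \<in> cball 0 (2 ^ (k + 1))" using k by (simp add: N_def powr_add pw)
      ultimately have "ennreal (f z) \<le> F k z" unfolding F_def by (simp add: add_increasing2)
      then show ?thesis using le_suminf_ennreal[of "\<lambda>k. F k z" k] by (rule order_trans)
    next
      case False
      then have N1: "1 < 1 / N" using N by simp
      define k where "k = nat \<lfloor>log 2 (1 / N)\<rfloor>"
      have "0 < log 2 (1 / N)" using N1 N by (subst zero_less_log_cancel_iff) auto
      then have "0 \<le> \<lfloor>log 2 (1 / N)\<rfloor>" by simp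
      then have "\<lfloor>log 2 (1 / N)\<rfloor> = int k" by (simp add: k_def)
      then have "2 powr real k \<le> 1 / N" "1 / N < 2 powr (real k + 1)"
        using floor_log_eq_powr_iff[of "1 / N" 2 "int k"] N by auto
      then have k: "N \<le> 2 powr (- real k)" "2 powr (- (real k + 1)) < N"
        unfolding powr_minus_divide using N by (auto simp: divide_simps mult.commute)
      have "f z \<le> N powr p / N powr (n + g)"
        unfolding f_def N_def[symmetric] by (intro divide_right_mono) auto
      also have "\<dots> = N powr (p - g) * N powr (- n)"
        using N by (simp add: powr_diff powr_add powr_minus field_simps)
      also have "\<dots> \<le> (2 powr (- real k)) powr (p - g) * (2 powr (- (real k + 1))) powr (- n)"
        using k n g N by (intro mult_mono powr_mono2 powr_mono2') auto
      also have "\<dots> = b k" by (simp add: b_def powr_powr algebra_simps)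
      finally have "ennreal (f z) \<le> ennreal (b k)" by (intro ennreal_leI)
      moreover have "z \<in> cball 0 (1 / 2 ^ k)" using k by (simp add: N_def powr_minus pw field_simps)
      ultimately have "ennreal (f z) \<le> F k z" unfolding F_def by (simp add: add_increasing)
      then show ?thesis using le_suminf_ennreal[of "\<lambda>k. F k z" k] by (rule order_trans)
    qed
  qed
  define h where "h k = unit_ball_vol n * 2 powr n * ((2 powr (- g)) ^ k + (2 powr (- (p - g))) ^ k)" for k :: nat
  have int: "(\<integral>\<^sup>+z. F k z \<partial>lborel) = ennreal (h k)" for k
  proof -
    have "(\<integral>\<^sup>+z. F k z \<partial>lborel) = ennreal (a k) * emeasure lborel (cball (0::'a) (2 ^ (k + 1))) + ennreal (b k) * emeasure lborel (cball (0::'a) (1 / 2 ^ k))"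
      unfolding F_def by (subst nn_integral_add) (auto simp: nn_integral_cmult_indicator)
    also have "\<dots> = ennreal (a k * (unit_ball_vol n * (2 ^ (k + 1)) powr n)) + ennreal (b k * (unit_ball_vol n * (1 / 2 ^ k) powr n))"
      by (simp add: vol ennreal_mult' a_def b_def)
    also have "\<dots> = ennreal (a k * (unit_ball_vol n * (2 ^ (k + 1)) powr n) + b k * (unit_ball_vol n * (1 / 2 ^ k) powr n))"
      using n by (intro ennreal_plus[symmetric]) (auto simp: a_def b_def intro!: mult_nonneg_nonneg)
    also have "a k * (unit_ball_vol n * (2 ^ (k + 1)) powr n) = unit_ball_vol n * 2 powr n * (2 powr (- g)) ^ k"
    proof -
      have "(2::real) ^ (k + 1) = 2 powr (real k + 1)" by (simp add: powr_add pw)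
      then have "(2 ^ (k + 1)) powr n = (2::real) powr ((real k + 1) * n)" by (simp only: powr_powr)
      then have "a k * (2 ^ (k + 1)) powr n = 2 powr (- real k * (n + g) + (real k + 1) * n)"
        by (simp only: a_def powr_add)
      also have "\<dots> = 2 powr n * (2 powr (- g)) powr (real k)" by (simp add: powr_powr powr_add[symmetric] algebra_simps)
      finally show ?thesis by (simp add: powr_realpow algebra_simps)
    qed
    also have "b k * (unit_ball_vol n * (1 / 2 ^ k) powr n) = unit_ball_vol n * 2 powr n * (2 powr (- (p - g))) ^ k"
    proof -
      have "(1 / 2 ^ k) powr n = (2::real) powr (- real k * n)"
      proof -
        have "1 / 2 ^ k = (2::real) powr (- real k)" by (simp add: powr_minus_divide pw)
        then show ?thesis by (simp only: powr_powr)
      qed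
      then have "b k * (1 / 2 ^ k) powr n = 2 powr (- real k * (p - g) + (real k + 1) * n + - real k * n)"
        by (simp only: b_def powr_add)
      also have "\<dots> = 2 powr n * (2 powr (- (p - g))) powr (real k)" by (simp add: powr_powr powr_add[symmetric] algebra_simps)
      finally show ?thesis by (simp add: powr_realpow algebra_simps)
    qed
    finally show ?thesis by (simp add: h_def algebra_simps)
  qed
  have "(\<integral>\<^sup>+z. ennreal (f z) \<partial>lborel) \<le> (\<integral>\<^sup>+z. (\<Sum>k. F k z) \<partial>lborel)"
    by (intro nn_integral_mono ptw)
  also have "\<dots> = (\<Sum>k. ennreal (h k))" by (subst nn_integral_suminf) (auto simp: int)
  also have "\<dots> < \<infinity>"
  proof -
    have r: "2 powr (- g) < 1" "2 powr (- (p - g)) < (1::real)"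
      using g powr_less_mono[of "- g" 0 2] powr_less_mono[of "- (p - g)" 0 2] by auto
    have "summable h" unfolding h_def
      using r by (intro summable_mult summable_add summable_geometric) auto
    moreover have "0 \<le> h k" for k
    proof -
      have "0 \<le> unit_ball_vol n" using n by simp
      then show ?thesis unfolding h_def by (intro mult_nonneg_nonneg add_nonneg_nonneg zero_le_power powr_ge_zero)
    qed
    ultimately show ?thesis using ennreal_suminf_neq_top[of h]
      unfolding infinity_ennreal_def less_top[symmetric] by blast
  qed
  finally show ?thesis by (simp add: f_def n_def)
qed

text \<open>The substitution y = x - \<delta> z. Later \<delta> is either the gap between two radii,
  where the integral weighs the cutoff error, or the width of a neighbourhood of the
  diagonal.\<close>

lemma truncated_kernel_scaled:
  fixes p g :: real
  assumes g: "0 < g" "g < p"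
  obtains C where "0 < C" "\<And>(x::'a::euclidean_space) \<delta>. 0 < \<delta> \<Longrightarrow>
     (\<integral>\<^sup>+y. ennreal (min 1 ((norm (x - y) / \<delta>) powr p) / norm (x - y) powr (real DIM('a) + g)) \<partial>lborel)
       \<le> ennreal (C * \<delta> powr (- g))"
proof -
  define n where "n = real DIM('a)"
  define f where "f z = ennreal (min 1 (norm z powr p) / norm z powr (n + g))" for z :: 'a
  obtain C0 where C0: "(\<integral>\<^sup>+z. f z \<partial>lborel) = ennreal C0" "0 \<le> C0"
    using truncated_kernel_finite[OF g, where 'a='a] unfolding f_def n_def
    by (cases "\<integral>\<^sup>+z. f z \<partial>lborel" rule: ennreal_cases) (auto simp: f_def n_def)
  show thesis
  \<comment> \<open>The added 1 makes the constant strictly positive at once.\<close>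
  proof (rule that[of "C0 + 1"])
    show "0 < C0 + 1" using C0 by simp
    fix x :: 'a and d :: real assume d: "0 < d"
    define h where "h z = ennreal (min 1 ((norm z / d) powr p) / norm z powr (n + g))" for z :: 'a
    have [measurable]: "h \<in> borel_measurable borel" "f \<in> borel_measurable borel" unfolding h_def f_def by measurable
    have dd: "d powr (- n - g) = 1 / d powr (n + g)" by (simp add: powr_minus_divide[symmetric])
    have sc: "h (0 + d *\<^sub>R z) = ennreal (d powr (- (n + g))) * f z" for z
      using d by (simp add: h_def f_def powr_mult dd ennreal_mult'[symmetric])
    have "(\<integral>\<^sup>+y. h (x - y) \<partial>lborel) = (\<integral>\<^sup>+z. h z \<partial>lborel)"
      by (rule nn_integral_lborel_reflect) simp
    also have "\<dots> = ennreal (\<bar>d\<bar> ^ DIM('a)) * (\<integral>\<^sup>+z. ennreal (d powr (- (n + g))) * f z \<partial>lborel)"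
      using nn_integral_lborel_affine[of h d 0] d unfolding sc by simp
    also have "\<dots> = ennreal (\<bar>d\<bar> ^ DIM('a) * (d powr (- (n + g)) * C0))"
      using C0 by (simp add: nn_integral_cmult ennreal_mult')
    also have "\<bar>d\<bar> ^ DIM('a) * (d powr (- (n + g)) * C0) = C0 * d powr (- g)"
      using d by (simp add: n_def powr_realpow[symmetric] powr_add[symmetric])
    also have "ennreal (C0 * d powr (- g)) \<le> ennreal ((C0 + 1) * d powr (- g))"
      by (intro ennreal_leI mult_right_mono) auto
    finally show "(\<integral>\<^sup>+y. ennreal (min 1 ((norm (x - y) / d) powr p) / norm (x - y) powr (real DIM('a) + g)) \<partial>lborel) \<le> ennreal ((C0 + 1) * d powr (- g))"
      by (simp add: h_def n_def)
  qed
qed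

text \<open>This replaces the fractional Sobolev inequality: a function supported in a small set pays
  at least this much for jumping to zero.\<close>

lemma kernel_complement_lower_bound:
  fixes x :: "'a::euclidean_space"
  assumes A[measurable]: "A \<in> sets borel" and Am: "emeasure lborel A \<le> ennreal m" and m: "0 < m" and g: "0 < g"
  defines "n \<equiv> real DIM('a)"
  shows "ennreal ((unit_ball_vol n / 2) powr (1 + g / n) * m powr (- g / n))
    \<le> (\<integral>\<^sup>+y. ennreal (1 / norm (x - y) powr (n + g)) * indicator (- A) y \<partial>lborel)"
proof -
  have n: "0 < n" by (simp add: n_def)
  define w where "w = unit_ball_vol n"
  have w: "0 < w" using n by (simp add: w_def)
  \<comment> \<open>The ball of this radius has volume 2 m, so at least volume m of it avoids A, and
    there the kernel is at least \<open>r powr (- (n + g))\<close>.\<close>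
  define r where "r = (2 * m / w) powr (1 / n)"
  have r: "0 < r" using m w by (simp add: r_def)
  have rn: "r powr n = 2 * m / w" using n m w by (simp add: r_def powr_powr)
  \<comment> \<open>The centre is removed because division by zero gives the kernel the value 0
    there.\<close>
  define B where "B = ball x r - {x}"
  have [measurable]: "B \<in> sets borel" by (simp add: B_def)
  have "emeasure lborel B = emeasure lborel (ball x r)"
    unfolding B_def by (intro emeasure_Diff_null_set) auto
  also have "\<dots> = ennreal (2 * m)"
    using r w m rn by (simp add: emeasure_ball powr_realpow n_def w_def less_imp_neq[symmetric])
  finally have B: "emeasure lborel B = ennreal (2 * m)" .
  have "ennreal (2 * m) \<le> emeasure lborel (B - A) + emeasure lborel A"
    unfolding B[symmetric] by (rule order_trans[OF emeasure_mono emeasure_subadditive]) auto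
  also have "\<dots> \<le> emeasure lborel (B - A) + ennreal m" by (intro add_left_mono Am)
  finally have BA: "ennreal m \<le> emeasure lborel (B - A)"
    using m by (cases "emeasure lborel (B - A)" rule: ennreal_cases)
      (auto simp: ennreal_plus[symmetric] simp del: ennreal_plus)
  have ptw: "ennreal (r powr (- (n + g))) * indicator (B - A) y \<le> ennreal (1 / norm (x - y) powr (n + g)) * indicator (- A) y" for y
  proof (cases "y \<in> B - A")
    case True
    then have "0 < norm (x - y)" "norm (x - y) \<le> r" by (auto simp: B_def dist_norm)
    then have "r powr (- (n + g)) \<le> 1 / norm (x - y) powr (n + g)"
      unfolding powr_minus_divide using n g r by (intro divide_left_mono powr_mono2) auto
    then show ?thesis using True by (simp add: ennreal_leI)
  qed simp
  have "ennreal ((w / 2) powr (1 + g / n) * m powr (- g / n)) = ennreal (r powr (- (n + g)) * m)"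
  proof -
    define e where "e = 1 + g / n"
    have "1 / n * (- (n + g)) = - e" using n by (simp add: e_def field_simps)
    then have "r powr (- (n + g)) = (2 * m / w) powr (- e)"
      by (simp add: r_def powr_powr)
    also have "\<dots> = (w / (2 * m)) powr e"
      using m w by (simp add: powr_minus_divide powr_divide powr_mult)
    also have "\<dots> = ((w / 2) / m) powr e" by simp
    also have "\<dots> = (w / 2) powr e * m powr (- e)"
      using m w by (subst powr_divide) (auto simp: powr_minus_divide)
    finally have r1: "r powr (- (n + g)) = (w / 2) powr e * m powr (- e)" .
    have "r powr (- (n + g)) * m = (w / 2) powr e * (m powr (- e) * m powr 1)"
      unfolding r1 using m by simp
    also have "m powr (- e) * m powr 1 = m powr (- g / n)"
      unfolding powr_add[symmetric] by (simp add: e_def)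
    finally have "r powr (- (n + g)) * m = (w / 2) powr (1 + g / n) * m powr (- g / n)"
      by (simp add: e_def)
    then show ?thesis by simp
  qed
  also have "\<dots> = ennreal (r powr (- (n + g))) * ennreal m" using m by (simp add: ennreal_mult')
  also have "\<dots> \<le> ennreal (r powr (- (n + g))) * emeasure lborel (B - A)" by (intro mult_left_mono BA) auto
  also have "\<dots> = (\<integral>\<^sup>+y. ennreal (r powr (- (n + g))) * indicator (B - A) y \<partial>lborel)"
    by (subst nn_integral_cmult_indicator) auto
  also have "\<dots> \<le> (\<integral>\<^sup>+y. ennreal (1 / norm (x - y) powr (n + g)) * indicator (- A) y \<partial>lborel)"
    by (intro nn_integral_mono ptw)
  finally show ?thesis by (simp add: w_def)
qed

section \<open>Steklov averages\<close>

text \<open>Reduction to continuous functions: F is an almost everywhere limit of continuous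
  functions, and clipping these to [-B, B] and cutting them off outside radius R + 1 lets dominated
  convergence upgrade this to L1. For continuous functions of bounded support the claim is dominated
  convergence again, and translation invariance handles the translated approximation error in the
  triangle inequality.\<close>

lemma translation_continuous_L1_seq:
  fixes F :: "'b::euclidean_space \<Rightarrow> real"
  assumes F[measurable]: "F \<in> borel_measurable borel" and B: "\<And>z. \<bar>F z\<bar> \<le> B"
    and R: "\<And>z. R < norm z \<Longrightarrow> F z = 0" and h: "h \<longlonglongrightarrow> 0"
  shows "(\<lambda>n. \<integral>\<^sup>+z. ennreal \<bar>F (z + h n) - F z\<bar> \<partial>lborel) \<longlonglongrightarrow> 0"
proof -
  have [measurable]: "cball (0::'b) r \<in> sets borel" for r by simp
  have B0: "0 \<le> B" using B[of 0] by linarith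
  have "F measurable_on UNIV"
    using F by (subst measurable_on_iff_borel_measurable)
      (auto simp: lebesgue_on_UNIV_eq intro: measurable_completion)
  then obtain N g where N: "negligible N" and g: "\<And>n. continuous_on UNIV (g n)"
    and gl: "\<And>x. x \<notin> N \<Longrightarrow> (\<lambda>n. g n x) \<longlonglongrightarrow> F x"
    by (auto simp: measurable_on_def)
  define cut where "cut z = max 0 (min 1 (R + 1 - norm z))" for z :: 'b
  define G where "G n z = cut z * max (- B) (min B (g n z))" for n z
  have Gc: "continuous_on UNIV (G n)" for n
    unfolding G_def cut_def using g by (intro continuous_intros) auto
  have [measurable]: "G n \<in> borel_measurable borel" for n
    by (intro borel_measurable_continuous_onI Gc)
  have cut: "0 \<le> cut z" "cut z \<le> 1" "norm z \<le> R \<Longrightarrow> cut z = 1" "R + 1 \<le> norm z \<Longrightarrow> cut z = 0" for z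
    by (auto simp: cut_def)
  have GB: "\<bar>G n z\<bar> \<le> B" for n z
  proof -
    have "\<bar>G n z\<bar> \<le> 1 * B" unfolding G_def abs_mult using cut B0 by (intro mult_mono) auto
    then show ?thesis by simp
  qed
  have GR: "G n z = 0" if "R + 1 \<le> norm z" for n z using cut(4)[OF that] by (simp add: G_def)
  have GF: "(\<lambda>n. G n z) \<longlonglongrightarrow> F z" if "z \<notin> N" for z
  proof -
    have "(\<lambda>n. G n z) \<longlonglongrightarrow> cut z * max (- B) (min B (F z))"
      unfolding G_def by (intro tendsto_intros gl that)
    also have "cut z * max (- B) (min B (F z)) = F z"
      using B[of z] R[of z] cut(3)[of z] B0 by (cases "R < norm z") (auto simp: max_def min_def)
    finally show ?thesis .
  qed
  have AEN: "AE z in lborel. z \<notin> N"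
  proof -
    have "N \<in> null_sets lebesgue" using N by (simp add: negligible_iff_null_sets)
    then have "AE z in lebesgue. z \<notin> N" by (rule AE_not_in)
    then show ?thesis by (simp add: AE_completion_iff)
  qed
  have fin: "(\<integral>\<^sup>+z. ennreal (2 * B) * indicator (cball 0 r) (z::'b) \<partial>lborel) < \<infinity>" for r :: real
    using emeasure_lborel_cball_finite[of "0::'b" r]
    by (subst nn_integral_cmult_indicator) (auto simp: ennreal_mult_less_top)
  have GF1: "(\<lambda>n. \<integral>\<^sup>+z. ennreal \<bar>G n z - F z\<bar> \<partial>lborel) \<longlonglongrightarrow> (\<integral>\<^sup>+z. (0::ennreal) \<partial>(lborel::'b measure))"
  proof (rule nn_integral_dominated_convergence[OF _ _ _ _ fin[of "R + 1"]])
    show "AE z in lborel. ennreal \<bar>G n z - F z\<bar> \<le> ennreal (2 * B) * indicator (cball 0 (R + 1)) z" for n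
    proof (intro AE_I2)
      fix z :: 'b
      have "\<bar>G n z - F z\<bar> \<le> 2 * B" using GB[of n z] B[of z] by linarith
      then show "ennreal \<bar>G n z - F z\<bar> \<le> ennreal (2 * B) * indicator (cball 0 (R + 1)) z"
        using GR[of z n] R[of z] by (cases "norm z \<le> R + 1") (auto simp: ennreal_leI)
    qed
    show "AE z in lborel. (\<lambda>n. ennreal \<bar>G n z - F z\<bar>) \<longlonglongrightarrow> 0"
    proof (rule AE_mp[OF AEN], intro AE_I2 impI)
      fix z assume "z \<notin> N"
      then have "(\<lambda>n. \<bar>G n z - F z\<bar>) \<longlonglongrightarrow> \<bar>F z - F z\<bar>" by (intro tendsto_intros GF)
      then show "(\<lambda>n. ennreal \<bar>G n z - F z\<bar>) \<longlonglongrightarrow> 0"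
        using tendsto_ennrealI[of "\<lambda>n. \<bar>G n z - F z\<bar>" "0::real"] by simp
    qed
  qed measurable
  have Gh: "(\<lambda>n. \<integral>\<^sup>+z. ennreal \<bar>G m (z + h n) - G m z\<bar> \<partial>lborel) \<longlonglongrightarrow> 0" for m
  proof -
    \<comment> \<open>Dropping finitely many terms makes all shifts shorter than 1, so that one ball
      of radius R + 2 carries every translate.\<close>
    obtain n0 where n0: "\<And>n. n0 \<le> n \<Longrightarrow> norm (h n) < 1"
      using LIMSEQ_D[OF h, of 1] by auto
    have "(\<lambda>n. \<integral>\<^sup>+z. ennreal \<bar>G m (z + h (n + n0)) - G m z\<bar> \<partial>lborel) \<longlonglongrightarrow> (\<integral>\<^sup>+z. (0::ennreal) \<partial>(lborel::'b measure))"
    proof (rule nn_integral_dominated_convergence[OF _ _ _ _ fin[of "R + 2"]])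
      show "AE z in lborel. ennreal \<bar>G m (z + h (n + n0)) - G m z\<bar> \<le> ennreal (2 * B) * indicator (cball 0 (R + 2)) z" for n
      proof (intro AE_I2)
        fix z :: 'b
        have "\<bar>G m (z + h (n + n0)) - G m z\<bar> \<le> 2 * B" using GB[of m z] GB[of m "z + h (n + n0)"] by linarith
        moreover have "norm (h (n + n0)) < 1" by (rule n0) simp
        then have "R + 1 \<le> norm (z + h (n + n0))" "R + 1 \<le> norm z" if "\<not> norm z \<le> R + 2"
          using that norm_diff_ineq[of z "h (n + n0)"] by linarith+
        then have "G m (z + h (n + n0)) = 0" "G m z = 0" if "\<not> norm z \<le> R + 2"
          using that GR by auto
        ultimately show "ennreal \<bar>G m (z + h (n + n0)) - G m z\<bar> \<le> ennreal (2 * B) * indicator (cball 0 (R + 2)) z"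
          by (cases "norm z \<le> R + 2") (auto simp: ennreal_leI)
      qed
      show "AE z in lborel. (\<lambda>n. ennreal \<bar>G m (z + h (n + n0)) - G m z\<bar>) \<longlonglongrightarrow> 0"
      proof (intro AE_I2)
        fix z :: 'b
        have "(\<lambda>n. z + h (n + n0)) \<longlonglongrightarrow> z + 0"
          by (intro tendsto_intros LIMSEQ_ignore_initial_segment h)
        then have "(\<lambda>n. G m (z + h (n + n0))) \<longlonglongrightarrow> G m (z + 0)"
          using Gc[of m] by (intro isCont_tendsto_compose[of "z + 0" "G m"]) (simp add: continuous_on_eq_continuous_at)
        then have "(\<lambda>n. \<bar>G m (z + h (n + n0)) - G m z\<bar>) \<longlonglongrightarrow> \<bar>G m (z + 0) - G m z\<bar>" by (intro tendsto_intros)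
        then show "(\<lambda>n. ennreal \<bar>G m (z + h (n + n0)) - G m z\<bar>) \<longlonglongrightarrow> 0"
          using tendsto_ennrealI[of "\<lambda>n. \<bar>G m (z + h (n + n0)) - G m z\<bar>" "0::real"] by simp
      qed
    qed measurable
    then show ?thesis by (simp add: LIMSEQ_offset[of _ n0])
  qed
  show ?thesis
  proof (rule tendsto_zero_ennreal)
    fix e :: real assume e: "0 < e"
    have "\<forall>\<^sub>F m in sequentially. (\<integral>\<^sup>+z. ennreal \<bar>G m z - F z\<bar> \<partial>lborel) < ennreal (e / 3)"
      using order_tendstoD(2)[OF GF1, of "ennreal (e / 3)"] e by simp
    then obtain m where m: "(\<integral>\<^sup>+z. ennreal \<bar>G m z - F z\<bar> \<partial>lborel) < ennreal (e / 3)"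
      using eventually_happens'[OF sequentially_bot] by blast
    have "\<forall>\<^sub>F n in sequentially. (\<integral>\<^sup>+z. ennreal \<bar>G m (z + h n) - G m z\<bar> \<partial>lborel) < ennreal (e / 3)"
      using order_tendstoD(2)[OF Gh, of "ennreal (e / 3)"] e by simp
    then show "\<forall>\<^sub>F n in sequentially. (\<integral>\<^sup>+z. ennreal \<bar>F (z + h n) - F z\<bar> \<partial>lborel) < ennreal e"
    proof eventually_elim
      case (elim n)
      have "(\<integral>\<^sup>+z. ennreal \<bar>F (z + h n) - F z\<bar> \<partial>lborel)
          \<le> (\<integral>\<^sup>+z. ennreal \<bar>G m (z + h n) - F (z + h n)\<bar> + (ennreal \<bar>G m (z + h n) - G m z\<bar> + ennreal \<bar>G m z - F z\<bar>) \<partial>lborel)"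
      proof (intro nn_integral_mono)
        fix z
        have tri: "\<bar>a - d\<bar> \<le> \<bar>b - a\<bar> + (\<bar>b - c\<bar> + \<bar>c - d\<bar>)" for a b c d :: real by linarith
        from ennreal_leI[OF tri[of "F (z + h n)" "F z" "G m (z + h n)" "G m z"]]
        show "ennreal \<bar>F (z + h n) - F z\<bar>
            \<le> ennreal \<bar>G m (z + h n) - F (z + h n)\<bar> + (ennreal \<bar>G m (z + h n) - G m z\<bar> + ennreal \<bar>G m z - F z\<bar>)"
          by simp
      qed
      also have "\<dots> = (\<integral>\<^sup>+z. ennreal \<bar>G m (z + h n) - F (z + h n)\<bar> \<partial>lborel)
          + ((\<integral>\<^sup>+z. ennreal \<bar>G m (z + h n) - G m z\<bar> \<partial>lborel) + (\<integral>\<^sup>+z. ennreal \<bar>G m z - F z\<bar> \<partial>lborel))"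
        by (subst nn_integral_add, measurable, subst nn_integral_add, measurable)
      also have "(\<integral>\<^sup>+z. ennreal \<bar>G m (z + h n) - F (z + h n)\<bar> \<partial>lborel) = (\<integral>\<^sup>+z. ennreal \<bar>G m z - F z\<bar> \<partial>lborel)"
        by (rule nn_integral_lborel_shift[of "\<lambda>z. ennreal \<bar>G m z - F z\<bar>"]) measurable
      also have "(\<integral>\<^sup>+z. ennreal \<bar>G m z - F z\<bar> \<partial>lborel) + ((\<integral>\<^sup>+z. ennreal \<bar>G m (z + h n) - G m z\<bar> \<partial>lborel) + (\<integral>\<^sup>+z. ennreal \<bar>G m z - F z\<bar> \<partial>lborel))
          < ennreal (e / 3) + (ennreal (e / 3) + ennreal (e / 3))"
        using m elim by (intro add_strict_mono) auto
      also have "\<dots> = ennreal e" using e by (simp add: ennreal_plus[symmetric] del: ennreal_plus)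
      finally show ?case .
    qed
  qed
qed

text \<open>The average looks forward in time: summation by parts then produces \<open>g(t) (v(t) - v(t - h))\<close>
  with \<open>g\<close> at the later time, the side on which convexity gives the right sign.\<close>

definition steklov_average :: "real \<Rightarrow> (real \<Rightarrow> real) \<Rightarrow> real \<Rightarrow> real"
  where "steklov_average h g t = (LINT \<sigma>:{0..h}|lborel. g (t + \<sigma>)) / h"

lemma set_integrable_bounded_shift:
  fixes g :: "real \<Rightarrow> real"
  assumes [measurable]: "g \<in> borel_measurable borel" and B: "\<And>t. \<bar>g t\<bar> \<le> B"
  shows "set_integrable lborel {a..b} (\<lambda>\<sigma>. g (t + \<sigma>))"
  unfolding set_integrable_def using B
  by (intro integrableI_bounded_set_indicator[where B = B]) (auto simp: emeasure_lborel_Icc_eq)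

lemma steklov_average_diff:
  assumes "f \<in> borel_measurable borel" "\<And>t. \<bar>f t\<bar> \<le> B"
    and "g \<in> borel_measurable borel" "\<And>t. \<bar>g t\<bar> \<le> C"
  shows "steklov_average h (\<lambda>t. f t - g t) t = steklov_average h f t - steklov_average h g t"
  unfolding steklov_average_def
  using set_integrable_bounded_shift[OF assms(1,2)] set_integrable_bounded_shift[OF assms(3,4)]
  by (simp add: set_integral_diff diff_divide_distrib)

lemma steklov_average_const: "0 < h \<Longrightarrow> steklov_average h (\<lambda>_. c) t = c"
  by (simp add: steklov_average_def set_lebesgue_integral_def)

lemma steklov_average_mono:
  assumes "f \<in> borel_measurable borel" "\<And>t. \<bar>f t\<bar> \<le> B"
    and "g \<in> borel_measurable borel" "\<And>t. \<bar>g t\<bar> \<le> C" and h: "0 < h" and le: "\<And>t. f t \<le> g t"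
  shows "steklov_average h f t \<le> steklov_average h g t"
  unfolding steklov_average_def using h
  by (intro divide_right_mono set_integral_mono set_integrable_bounded_shift[OF assms(1,2)]
      set_integrable_bounded_shift[OF assms(3,4)] le) auto

lemma steklov_average_nonneg: "0 < h \<Longrightarrow> (\<And>t. 0 \<le> g t) \<Longrightarrow> 0 \<le> steklov_average h g t"
  unfolding steklov_average_def set_lebesgue_integral_def
  by (intro divide_nonneg_pos integral_nonneg_AE) auto

lemma steklov_average_abs_le:
  assumes "g \<in> borel_measurable borel" "\<And>t. \<bar>g t\<bar> \<le> B" and h: "0 < h"
  shows "\<bar>steklov_average h g t\<bar> \<le> B"
proof -
  have "g t \<le> B" "- B \<le> g t" for t using assms(2)[of t] by auto
  then show ?thesis
    using steklov_average_mono[OF assms(1,2) borel_measurable_const[of B] order_refl h, of t]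
      steklov_average_mono[OF borel_measurable_const[of "- B"] order_refl assms(1,2) h, of t]
    by (simp add: steklov_average_const[OF h])
qed

lemma steklov_average_eq_0:
  assumes "\<And>\<sigma>. 0 \<le> \<sigma> \<Longrightarrow> \<sigma> \<le> h \<Longrightarrow> g (t + \<sigma>) = 0"
  shows "steklov_average h g t = 0"
proof -
  have "(\<lambda>\<sigma>. indicat_real {0..h} \<sigma> *\<^sub>R g (t + \<sigma>)) = (\<lambda>_. 0)"
    using assms by (auto simp: indicator_def)
  then show ?thesis by (simp add: steklov_average_def set_lebesgue_integral_def)
qed

lemma measurable_steklov_average:
  fixes G :: "'b \<Rightarrow> real \<Rightarrow> real"
  assumes G: "case_prod G \<in> borel_measurable (M \<Otimes>\<^sub>M borel)"
  shows "(\<lambda>(x, t). steklov_average h (G x) t) \<in> borel_measurable (M \<Otimes>\<^sub>M borel)"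
proof -
  have "(\<lambda>w. G (fst (fst w)) (snd (fst w) + snd w)) \<in> borel_measurable ((M \<Otimes>\<^sub>M borel) \<Otimes>\<^sub>M lborel)"
  proof -
    have "(\<lambda>w. (fst (fst w), snd (fst w) + snd w)) \<in> (M \<Otimes>\<^sub>M borel) \<Otimes>\<^sub>M lborel \<rightarrow>\<^sub>M M \<Otimes>\<^sub>M (borel::real measure)"
      by measurable
    from measurable_compose[OF this G] show ?thesis by simp
  qed
  then have [measurable]: "(\<lambda>(z, \<sigma>). G (fst z) (snd z + \<sigma>)) \<in> borel_measurable ((M \<Otimes>\<^sub>M borel) \<Otimes>\<^sub>M lborel)"
    by (simp add: case_prod_beta')
  have "(\<lambda>z. LINT \<sigma>|lborel. indicat_real {0..h} \<sigma> *\<^sub>R G (fst z) (snd z + \<sigma>)) \<in> borel_measurable (M \<Otimes>\<^sub>M borel)"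
    by measurable
  then show ?thesis
    unfolding steklov_average_def set_lebesgue_integral_def case_prod_beta' by measurable
qed

text \<open>The tangent of the convex power at c, from Young's inequality with exponents p and p/(p
  - 1). These require p > 1, so p = 1 is treated apart, as is c = 0.\<close>

lemma powr_tangent_ge:
  fixes y c p :: real
  assumes p: "1 \<le> p" and "0 \<le> y" "0 \<le> c"
  shows "c powr p + p * c powr (p - 1) * (y - c) \<le> y powr p"
proof (cases "p = 1 \<or> c = 0")
  case True then show ?thesis using assms by auto
next
  case False
  then have p: "1 < p" and c: "0 < c" using assms by auto
  have "y * c powr (p - 1) \<le> y powr p / p + (c powr (p - 1)) powr (p / (p - 1)) / (p / (p - 1))"
    using p assms by (intro Youngs_inequality) (auto simp: field_simps)
  also have "(c powr (p - 1)) powr (p / (p - 1)) = c powr p" using p by (simp add: powr_powr)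
  finally have "p * (y * c powr (p - 1)) \<le> p * (y powr p / p + c powr p / (p / (p - 1)))"
    using p by (intro mult_left_mono) auto
  also have "\<dots> = y powr p + (p - 1) * c powr p" using p by (simp add: field_simps)
  finally show ?thesis using c by (simp add: powr_diff field_simps)
qed

text \<open>Jensen's inequality by integrating the tangent of y^p at y = c, where c is the modulus
  of the average itself: the linear term has nonnegative integral because c is at most the average
  of the moduli.\<close>

lemma steklov_average_jensen:
  assumes g[measurable]: "g \<in> borel_measurable borel" and B: "\<And>t. \<bar>g t\<bar> \<le> B"
    and h: "0 < h" and p: "1 \<le> p"
  shows "ennreal (\<bar>steklov_average h g t\<bar> powr p)
    \<le> ennreal (1 / h) * (\<integral>\<^sup>+\<sigma>. ennreal (\<bar>g (t + \<sigma>)\<bar> powr p) * indicator {0..h} \<sigma> \<partial>lborel)"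
proof -
  define c where "c = \<bar>steklov_average h g t\<bar>"
  have B0: "0 \<le> B" using B[of 0] by linarith
  have i1: "set_integrable lborel {0..h} (\<lambda>\<sigma>. \<bar>g (t + \<sigma>)\<bar>)"
    using B by (intro set_integrable_bounded_shift[where B = B]) auto
  have i2: "set_integrable lborel {0..h} (\<lambda>\<sigma>. \<bar>g (t + \<sigma>)\<bar> powr p)"
    using B B0 p by (intro set_integrable_bounded_shift[where g = "\<lambda>t. \<bar>g t\<bar> powr p" and B = "B powr p"]) (auto intro!: powr_mono2)
  have i3: "set_integrable lborel {0..h} (\<lambda>\<sigma>. k)" for k :: real
    using set_integrable_bounded_shift[of "\<lambda>_. k" "\<bar>k\<bar>" 0 h 0] by simp
  have k: "(LINT \<sigma>:{0..h}|lborel. k) = h * k" for k :: real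
    using h by (simp add: set_lebesgue_integral_def)
  have "h * c = \<bar>LINT \<sigma>:{0..h}|lborel. g (t + \<sigma>)\<bar>"
    using h by (simp add: c_def steklov_average_def)
  also have "\<dots> \<le> (LINT \<sigma>:{0..h}|lborel. \<bar>g (t + \<sigma>)\<bar>)"
    using set_integral_norm_bound[OF set_integrable_bounded_shift[OF g B, of 0 h t]] by simp
  finally have hc: "h * c \<le> (LINT \<sigma>:{0..h}|lborel. \<bar>g (t + \<sigma>)\<bar>)" .
  have "0 \<le> p * c powr (p - 1) * ((LINT \<sigma>:{0..h}|lborel. \<bar>g (t + \<sigma>)\<bar>) - h * c)"
    using hc p by (intro mult_nonneg_nonneg) auto
  then have "h * c powr p \<le> h * (c powr p - p * c powr (p - 1) * c) + p * c powr (p - 1) * (LINT \<sigma>:{0..h}|lborel. \<bar>g (t + \<sigma>)\<bar>)"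
    by (simp add: algebra_simps)
  also have "\<dots> = (LINT \<sigma>:{0..h}|lborel. (c powr p - p * c powr (p - 1) * c) + p * c powr (p - 1) * \<bar>g (t + \<sigma>)\<bar>)"
    using i1 i3 by (subst set_integral_add) (auto simp: k)
  also have "\<dots> \<le> (LINT \<sigma>:{0..h}|lborel. \<bar>g (t + \<sigma>)\<bar> powr p)"
  proof (intro set_integral_mono set_integral_add set_integrable_mult_right i1 i2 i3)
    show "c powr p - p * c powr (p - 1) * c + p * c powr (p - 1) * \<bar>g (t + \<sigma>)\<bar> \<le> \<bar>g (t + \<sigma>)\<bar> powr p" for \<sigma>
      using powr_tangent_ge[OF p, of "\<bar>g (t + \<sigma>)\<bar>" c] by (simp add: c_def algebra_simps)
  qed
  finally have "c powr p \<le> (1 / h) * (LINT \<sigma>:{0..h}|lborel. \<bar>g (t + \<sigma>)\<bar> powr p)"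
    using h by (simp add: field_simps)
  then have "ennreal (c powr p) \<le> ennreal (1 / h) * ennreal (LINT \<sigma>:{0..h}|lborel. \<bar>g (t + \<sigma>)\<bar> powr p)"
    using h by (simp add: ennreal_mult'[symmetric] ennreal_leI)
  also have "ennreal (LINT \<sigma>:{0..h}|lborel. \<bar>g (t + \<sigma>)\<bar> powr p)
      = (\<integral>\<^sup>+\<sigma>. ennreal (indicat_real {0..h} \<sigma> *\<^sub>R \<bar>g (t + \<sigma>)\<bar> powr p) \<partial>lborel)"
    unfolding set_lebesgue_integral_def using i2
    by (intro nn_integral_eq_integral[symmetric]) (auto simp: set_integrable_def)
  also have "\<dots> = (\<integral>\<^sup>+\<sigma>. ennreal (\<bar>g (t + \<sigma>)\<bar> powr p) * indicator {0..h} \<sigma> \<partial>lborel)"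
    by (intro nn_integral_cong) (auto simp: indicator_def)
  finally show ?thesis by (simp add: c_def)
qed

text \<open>Tonelli and translation invariance. Together with Jensen's inequality this makes Steklov
  averaging a contraction for the energies below.\<close>

lemma nn_integral_average_shift:
  fixes f :: "real \<Rightarrow> ennreal"
  assumes [measurable]: "f \<in> borel_measurable borel" and h: "0 < h"
  shows "(\<integral>\<^sup>+t. ennreal (1 / h) * (\<integral>\<^sup>+\<sigma>. f (t + \<sigma>) * indicator {0..h} \<sigma> \<partial>lborel) \<partial>lborel) = (\<integral>\<^sup>+t. f t \<partial>lborel)"
proof -
  have "(\<integral>\<^sup>+t. ennreal (1 / h) * (\<integral>\<^sup>+\<sigma>. f (t + \<sigma>) * indicator {0..h} \<sigma> \<partial>lborel) \<partial>lborel)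
      = ennreal (1 / h) * (\<integral>\<^sup>+\<sigma>. \<integral>\<^sup>+t. f (t + \<sigma>) * indicator {0..h} \<sigma> \<partial>lborel \<partial>lborel)"
    by (subst nn_integral_cmult) (auto intro!: arg_cong[where f = "\<lambda>c. ennreal (1 / h) * c"] nn_integral_lborel_swap)
  also have "(\<integral>\<^sup>+\<sigma>. \<integral>\<^sup>+t. f (t + \<sigma>) * indicator {0..h} \<sigma> \<partial>lborel \<partial>lborel)
      = (\<integral>\<^sup>+\<sigma>. (\<integral>\<^sup>+t. f t \<partial>lborel) * indicator {0..h} \<sigma> \<partial>lborel)"
    by (intro nn_integral_cong) (simp add: nn_integral_multc nn_integral_lborel_shift)
  also have "\<dots> = (\<integral>\<^sup>+t. f t \<partial>lborel) * ennreal h"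
    using h by (subst nn_integral_cmult_indicator) auto
  also have "ennreal (1 / h) * \<dots> = (\<integral>\<^sup>+t. f t \<partial>lborel) * ennreal (1 / h * h)"
    using h by (subst ennreal_mult') (auto simp: ac_simps)
  finally show ?thesis using h by simp
qed

text \<open>The deviation is at most the mean over 0 \<le> \<sigma> \<le> h of the translation
  errors \<open>W \<sigma>\<close>, and these are small by continuity of translations in L1.\<close>

lemma steklov_average_converges_L1:
  fixes F :: "'b::euclidean_space \<Rightarrow> real \<Rightarrow> real"
  assumes F: "case_prod F \<in> borel_measurable (borel \<Otimes>\<^sub>M borel)" and B: "\<And>x t. \<bar>F x t\<bar> \<le> B"
    and R: "\<And>x t. R < norm (x, t) \<Longrightarrow> F x t = 0"
  shows "((\<lambda>h. \<integral>\<^sup>+z. ennreal \<bar>steklov_average h (F (fst z)) (snd z) - F (fst z) (snd z)\<bar> \<partial>lborel) \<longlongrightarrow> 0) (at_right 0)"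
proof (rule tendsto_zero_ennreal)
  note [measurable] = measurable_compose2[OF F]
  fix e :: real assume e: "0 < e"
  define W where "W \<sigma> = (\<integral>\<^sup>+z. ennreal \<bar>F (fst z) (snd z + \<sigma>) - F (fst z) (snd z)\<bar> \<partial>lborel)" for \<sigma>
  have Wm[measurable]: "W \<in> borel_measurable borel"
  proof -
    have "(\<lambda>(\<sigma>, z). ennreal \<bar>F (fst z) (snd z + \<sigma>) - F (fst z) (snd z)\<bar>) \<in> borel_measurable (borel \<Otimes>\<^sub>M (lborel :: ('b \<times> real) measure))"
      unfolding measurable_cong_sets[OF sets_pair_measure_cong[OF refl sets_lborel] refl]
      by (simp add: borel_prod[symmetric] case_prod_beta')
    from lborel.borel_measurable_nn_integral[OF this] show ?thesis by (simp add: W_def[abs_def])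
  qed
  have W0: "(W \<longlongrightarrow> 0) (at 0)"
    unfolding tendsto_at_iff_sequentially comp_def
  proof (intro allI impI)
    fix X :: "nat \<Rightarrow> real" assume X: "X \<longlonglongrightarrow> 0"
    have "(\<lambda>n. \<integral>\<^sup>+z. ennreal \<bar>(\<lambda>z. F (fst z) (snd z)) (z + (0::'b, X n)) - (\<lambda>z. F (fst z) (snd z)) z\<bar> \<partial>lborel) \<longlonglongrightarrow> 0"
    proof (rule translation_continuous_L1_seq[where B = B and R = R])
      show "(\<lambda>z. F (fst z) (snd z)) \<in> borel_measurable (borel :: ('b \<times> real) measure)"
        by (simp add: borel_prod[symmetric])
      have "(\<lambda>n. (0::'b, X n)) \<longlonglongrightarrow> (0, 0)" by (intro tendsto_intros X)
      then show "(\<lambda>n. (0::'b, X n)) \<longlonglongrightarrow> 0" by (simp add: zero_prod_def)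
    qed (use B R in auto)
    then show "(\<lambda>n. W (X n)) \<longlonglongrightarrow> 0" by (simp add: W_def)
  qed
  have "\<forall>\<^sub>F \<sigma> in at 0. W \<sigma> < ennreal (e / 2)"
    using order_tendstoD(2)[OF W0, of "ennreal (e / 2)"] e by simp
  then obtain d where d: "0 < d" "\<And>\<sigma>. \<sigma> \<noteq> 0 \<Longrightarrow> \<bar>\<sigma>\<bar> < d \<Longrightarrow> W \<sigma> < ennreal (e / 2)"
    by (auto simp: eventually_at dist_real_def)
  have W00: "W 0 = 0" by (simp add: W_def)
  have "(\<integral>\<^sup>+z. ennreal \<bar>steklov_average h (F (fst z)) (snd z) - F (fst z) (snd z)\<bar> \<partial>lborel) < ennreal e"
    if h: "0 < h" "h < d" for h
  proof -
    have ptw: "ennreal \<bar>steklov_average h (F x) t - F x t\<bar>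
        \<le> ennreal (1 / h) * (\<integral>\<^sup>+\<sigma>. ennreal \<bar>F x (t + \<sigma>) - F x t\<bar> * indicator {0..h} \<sigma> \<partial>lborel)" for x t
    proof -
      have b: "\<bar>F x s - F x t\<bar> \<le> 2 * B" for s using B[of x s] B[of x t] by linarith
      have [measurable]: "F x \<in> borel_measurable borel" by measurable
      have "steklov_average h (\<lambda>s. F x s - F x t) t = steklov_average h (F x) t - F x t"
        using steklov_average_diff[of "F x" B "\<lambda>_. F x t" "\<bar>F x t\<bar>"] B steklov_average_const[OF h(1)] by simp
      with steklov_average_jensen[of "\<lambda>s. F x s - F x t" "2 * B" h 1 t] b h show ?thesis by simp
    qed
    have "(\<integral>\<^sup>+z. ennreal \<bar>steklov_average h (F (fst z)) (snd z) - F (fst z) (snd z)\<bar> \<partial>lborel)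
        \<le> (\<integral>\<^sup>+z. ennreal (1 / h) * (\<integral>\<^sup>+\<sigma>. ennreal \<bar>F (fst z) (snd z + \<sigma>) - F (fst z) (snd z)\<bar> * indicator {0..h} \<sigma> \<partial>lborel) \<partial>lborel)"
      by (intro nn_integral_mono ptw)
    also have "\<dots> = ennreal (1 / h) * (\<integral>\<^sup>+z. \<integral>\<^sup>+\<sigma>. ennreal \<bar>F (fst z) (snd z + \<sigma>) - F (fst z) (snd z)\<bar> * indicator {0..h} \<sigma> \<partial>lborel \<partial>lborel)"
      by (intro nn_integral_cmult) (simp add: borel_prod[symmetric])
    also have "(\<integral>\<^sup>+z. \<integral>\<^sup>+\<sigma>. ennreal \<bar>F (fst z) (snd z + \<sigma>) - F (fst z) (snd z)\<bar> * indicator {0..h} \<sigma> \<partial>lborel \<partial>lborel)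
        = (\<integral>\<^sup>+\<sigma>. \<integral>\<^sup>+z. ennreal \<bar>F (fst z) (snd z + \<sigma>) - F (fst z) (snd z)\<bar> * indicator {0..h} \<sigma> \<partial>lborel \<partial>lborel)"
      by (intro nn_integral_lborel_swap) (simp add: borel_prod[symmetric])
    also have "\<dots> = (\<integral>\<^sup>+\<sigma>. W \<sigma> * indicator {0..h} \<sigma> \<partial>lborel)"
      unfolding W_def by (intro nn_integral_cong nn_integral_multc) (simp add: borel_prod[symmetric])
    also have "\<dots> \<le> (\<integral>\<^sup>+\<sigma>. ennreal (e / 2) * indicator {0..h} \<sigma> \<partial>lborel)"
    proof (intro nn_integral_mono)
      fix \<sigma> show "W \<sigma> * indicator {0..h} \<sigma> \<le> ennreal (e / 2) * indicator {0..h} \<sigma>"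
        using d(2)[of \<sigma>] h W00 by (cases "\<sigma> = 0") (auto simp: indicator_def less_imp_le)
    qed
    also have "\<dots> = ennreal (e / 2) * ennreal h" using h by (subst nn_integral_cmult_indicator) auto
    finally have "(\<integral>\<^sup>+z. ennreal \<bar>steklov_average h (F (fst z)) (snd z) - F (fst z) (snd z)\<bar> \<partial>lborel)
        \<le> ennreal (1 / h) * (ennreal (e / 2) * ennreal h)" by (simp add: mult_left_mono)
    also have "\<dots> = ennreal (e / 2)" using h e by (simp add: ennreal_mult'[symmetric])
    also have "\<dots> < ennreal e" using e by (simp add: ennreal_lessI)
    finally show ?thesis .
  qed
  then show "\<forall>\<^sub>F h in at_right 0. (\<integral>\<^sup>+z. ennreal \<bar>steklov_average h (F (fst z)) (snd z) - F (fst z) (snd z)\<bar> \<partial>lborel) < ennreal e"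
    using d(1) by (auto simp: eventually_at_right_field intro!: exI[of _ d])
qed

section \<open>Borel versions of weak supersolutions\<close>

text \<open>Q need not define a measurable set, so Fubini is applied to a Borel null set N
  containing all exceptions.\<close>

lemma AE_lborel_pairD:
  fixes Q :: "'b::euclidean_space \<Rightarrow> 'c::euclidean_space \<Rightarrow> bool"
  assumes "AE z in lborel. Q (fst z) (snd z)"
  shows "AE y in lborel. AE x in lborel. Q x y"
proof -
  obtain N where N: "N \<in> null_sets (lborel :: ('b \<times> 'c) measure)" "{z. \<not> Q (fst z) (snd z)} \<subseteq> N"
    using assms unfolding eventually_ae_filter by auto
  have NQ: "Q x y" if "(x, y) \<notin> N" for x y using N(2) that by (metis (mono_tags, lifting) fst_conv mem_Collect_eq snd_conv subsetD)
  have Ns: "{z \<in> space (lborel \<Otimes>\<^sub>M lborel). (fst z, snd z) \<notin> N} \<in> sets (lborel \<Otimes>\<^sub>M (lborel :: 'c measure))"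
    using N(1) unfolding lborel_prod by auto
  have "AE z in lborel \<Otimes>\<^sub>M lborel. z \<notin> N" unfolding lborel_prod using N(1) by (rule AE_not_in)
  then have "AE x in lborel. AE y in lborel. (x, y) \<notin> N" by (rule lborel_pair.AE_pair)
  then have "AE y in lborel. AE x in lborel. (x, y) \<notin> N" using lborel_pair.AE_commute[OF Ns] by blast
  then show ?thesis using NQ by (auto elim!: eventually_mono)
qed

text \<open>A null set in (x, t) stays null when a free space variable is added; again the argument
  runs on a Borel null set containing the exceptions.\<close>

lemma AE_lborel_tripleI:
  fixes Q :: "'b::euclidean_space \<Rightarrow> 'c::euclidean_space \<Rightarrow> bool"
  assumes "AE z in lborel. Q (fst z) (snd z)"
  shows "AE (x, y, t) in (lborel :: ('b \<times> 'b \<times> 'c) measure). Q x t"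
    and "AE (x, y, t) in (lborel :: ('b \<times> 'b \<times> 'c) measure). Q y t"
proof -
  obtain N where N: "N \<in> null_sets (lborel :: ('b \<times> 'c) measure)" "{z. \<not> Q (fst z) (snd z)} \<subseteq> N"
    using assms unfolding eventually_ae_filter by auto
  have NQ: "Q x y" if "(x, y) \<notin> N" for x y using N(2) that by (metis (mono_tags, lifting) fst_conv mem_Collect_eq snd_conv subsetD)
  have Nm[measurable]: "N \<in> sets (borel \<Otimes>\<^sub>M borel)" using null_setsD2[OF N(1)] by (metis borel_prod sets_lborel)
  have f: "case_prod (\<lambda>x t. indicator N (x, t) :: ennreal) \<in> borel_measurable (borel \<Otimes>\<^sub>M borel)"
    using Nm by simp
  note [measurable] = measurable_compose2[OF f]
  have 0: "(\<integral>\<^sup>+x. \<integral>\<^sup>+t. indicator N (x, t) \<partial>lborel \<partial>lborel) = (0::ennreal)"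
    using nn_integral_lborel_pair(1)[OF f] null_setsD1[OF N(1)] null_setsD2[OF N(1)] by (simp add: nn_integral_indicator)
  have "(\<integral>\<^sup>+(x, y, t). indicator N (x, t) \<partial>(lborel :: ('b \<times> 'b \<times> 'c) measure)) = (0::ennreal)"
    by (subst nn_integral_lborel_triple(3)) (auto simp: 0)
  then have "AE (x, y, t) in (lborel :: ('b \<times> 'b \<times> 'c) measure). indicator N (x, t) = (0::ennreal)"
    by (subst (asm) nn_integral_0_iff_AE) (auto simp: borel_prod[symmetric] case_prod_beta')
  then show "AE (x, y, t) in (lborel :: ('b \<times> 'b \<times> 'c) measure). Q x t"
    by (rule eventually_mono) (use NQ in \<open>auto simp: indicator_def split: if_splits\<close>)
  have "(\<integral>\<^sup>+(x, y, t). indicator N (y, t) \<partial>(lborel :: ('b \<times> 'b \<times> 'c) measure)) = (0::ennreal)"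
    by (subst nn_integral_lborel_triple(1)) (auto simp: 0)
  then have "AE (x, y, t) in (lborel :: ('b \<times> 'b \<times> 'c) measure). indicator N (y, t) = (0::ennreal)"
    by (subst (asm) nn_integral_0_iff_AE) (auto simp: borel_prod[symmetric] case_prod_beta')
  then show "AE (x, y, t) in (lborel :: ('b \<times> 'b \<times> 'c) measure). Q y t"
    by (rule eventually_mono) (use NQ in \<open>auto simp: indicator_def split: if_splits\<close>)
qed

text \<open>Completeness of Lebesgue measure makes f measurable, as it agrees almost everywhere with
  a Borel function. Both integrals that remain in the weak formulation pass to Borel integrands in
  this way.\<close>

lemma integral_lebesgue_eq_lborel:
  fixes f g :: "'b::euclidean_space \<Rightarrow> real"
  assumes g[measurable]: "g \<in> borel_measurable borel" and eq: "AE z in lborel. f z = g z"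
  shows "integral\<^sup>L lebesgue f = integral\<^sup>L lborel g"
proof -
  have gl: "g \<in> borel_measurable lebesgue" by (intro measurable_completion) simp
  have eql: "AE z in lebesgue. f z = g z" using eq by (simp add: AE_completion_iff)
  have fl: "f \<in> borel_measurable lebesgue"
  proof (rule measurableI)
    fix A :: "real set" assume A: "A \<in> sets borel"
    show "f -` A \<inter> space lebesgue \<in> sets lebesgue"
    proof (rule completion.in_sets_AE)
      show "AE x in lebesgue. x \<in> g -` A \<inter> space lebesgue \<longleftrightarrow> x \<in> f -` A \<inter> space lebesgue"
        using eql by eventually_elim auto
    qed (use measurable_sets[OF gl A] in auto)
  qed simp
  have "integral\<^sup>L lebesgue f = integral\<^sup>L lebesgue g" by (rule integral_cong_AE[OF fl gl eql])
  also have "\<dots> = integral\<^sup>L lborel g" by (rule integral_completion) simp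
  finally show ?thesis .
qed

section \<open>Weak time derivatives of Steklov averages, and integrability of bounded test
  functions\<close>

lemma steklov_integration_by_parts:
  assumes g[measurable]: "g \<in> borel_measurable borel" and B: "\<And>t. \<bar>g t\<bar> \<le> B" and h: "0 < h"
    and eta: "\<And>t. (\<eta> has_real_derivative \<eta>' t) (at t)" and cont: "continuous_on UNIV \<eta>'"
    and R: "\<And>t. R < \<bar>t\<bar> \<Longrightarrow> \<eta> t = 0 \<and> \<eta>' t = 0"
  shows "(LINT t|lborel. steklov_average h g t * \<eta>' t) = - (LINT t|lborel. (g (t + h) - g t) / h * \<eta> t)"
proof -
  have B0: "0 \<le> B" using B[of 0] by linarith
  have cont0: "continuous_on UNIV \<eta>"
    using eta by (meson DERIV_isCont continuous_at_imp_continuous_on)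
  have [measurable]: "\<eta> \<in> borel_measurable borel" "\<eta>' \<in> borel_measurable borel"
    by (intro borel_measurable_continuous_onI cont cont0)+
  have bdd: "\<exists>C. \<forall>t. \<bar>k t\<bar> \<le> C" if "continuous_on UNIV k" "\<And>t. R < \<bar>t\<bar> \<Longrightarrow> k t = 0" for k :: "real \<Rightarrow> real"
  proof -
    have "compact (k ` {-R..R})"
      using that(1) by (intro compact_continuous_image) (auto intro: continuous_on_subset)
    then obtain C where C: "\<And>t. t \<in> {-R..R} \<Longrightarrow> \<bar>k t\<bar> \<le> C"
      using compact_imp_bounded bounded_iff by (metis image_eqI real_norm_def)
    have "\<bar>k t\<bar> \<le> max 0 C" for t
    proof (cases "R < \<bar>t\<bar>")
      case False
      then have "t \<in> {-R..R}" by auto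
      then show ?thesis using C[of t] by simp
    qed (use that(2)[of t] in simp)
    then show ?thesis by blast
  qed
  obtain C where C: "\<And>t. \<bar>\<eta>' t\<bar> \<le> C" using bdd[OF cont] R by blast
  obtain D where D: "\<And>t. \<bar>\<eta> t\<bar> \<le> D" using bdd[OF cont0] R by blast
  have C0: "0 \<le> C" using C[of 0] by linarith
  \<comment> \<open>\<open>k\<close> is \<open>f\<close> in the variable \<tau> = t + \<sigma>. The
    substitution moves the shift from g, which is merely bounded and measurable, to
    \<open>\<eta>'\<close>, where the integral over \<sigma> is evaluated by the fundamental theorem
    of calculus.\<close>
  define k where "k \<sigma> \<tau> = indicat_real {0..h} \<sigma> * (g \<tau> * \<eta>' (\<tau> - \<sigma>))" for \<sigma> \<tau>
  define f where "f \<sigma> t = indicat_real {0..h} \<sigma> * (g (t + \<sigma>) * \<eta>' t)" for \<sigma> t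
  have bf: "\<bar>indicat_real A \<sigma> * (u * v)\<bar> \<le> B * C" if "\<bar>u\<bar> \<le> B" "\<bar>v\<bar> \<le> C" for A and \<sigma> u v :: real
  proof -
    have "\<bar>u * v\<bar> \<le> B * C" unfolding abs_mult using that C0 B0 by (intro mult_mono) auto
    then show ?thesis using B0 C0 by (auto simp: indicator_def)
  qed
  have fin: "emeasure (lborel \<Otimes>\<^sub>M lborel) ({0..h} \<times> {- \<bar>R\<bar> - h..\<bar>R\<bar> + h}) < \<infinity>"
    by (subst lborel.emeasure_pair_measure_Times) (auto simp: emeasure_lborel_Icc_eq ennreal_mult_less_top)
  have if': "integrable (lborel \<Otimes>\<^sub>M lborel) (case_prod f)"
  proof (rule integrableI_bounded_set[OF _ _ fin])
    show "case_prod f \<in> borel_measurable (lborel \<Otimes>\<^sub>M lborel)" unfolding f_def by measurable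
    show "AE x in lborel \<Otimes>\<^sub>M lborel. x \<in> {0..h} \<times> {- \<bar>R\<bar> - h..\<bar>R\<bar> + h} \<longrightarrow> norm (case_prod f x) \<le> B * C"
      using bf B C by (auto simp: f_def split_beta)
    have "case_prod f x = 0" if "x \<notin> {0..h} \<times> {- \<bar>R\<bar> - h..\<bar>R\<bar> + h}" for x
    proof -
      obtain \<sigma> t where x: "x = (\<sigma>, t)" by (cases x)
      show ?thesis
      proof (cases "\<sigma> \<in> {0..h}")
        case True
        then have "t < - \<bar>R\<bar> - h \<or> \<bar>R\<bar> + h < t" using that x by auto
        then have "R < \<bar>t\<bar>" using True by auto
        then show ?thesis using R[of "t"] x by (simp add: f_def)
      qed (simp add: x f_def)
    qed
    then show "AE x in lborel \<Otimes>\<^sub>M lborel. x \<notin> {0..h} \<times> {- \<bar>R\<bar> - h..\<bar>R\<bar> + h} \<longrightarrow> case_prod f x = 0"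
      by (intro AE_I2 impI)
  qed auto
  have ik: "integrable (lborel \<Otimes>\<^sub>M lborel) (case_prod k)"
  proof (rule integrableI_bounded_set[OF _ _ fin])
    show "case_prod k \<in> borel_measurable (lborel \<Otimes>\<^sub>M lborel)" unfolding k_def by measurable
    show "AE x in lborel \<Otimes>\<^sub>M lborel. x \<in> {0..h} \<times> {- \<bar>R\<bar> - h..\<bar>R\<bar> + h} \<longrightarrow> norm (case_prod k x) \<le> B * C"
      using bf B C by (auto simp: k_def split_beta)
    have "case_prod k x = 0" if "x \<notin> {0..h} \<times> {- \<bar>R\<bar> - h..\<bar>R\<bar> + h}" for x
    proof -
      obtain \<sigma> t where x: "x = (\<sigma>, t)" by (cases x)
      show ?thesis
      proof (cases "\<sigma> \<in> {0..h}")
        case True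
        then have "t < - \<bar>R\<bar> - h \<or> \<bar>R\<bar> + h < t" using that x by auto
        then have "R < \<bar>t - \<sigma>\<bar>" using True by auto
        then show ?thesis using R[of "t - \<sigma>"] x by (simp add: k_def)
      qed (simp add: x k_def)
    qed
    then show "AE x in lborel \<Otimes>\<^sub>M lborel. x \<notin> {0..h} \<times> {- \<bar>R\<bar> - h..\<bar>R\<bar> + h} \<longrightarrow> case_prod k x = 0"
      by (intro AE_I2 impI)
  qed auto
  have ftc: "(LINT \<sigma>|lborel. indicat_real {0..h} \<sigma> * \<eta>' (\<tau> - \<sigma>)) = \<eta> \<tau> - \<eta> (\<tau> - h)" for \<tau>
  proof -
    have "(LINT \<sigma>|lborel. \<eta>' (\<tau> - \<sigma>) * indicator {0..h} \<sigma>) = (- \<eta> (\<tau> - h)) - (- \<eta> (\<tau> - 0))"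
    proof (rule integral_FTC_Icc_real)
      show "((\<lambda>\<sigma>. - \<eta> (\<tau> - \<sigma>)) has_real_derivative \<eta>' (\<tau> - x)) (at x)" for x
      proof -
        have "((\<lambda>\<sigma>. \<eta> (\<tau> - \<sigma>)) has_real_derivative \<eta>' (\<tau> - x) * (-1)) (at x)"
          by (rule DERIV_chain2[where f = \<eta> and g = "\<lambda>\<sigma>. \<tau> - \<sigma>", OF eta]) (auto intro!: derivative_eq_intros)
        from DERIV_minus[OF this] show ?thesis by simp
      qed
      show "isCont (\<lambda>\<sigma>. \<eta>' (\<tau> - \<sigma>)) x" for x
      proof -
        have "continuous_on UNIV (\<lambda>\<sigma>. \<eta>' (\<tau> - \<sigma>))"
          by (rule continuous_on_compose2[OF cont]) (auto intro: continuous_intros)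
        then show ?thesis by (simp add: continuous_on_eq_continuous_at)
      qed
    qed (use h in auto)
    then show ?thesis by (simp add: mult.commute)
  qed
  have int_sh: "integrable lborel (\<lambda>t. g (t + c) * \<eta> (t + d))" for c d
  proof (rule integrableI_bounded_set[where A = "{-\<bar>R\<bar> - d..\<bar>R\<bar> - d}" and B = "B * D"])
    show "AE t in lborel. t \<in> {-\<bar>R\<bar> - d..\<bar>R\<bar> - d} \<longrightarrow> norm (g (t + c) * \<eta> (t + d)) \<le> B * D"
    proof (intro AE_I2 impI)
      fix t show "norm (g (t + c) * \<eta> (t + d)) \<le> B * D"
        unfolding real_norm_def abs_mult by (intro mult_mono B D B0) auto
    qed
    have "g (t + c) * \<eta> (t + d) = 0" if "t \<notin> {-\<bar>R\<bar> - d..\<bar>R\<bar> - d}" for t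
    proof -
      have "t + d < - \<bar>R\<bar> \<or> \<bar>R\<bar> < t + d" using that by auto
      then have "R < \<bar>t + d\<bar>" by linarith
      then show ?thesis using R[of "t + d"] by simp
    qed
    then show "AE t in lborel. t \<notin> {-\<bar>R\<bar> - d..\<bar>R\<bar> - d} \<longrightarrow> g (t + c) * \<eta> (t + d) = 0" by auto
  qed (auto simp: emeasure_lborel_Icc_eq)
  have "(LINT t|lborel. steklov_average h g t * \<eta>' t) = (LINT t|lborel. (LINT \<sigma>|lborel. f \<sigma> t) / h)"
  proof (rule Bochner_Integration.integral_cong[OF refl])
    fix t
    have "(LINT \<sigma>|lborel. f \<sigma> t) = (LINT \<sigma>|lborel. (indicat_real {0..h} \<sigma> * g (t + \<sigma>)) * \<eta>' t)"
      by (simp add: f_def mult.assoc)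
    then show "steklov_average h g t * \<eta>' t = (LINT \<sigma>|lborel. f \<sigma> t) / h"
      by (simp add: steklov_average_def set_lebesgue_integral_def)
  qed
  also have "\<dots> = (LINT t|lborel. (LINT \<sigma>|lborel. f \<sigma> t)) / h" by simp
  also have "(LINT t|lborel. (LINT \<sigma>|lborel. f \<sigma> t)) = (LINT \<sigma>|lborel. (LINT t|lborel. f \<sigma> t))"
    by (rule lborel_pair.Fubini_integral[OF if'])
  also have "\<dots> = (LINT \<sigma>|lborel. (LINT t|lborel. k \<sigma> t))"
  proof (rule Bochner_Integration.integral_cong[OF refl])
    fix \<sigma>
    have "(LINT t|lborel. k \<sigma> t) = (LINT t|lborel. f \<sigma> t)"
      using lborel_integral_real_affine[of 1 "k \<sigma>" \<sigma>] by (simp add: f_def k_def add.commute)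
    then show "(LINT t|lborel. f \<sigma> t) = (LINT t|lborel. k \<sigma> t)" by simp
  qed
  also have "\<dots> = (LINT t|lborel. (LINT \<sigma>|lborel. k \<sigma> t))"
    by (rule lborel_pair.Fubini_integral[OF ik, symmetric])
  also have "\<dots> = (LINT t|lborel. g t * (\<eta> t - \<eta> (t - h)))"
  proof (rule Bochner_Integration.integral_cong[OF refl])
    fix t
    have "(LINT \<sigma>|lborel. k \<sigma> t) = (LINT \<sigma>|lborel. g t * (indicat_real {0..h} \<sigma> * \<eta>' (t - \<sigma>)))"
      by (simp add: k_def algebra_simps)
    then show "(LINT \<sigma>|lborel. k \<sigma> t) = g t * (\<eta> t - \<eta> (t - h))" by (simp add: ftc)
  qed
  also have "\<dots> = (LINT t|lborel. g t * \<eta> t) - (LINT t|lborel. g t * \<eta> (t - h))"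
    using int_sh[of 0 0] int_sh[of 0 "- h"] by (simp add: right_diff_distrib)
  also have "(LINT t|lborel. g t * \<eta> (t - h)) = (LINT t|lborel. g (t + h) * \<eta> t)"
    using lborel_integral_real_affine[of 1 "\<lambda>t. g t * \<eta> (t - h)" h] by (simp add: add.commute)
  also have "((LINT t|lborel. g t * \<eta> t) - (LINT t|lborel. g (t + h) * \<eta> t)) / h
      = - (LINT t|lborel. (g (t + h) * \<eta> t - g t * \<eta> t) / h)"
    using int_sh[of 0 0] int_sh[of h 0] by (simp add: diff_divide_distrib)
  also have "(\<lambda>t. (g (t + h) * \<eta> t - g t * \<eta> t) / h) = (\<lambda>t. (g (t + h) - g t) / h * \<eta> t)"
    by (auto simp: field_simps)
  finally show ?thesis .
qed

lemma test_functions_1dD: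
  assumes "\<eta> \<in> test_functions_1d T"
  shows "(\<eta> has_real_derivative deriv \<eta> t) (at t)" and "continuous_on UNIV (deriv \<eta>)"
    and "t \<notin> {0<..<T} \<Longrightarrow> \<eta> t = 0" and "t \<notin> {0<..<T} \<Longrightarrow> deriv \<eta> t = 0"
proof -
  have d: "((deriv ^^ k) \<eta>) differentiable (at t)" for k t
    using assms by (auto simp: test_functions_1d_def)
  have S: "closure {t. \<eta> t \<noteq> 0} \<subseteq> {0<..<T}"
    using assms by (auto simp: test_functions_1d_def compactly_contained_def)
  have e: "(\<eta> has_real_derivative deriv \<eta> t) (at t)" for t
    using d[of 0 t] by (simp add: DERIV_deriv_iff_real_differentiable)
  then show "(\<eta> has_real_derivative deriv \<eta> t) (at t)" .
  show "continuous_on UNIV (deriv \<eta>)"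
    using d[of 1] by (auto intro!: continuous_at_imp_continuous_on differentiable_imp_continuous_within)
  show "\<eta> t = 0" if "t \<notin> {0<..<T}"
    using S closure_subset[of "{t. \<eta> t \<noteq> 0}"] that by blast
  show "deriv \<eta> t = 0" if t: "t \<notin> {0<..<T}"
  proof -
    have "(\<eta> has_real_derivative 0) (at t)"
    proof (rule has_field_derivative_transform_within_open[of "\<lambda>_. 0"])
      show "open (- closure {t. \<eta> t \<noteq> 0})" by (intro open_Compl closed_closure)
      show "t \<in> - closure {t. \<eta> t \<noteq> 0}" using S t by blast
      show "0 = \<eta> x" if "x \<in> - closure {t. \<eta> t \<noteq> 0}" for x
        using that closure_subset[of "{t. \<eta> t \<noteq> 0}"] by auto
    qed simp
    then show ?thesis using e DERIV_unique by blast
  qed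
qed

text \<open>G may be merely measurable in time, yet its average has a bounded difference quotient as
  time derivative, which is what makes it a legitimate test function. Because \<eta> and its
  derivative vanish outside (0, T), the integrals may be read over the whole line.\<close>

lemma steklov_weak_time_derivative:
  assumes G: "case_prod G \<in> borel_measurable (borel \<Otimes>\<^sub>M borel)" and B: "\<And>x t. \<bar>G x t\<bar> \<le> B" and h: "0 < h"
  shows "weak_time_derivative T D (\<lambda>x. steklov_average h (G x)) (\<lambda>x t. (G x (t + h) - G x t) / h)"
  unfolding weak_time_derivative_def
proof (intro ballI AE_I2 impI)
  fix \<eta> x assume eta: "\<eta> \<in> test_functions_1d T"
  note E = test_functions_1dD[OF eta]
  have [measurable]: "G x \<in> borel_measurable borel" using measurable_compose2[OF G, of "\<lambda>_. x" borel "\<lambda>t. t"] by simp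
  have [measurable]: "deriv \<eta> \<in> borel_measurable borel" by (intro borel_measurable_continuous_onI E)
  have [measurable]: "\<eta> \<in> borel_measurable borel"
    using E(1) by (intro borel_measurable_continuous_onI continuous_at_imp_continuous_on) (auto intro: DERIV_isCont)
  have [measurable]: "steklov_average h (G x) \<in> borel_measurable borel"
    using measurable_compose2[OF measurable_steklov_average[OF G], of "\<lambda>_. x" borel "\<lambda>t. t" h] by simp
  have set: "(LINT t:{0<..<T}|lebesgue. f t * k t) = (LINT t|lborel. f t * k t)"
    if "f \<in> borel_measurable borel" "k \<in> borel_measurable borel" "\<And>t. t \<notin> {0<..<T} \<Longrightarrow> k t = 0" for f k :: "real \<Rightarrow> real"
  proof -
    have "(\<lambda>t. indicat_real {0<..<T} t *\<^sub>R (f t * k t)) = (\<lambda>t. f t * k t)"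
      using that(3) by (force simp: indicator_def)
    then show ?thesis using that unfolding set_lebesgue_integral_def by (simp add: integral_completion)
  qed
  have R0: "\<eta> t = 0 \<and> deriv \<eta> t = 0" if "\<bar>T\<bar> < \<bar>t\<bar>" for t
  proof -
    have "t \<notin> {0<..<T}" using that by auto
    then show ?thesis using E(3,4) by blast
  qed
  have "(LINT t|lborel. steklov_average h (G x) t * deriv \<eta> t) = - (LINT t|lborel. (G x (t + h) - G x t) / h * \<eta> t)"
    by (rule steklov_integration_by_parts[where B = B and R = "\<bar>T\<bar>"]) (use B h E R0 in auto)
  then show "(LINT t:{0<..<T}|lebesgue. steklov_average h (G x) t * deriv \<eta> t)
      = - (LINT t:{0<..<T}|lebesgue. (G x (t + h) - G x t) / h * \<eta> t)"
    using E by (subst set, simp, simp, simp, subst set) auto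
qed

lemma borel_measurable_lebesgue_on_pair:
  fixes F :: "'a::euclidean_space \<Rightarrow> real \<Rightarrow> real"
  assumes F: "case_prod F \<in> borel_measurable (borel \<Otimes>\<^sub>M borel)"
  shows "(\<lambda>(x, t). F x t) \<in> borel_measurable (lebesgue_on S)"
proof -
  have "case_prod F \<in> borel_measurable lborel" using F by (simp add: borel_prod)
  then have "case_prod F \<in> borel_measurable lebesgue" by (rule measurable_completion)
  then show ?thesis by (simp add: measurable_restrict_space1)
qed

lemma bounded_in_Lr_loc_Lr:
  fixes F :: "'a::euclidean_space \<Rightarrow> real \<Rightarrow> real"
  assumes F: "case_prod F \<in> borel_measurable (borel \<Otimes>\<^sub>M borel)" and B: "\<And>x t. \<bar>F x t\<bar> \<le> B" and m: "0 \<le> m"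
  shows "F \<in> Lr_loc_Lr m T (ball x0 r)"
  unfolding Lr_loc_Lr_def space_time_Lp_def
proof (intro CollectI allI impI conjI)
  fix t1 t2
  show "(\<lambda>(x, t). F x t) \<in> borel_measurable (lebesgue_on (ball x0 r \<times> {t1..t2}))"
    by (rule borel_measurable_lebesgue_on_pair[OF F])
  have "Lp_norm_pow m (ball x0 r) (\<lambda>x. F x t) \<le> ennreal (B powr m) * emeasure lborel (ball x0 r)" for t
  proof -
    have "Lp_norm_pow m (ball x0 r) (\<lambda>x. F x t) \<le> (\<integral>\<^sup>+x. ennreal (B powr m) * indicator (ball x0 r) x \<partial>lebesgue)"
      unfolding Lp_norm_pow_def using B m
      by (intro nn_integral_mono) (auto simp: indicator_def intro!: ennreal_leI powr_mono2)
    also have "\<dots> = ennreal (B powr m) * emeasure lborel (ball x0 r)"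
      by (subst nn_integral_cmult_indicator) auto
    finally show ?thesis .
  qed
  then have "(\<integral>\<^sup>+t\<in>{t1..t2}. Lp_norm_pow m (ball x0 r) (\<lambda>x. F x t) \<partial>lebesgue)
      \<le> (\<integral>\<^sup>+t. (ennreal (B powr m) * emeasure lborel (ball x0 r)) * indicator {t1..t2} t \<partial>lebesgue)"
    by (intro nn_integral_mono mult_right_mono) auto
  also have "\<dots> = ennreal (B powr m) * emeasure lborel (ball x0 r) * emeasure lborel {t1..t2}"
    by (subst nn_integral_cmult_indicator) auto
  also have "\<dots> < \<infinity>"
    using emeasure_lborel_ball_finite[of x0 r] by (auto simp: ennreal_mult_less_top emeasure_lborel_Icc_eq)
  finally show "(\<integral>\<^sup>+t\<in>{t1..t2}. Lp_norm_pow m (ball x0 r) (\<lambda>x. F x t) \<partial>lebesgue) < \<infinity>" .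
qed

section \<open>Borel representatives with bounds valid everywhere\<close>

lemma borel_measurable_signed_power [measurable]:
  "f \<in> borel_measurable M \<Longrightarrow> (\<lambda>x. signed_power m (f x)) \<in> borel_measurable M"
  unfolding signed_power_def by measurable

text \<open>The bound in \<open>Linf_Linf\<close> is iterated: for almost every t, then almost every
  x. Fubini turns it into a joint bound, but needs a measurable set; hence the detour over the Borel
  function g. Clipping g to [\<mu>, M] then gives bounds at every point.\<close>

lemma bounded_supersolution_borel_version:
  fixes u :: "'a::euclidean_space \<Rightarrow> real \<Rightarrow> real"
  assumes u: "u \<in> Linf_Linf T"
    and mu: "ereal \<mu> \<le> essinf (lebesgue_on (UNIV \<times> {0<..<T})) (\<lambda>(x, t). u x t)"
  obtains U M where "case_prod U \<in> borel_measurable (borel \<Otimes>\<^sub>M borel)"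
    "\<And>x t. \<mu> \<le> U x t" "\<And>x t. \<bar>U x t\<bar> \<le> M"
    "AE z in lborel. snd z \<in> {0<..<T} \<longrightarrow> u (fst z) (snd z) = U (fst z) (snd z)"
proof -
  let ?S = "(UNIV :: 'a set) \<times> {0<..<T}"
  have S: "?S \<in> sets borel" by (simp add: borel_prod[symmetric])
  then have Sl: "?S \<in> sets lebesgue" by (intro sets_completionI_sets) simp
  have um: "(\<lambda>(x, t). u x t) \<in> borel_measurable (lebesgue_on ?S)"
    using u by (simp add: Linf_Linf_def)
  obtain M0 where M0: "AE t in lebesgue. t \<in> {0<..<T} \<longrightarrow> (AE x in lebesgue. \<bar>u x t\<bar> \<le> M0)"
    using u by (auto simp: Linf_Linf_def)
  have "(\<lambda>z. if z \<in> ?S then case_prod u z else 0) \<in> borel_measurable lebesgue"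
    using um Sl by (subst (asm) borel_measurable_if[OF Sl, symmetric]) simp
  then obtain g where g[measurable]: "g \<in> borel_measurable lborel"
    and gu: "AE z in lborel. (if z \<in> ?S then case_prod u z else 0) = g z"
    using completion_ex_borel_measurable_real by blast
  have ereal_flip: "m \<le> v" if "ereal m \<le> - e" "ereal (- v) \<le> e" for m v e
    using that by (cases e) auto
  have "AE z in lebesgue_on ?S. - ereal (case_prod u z) \<le> esssup (lebesgue_on ?S) (\<lambda>z. - ereal (case_prod u z))"
    by (rule esssup_AE)
  then have "AE z in lebesgue. z \<in> ?S \<longrightarrow> \<mu> \<le> case_prod u z"
    using mu Sl unfolding essinf_def
    by (subst (asm) AE_restrict_space_iff)
      (auto elim!: eventually_mono intro: ereal_flip)
  then have mu': "AE z in lborel. z \<in> ?S \<longrightarrow> \<mu> \<le> case_prod u z" by (simp add: AE_completion_iff)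
  have gM: "AE z in lborel. z \<in> ?S \<longrightarrow> \<bar>g z\<bar> \<le> M0"
  proof -
    have "AE z in lborel. (if (fst z, snd z) \<in> ?S then u (fst z) (snd z) else 0) = g (fst z, snd z)"
      using gu unfolding prod.collapse case_prod_beta' .
    from AE_lborel_pairD[OF this]
    have 1: "AE t in lborel. AE x in lborel. (if (x, t) \<in> ?S then u x t else 0) = g (x, t)" by simp
    have 2: "AE t in lborel. t \<in> {0<..<T} \<longrightarrow> (AE x in lborel. \<bar>u x t\<bar> \<le> M0)"
      using M0 by (simp add: AE_completion_iff)
    have "AE t in lborel. AE x in lborel. (x, t) \<in> ?S \<longrightarrow> \<bar>g (x, t)\<bar> \<le> M0"
      using 1 2
    proof eventually_elim
      case (elim t)
      show ?case
      proof (cases "t \<in> {0<..<T}")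
        case True
        with elim have "AE x in lborel. (if (x, t) \<in> ?S then u x t else 0) = g (x, t)" "AE x in lborel. \<bar>u x t\<bar> \<le> M0" by auto
        then show ?thesis by eventually_elim (use True in simp)
      qed auto
    qed
    moreover have Qm: "{z \<in> space (lborel \<Otimes>\<^sub>M lborel). z \<in> ?S \<longrightarrow> \<bar>g z\<bar> \<le> M0} \<in> sets (lborel \<Otimes>\<^sub>M lborel)"
      using S unfolding lborel_prod by simp
    ultimately have "AE x in lborel. AE t in lborel. (x, t) \<in> ?S \<longrightarrow> \<bar>g (x, t)\<bar> \<le> M0"
      using lborel_pair.AE_commute[of "\<lambda>x t. (x, t) \<in> ?S \<longrightarrow> \<bar>g (x, t)\<bar> \<le> M0"] by simp
    from lborel_pair.AE_pair_measure[OF Qm this] show ?thesis unfolding lborel_prod .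
  qed
  \<comment> \<open>Since |\<mu>| \<le> M, the interval [\<mu>, M] is nonempty and lies in
    [-M, M].\<close>
  define M where "M = max M0 \<bar>\<mu>\<bar>"
  define U where "U x t = max \<mu> (min M (g (x, t)))" for x t
  have gm: "g \<in> borel_measurable (borel \<Otimes>\<^sub>M borel)" using g by (simp add: borel_prod)
  show thesis
  proof (rule that[of U M])
    show "case_prod U \<in> borel_measurable (borel \<Otimes>\<^sub>M borel)"
      unfolding U_def using gm by simp
    show "\<mu> \<le> U x t" for x t by (simp add: U_def)
    show "\<bar>U x t\<bar> \<le> M" for x t unfolding U_def M_def by (auto simp: max_def min_def abs_if)
    show "AE z in lborel. snd z \<in> {0<..<T} \<longrightarrow> u (fst z) (snd z) = U (fst z) (snd z)"
      using gu mu' gM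
    proof eventually_elim
      case (elim z)
      show ?case
      proof
        assume z: "snd z \<in> {0<..<T}"
        then have "z \<in> ?S" by (cases z) auto
        then have "u (fst z) (snd z) = g z" "\<mu> \<le> u (fst z) (snd z)" "\<bar>g z\<bar> \<le> M0"
          using elim by (auto simp: case_prod_beta')
        then show "u (fst z) (snd z) = U (fst z) (snd z)"
          by (simp add: U_def M_def)
      qed
    qed
  qed
qed

text \<open>The kernel bounds are assumed at each time for almost all (x, y). The set where a Borel
  version g violates them has null slices at almost every time, so it is null by Tonelli; hence
  clipping g between the two bounds changes it only on a null set of times in (0, T) and
  pairs.\<close>

lemma admissible_kernel_borel_version:
  fixes K :: "'a::euclidean_space \<Rightarrow> 'a \<Rightarrow> real \<Rightarrow> real"
  assumes K: "admissible_kernel p s \<Lambda> T K" and L: "1 \<le> \<Lambda>"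
  obtains \<kappa> where "(\<lambda>(x, y, t). \<kappa> x y t) \<in> borel_measurable (borel \<Otimes>\<^sub>M borel \<Otimes>\<^sub>M borel)"
    "\<And>x y t. (1 / \<Lambda>) / norm (x - y) powr (real DIM('a) + p * s) \<le> \<kappa> x y t"
    "\<And>x y t. \<kappa> x y t \<le> \<Lambda> / norm (x - y) powr (real DIM('a) + p * s)"
    "AE (x, y, t) in lborel. t \<in> {0<..<T} \<longrightarrow> K x y t = \<kappa> x y t"
proof -
  let ?S = "(UNIV :: 'a set) \<times> (UNIV :: 'a set) \<times> {0<..<T}"
  define e where "e = real DIM('a) + p * s"
  have S: "?S \<in> sets borel" by (simp add: borel_prod[symmetric])
  then have Sl: "?S \<in> sets lebesgue" by (intro sets_completionI_sets) simp
  let ?K = "\<lambda>(x, y, t). K x y t"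
  have "?K \<in> borel_measurable (lebesgue_on ?S)" using K by (simp add: admissible_kernel_def)
  then have "(\<lambda>z. if z \<in> ?S then ?K z else 0) \<in> borel_measurable lebesgue"
    using Sl by (subst (asm) borel_measurable_if[OF Sl, symmetric]) simp
  then obtain g where g[measurable]: "g \<in> borel_measurable lborel"
    and gK: "AE z in lborel. (if z \<in> ?S then ?K z else 0) = g z"
    using completion_ex_borel_measurable_real by blast
  have gm: "g \<in> borel_measurable (borel \<Otimes>\<^sub>M borel \<Otimes>\<^sub>M borel)" using g by (simp add: borel_prod)
  have gc: "(\<lambda>(x, y, t). g (x, y, t)) \<in> borel_measurable (borel \<Otimes>\<^sub>M borel \<Otimes>\<^sub>M borel)"
    using gm by (simp add: case_prod_beta')
  note [measurable] = measurable_compose3[OF gc]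
  define lo where "lo x y = (1 / \<Lambda>) / norm (x - y) powr e" for x y :: 'a
  define hi where "hi x y = \<Lambda> / norm (x - y) powr e" for x y :: 'a
  have lohi: "lo x y \<le> hi x y" for x y
  proof -
    have "1 \<le> \<Lambda> * \<Lambda>" using L mult_mono[of 1 \<Lambda> 1 \<Lambda>] by simp
    then show ?thesis unfolding lo_def hi_def using L by (intro divide_right_mono) (auto simp: divide_le_eq)
  qed
  have lhm: "case_prod lo \<in> borel_measurable (borel \<Otimes>\<^sub>M borel)" "case_prod hi \<in> borel_measurable (borel \<Otimes>\<^sub>M borel)"
    unfolding lo_def hi_def by measurable
  note [measurable] = measurable_compose2[OF lhm(1)] measurable_compose2[OF lhm(2)]
  define \<kappa> where "\<kappa> x y t = max (lo x y) (min (hi x y) (g (x, y, t)))" for x y t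
  define bad where "bad x y t = (if t \<in> {0<..<T} \<and> \<not> (lo x y \<le> g (x, y, t) \<and> g (x, y, t) \<le> hi x y) then 1 else 0 :: ennreal)" for x y t
  have bm: "(\<lambda>(x, y, t). bad x y t) \<in> borel_measurable (borel \<Otimes>\<^sub>M borel \<Otimes>\<^sub>M borel)"
    unfolding bad_def by measurable
  note [measurable] = measurable_compose3[OF bm]
  have Kt: "AE z in lborel. t \<in> {0<..<T} \<longrightarrow> lo (fst z) (snd z) \<le> K (fst z) (snd z) t \<and> K (fst z) (snd z) t \<le> hi (fst z) (snd z)" for t
    using K unfolding admissible_kernel_def lo_def hi_def e_def
    by (cases "t \<in> {0<..<T}") (auto simp: AE_completion_iff case_prod_beta')
  have "AE t in lborel. AE z in lborel. (if (fst z, snd z, t) \<in> ?S then K (fst z) (snd z) t else 0) = g (fst z, snd z, t)"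
  proof -
    obtain N where N: "N \<in> null_sets lborel" "{z. \<not> (if z \<in> ?S then ?K z else 0) = g z} \<subseteq> N"
      using gK unfolding eventually_ae_filter by auto
    have NQ: "(if z \<in> ?S then ?K z else 0) = g z" if "z \<notin> N" for z using N(2) that by blast
    have Nm: "(\<lambda>(x, y, t). indicator N (x, y, t) :: ennreal) \<in> borel_measurable (borel \<Otimes>\<^sub>M borel \<Otimes>\<^sub>M borel)"
    proof -
      have "N \<in> sets (borel \<Otimes>\<^sub>M borel \<Otimes>\<^sub>M borel)" using null_setsD2[OF N(1)] by (metis borel_prod sets_lborel)
      then show ?thesis by (simp add: case_prod_beta')
    qed
    note [measurable] = measurable_compose3[OF Nm]
    have "(\<integral>\<^sup>+t. \<integral>\<^sup>+x. \<integral>\<^sup>+y. indicator N (x, y, t) \<partial>lborel \<partial>lborel \<partial>lborel) = (0::ennreal)"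
      using nn_integral_lborel_triple(2)[OF Nm] null_setsD1[OF N(1)] null_setsD2[OF N(1)]
      by (simp add: nn_integral_indicator case_prod_beta')
    moreover have "(\<integral>\<^sup>+x. \<integral>\<^sup>+y. indicator N (x, y, t) \<partial>lborel \<partial>lborel) = (\<integral>\<^sup>+z. indicator N (fst z, snd z, t) \<partial>lborel :: ennreal)" for t
      by (rule nn_integral_lborel_pair(1)[symmetric]) measurable
    moreover have "AE t in lborel. (\<integral>\<^sup>+x. \<integral>\<^sup>+y. indicator N (x, y, t) \<partial>lborel \<partial>lborel) = (0::ennreal)"
      using calculation(1) by (subst (asm) nn_integral_0_iff_AE) auto
    ultimately have "AE t in lborel. (\<integral>\<^sup>+z. indicator N (fst z, snd z, t) \<partial>lborel) = (0::ennreal)" by simp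
    then show ?thesis
    proof eventually_elim
      case (elim t)
      then have "AE z in lborel. indicator N (fst z, snd z, t) = (0::ennreal)"
        by (subst (asm) nn_integral_0_iff_AE) (auto simp: borel_prod[symmetric])
      then show ?case
      proof eventually_elim
        case (elim z)
        then have "(fst z, snd z, t) \<notin> N" by (auto simp: indicator_def split: if_splits)
        from NQ[OF this] show ?case by (simp only: case_prod_conv)
      qed
    qed
  qed
  then have "AE t in lborel. AE z in lborel. bad (fst z) (snd z) t = 0"
  proof eventually_elim
    case (elim t)
    from elim Kt[of t] show ?case
      by eventually_elim (auto simp: bad_def split: if_splits)
  qed
  moreover have bp: "(\<integral>\<^sup>+x. \<integral>\<^sup>+y. bad x y t \<partial>lborel \<partial>lborel) = (\<integral>\<^sup>+z. bad (fst z) (snd z) t \<partial>lborel)" for t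
    by (rule nn_integral_lborel_pair(1)[symmetric]) measurable
  ultimately have "AE t in lborel. (\<integral>\<^sup>+x. \<integral>\<^sup>+y. bad x y t \<partial>lborel \<partial>lborel) = 0"
    by (auto elim!: eventually_mono simp: bp nn_integral_0_iff_AE borel_prod[symmetric])
  then have "(\<integral>\<^sup>+(x, y, t). bad x y t \<partial>lborel) = 0"
    unfolding nn_integral_lborel_triple(2)[OF bm] by (subst nn_integral_0_iff_AE) auto
  then have bad0: "AE (x, y, t) in lborel. bad x y t = 0"
    by (subst (asm) nn_integral_0_iff_AE) (auto simp: borel_prod[symmetric] case_prod_beta')
  show thesis
  proof (rule that[of \<kappa>])
    show "(\<lambda>(x, y, t). \<kappa> x y t) \<in> borel_measurable (borel \<Otimes>\<^sub>M borel \<Otimes>\<^sub>M borel)"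
      unfolding \<kappa>_def by measurable
    show "(1 / \<Lambda>) / norm (x - y) powr (real DIM('a) + p * s) \<le> \<kappa> x y t" for x y t
      by (simp add: \<kappa>_def lo_def e_def)
    show "\<kappa> x y t \<le> \<Lambda> / norm (x - y) powr (real DIM('a) + p * s)" for x y t
      using lohi[of x y] by (simp add: \<kappa>_def hi_def e_def)
    show "AE (x, y, t) in lborel. t \<in> {0<..<T} \<longrightarrow> K x y t = \<kappa> x y t"
      using gK bad0 by eventually_elim (auto simp: bad_def \<kappa>_def split: if_splits)
  qed
qed

section \<open>Gagliardo energies in space and time, and the tested inequality\<close>

definition gagliardo_energy :: "('a::euclidean_space \<Rightarrow> 'a \<Rightarrow> real) \<Rightarrow> real \<Rightarrow> ('a \<Rightarrow> real \<Rightarrow> real) \<Rightarrow> ennreal"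
  where "gagliardo_energy W p G = (\<integral>\<^sup>+(x, y, t). ennreal (\<bar>G x t - G y t\<bar> powr p * W x y) \<partial>lborel)"

lemma measurable_gagliardo_integrand:
  fixes G :: "'a::euclidean_space \<Rightarrow> real \<Rightarrow> real"
  assumes G: "case_prod G \<in> borel_measurable (borel \<Otimes>\<^sub>M borel)" and W: "case_prod W \<in> borel_measurable (borel \<Otimes>\<^sub>M borel)"
  shows "(\<lambda>(x, y, t). ennreal (\<bar>G x t - G y t\<bar> powr p * W x y)) \<in> borel_measurable (borel \<Otimes>\<^sub>M borel \<Otimes>\<^sub>M borel)"
proof -
  note [measurable] = measurable_compose2[OF G] measurable_compose2[OF W]
  show ?thesis by measurable
qed

text \<open>For fixed x and y averaging commutes with the spatial difference, so Jensen's inequality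
  in time applies to G x - G y. The weight is arbitrary because the estimate is also applied to the
  weight restricted to a neighbourhood of the diagonal.\<close>

lemma gagliardo_energy_steklov_le:
  fixes G :: "'a::euclidean_space \<Rightarrow> real \<Rightarrow> real"
  assumes G: "case_prod G \<in> borel_measurable (borel \<Otimes>\<^sub>M borel)" and B: "\<And>x t. \<bar>G x t\<bar> \<le> B"
    and W: "case_prod W \<in> borel_measurable (borel \<Otimes>\<^sub>M borel)" "\<And>x y. 0 \<le> W x y"
    and h: "0 < h" and p: "1 \<le> p"
  shows "gagliardo_energy W p (\<lambda>x. steklov_average h (G x)) \<le> gagliardo_energy W p G"
proof -
  note [measurable] = measurable_compose2[OF G] measurable_compose2[OF W(1)] measurable_compose2[OF measurable_steklov_average[OF G]]
  have [measurable]: "G x \<in> borel_measurable borel" for x using measurable_compose2[OF G, of "\<lambda>_. x" borel "\<lambda>t. t"] by simp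
  have sm: "case_prod (\<lambda>x. steklov_average h (G x)) \<in> borel_measurable (borel \<Otimes>\<^sub>M borel)"
    using measurable_steklov_average[OF G, of h] by simp
  have le: "(\<integral>\<^sup>+t. ennreal (\<bar>steklov_average h (G x) t - steklov_average h (G y) t\<bar> powr p * W x y) \<partial>lborel)
      \<le> (\<integral>\<^sup>+t. ennreal (\<bar>G x t - G y t\<bar> powr p * W x y) \<partial>lborel)" for x y
  proof -
    have b: "\<bar>G x t - G y t\<bar> \<le> B + B" for t using B[of x t] B[of y t] by linarith
    have "(\<integral>\<^sup>+t. ennreal (\<bar>steklov_average h (G x) t - steklov_average h (G y) t\<bar> powr p * W x y) \<partial>lborel)
        = (\<integral>\<^sup>+t. ennreal (W x y) * ennreal (\<bar>steklov_average h (\<lambda>t. G x t - G y t) t\<bar> powr p) \<partial>lborel)"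
      using B W by (subst steklov_average_diff[where B = B and C = B]) (auto simp: ennreal_mult'[symmetric] mult.commute)
    also have "\<dots> \<le> (\<integral>\<^sup>+t. ennreal (W x y) * (ennreal (1 / h) * (\<integral>\<^sup>+\<sigma>. ennreal (\<bar>G x (t + \<sigma>) - G y (t + \<sigma>)\<bar> powr p) * indicator {0..h} \<sigma> \<partial>lborel)) \<partial>lborel)"
      using steklov_average_jensen[where g = "\<lambda>t. G x t - G y t", OF _ b h p] by (intro nn_integral_mono mult_left_mono) auto
    also have "\<dots> = ennreal (W x y) * (\<integral>\<^sup>+t. ennreal (\<bar>G x t - G y t\<bar> powr p) \<partial>lborel)"
      by (subst nn_integral_cmult, measurable)
        (subst nn_integral_average_shift[of "\<lambda>t. ennreal (\<bar>G x t - G y t\<bar> powr p)", OF _ h], auto)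
    also have "\<dots> = (\<integral>\<^sup>+t. ennreal (\<bar>G x t - G y t\<bar> powr p * W x y) \<partial>lborel)"
      using W by (subst nn_integral_cmult[symmetric]) (auto simp: ennreal_mult'[symmetric] mult.commute)
    finally show ?thesis .
  qed
  show ?thesis
    unfolding gagliardo_energy_def nn_integral_lborel_triple(1)[OF measurable_gagliardo_integrand[OF G W(1)]]
      nn_integral_lborel_triple(1)[OF measurable_gagliardo_integrand[OF sm W(1)]]
    by (rule nn_integral_mono, rule nn_integral_mono, rule le)
qed

abbreviation gagliardo_weight :: "real \<Rightarrow> real \<Rightarrow> 'a::euclidean_space \<Rightarrow> 'a \<Rightarrow> real"
  where "gagliardo_weight p s x y \<equiv> 1 / norm (x - y) powr (real DIM('a) + p * s)"

lemma measurable_gagliardo_weight [measurable]: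
  "case_prod (gagliardo_weight p s :: 'a::euclidean_space \<Rightarrow> 'a \<Rightarrow> real) \<in> borel_measurable (borel \<Otimes>\<^sub>M borel)"
  by measurable

lemma bounded_in_Lp_loc_Wsp0:
  fixes F :: "'a::euclidean_space \<Rightarrow> real \<Rightarrow> real"
  assumes F: "case_prod F \<in> borel_measurable (borel \<Otimes>\<^sub>M borel)" and B: "\<And>x t. \<bar>F x t\<bar> \<le> B"
    and supp: "\<And>x t. F x t \<noteq> 0 \<Longrightarrow> x \<in> ball x0 r \<and> t \<in> {a..b}"
    and E: "gagliardo_energy (gagliardo_weight p s) p F < \<infinity>" and p: "1 < p"
  shows "F \<in> Lp_loc_Wsp0 s p T (ball x0 r)"
proof -
  note [measurable] = measurable_compose2[OF F]
  define N where "N t = Wsp_norm_pow s p UNIV (\<lambda>x. F x t)" for t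
  define N1 where "N1 t = (\<integral>\<^sup>+x. ennreal (\<bar>F x t\<bar> powr p) \<partial>lborel)" for t
  define N2 where "N2 t = (\<integral>\<^sup>+x. \<integral>\<^sup>+y. ennreal (\<bar>F x t - F y t\<bar> powr p * gagliardo_weight p s x y) \<partial>lborel \<partial>lborel)" for t
  have Nt: "N t = N1 t + N2 t" for t
    using nn_integral_lborel_pair(1)[of "\<lambda>x y. ennreal (\<bar>F x t - F y t\<bar> powr p * gagliardo_weight p s x y)"]
    by (simp add: N_def N1_def N2_def Wsp_norm_pow_def Lp_norm_pow_def nn_integral_completion)
  have [measurable]: "N1 \<in> borel_measurable borel" "N2 \<in> borel_measurable borel"
    unfolding N1_def N2_def by measurable
  have "(\<integral>\<^sup>+t. N1 t \<partial>lborel) \<le> (\<integral>\<^sup>+t. (ennreal (B powr p) * emeasure lborel (ball x0 r)) * indicator {a..b} t \<partial>lborel)"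
  proof (intro nn_integral_mono)
    fix t
    have "N1 t \<le> (\<integral>\<^sup>+x. (ennreal (B powr p) * indicator {a..b} t) * indicator (ball x0 r) x \<partial>lborel)"
      unfolding N1_def
    proof (intro nn_integral_mono)
      fix x show "ennreal (\<bar>F x t\<bar> powr p) \<le> ennreal (B powr p) * indicator {a..b} t * indicator (ball x0 r) x"
        using supp[of x t] B[of x t] p by (cases "F x t = 0") (auto intro!: ennreal_leI powr_mono2)
    qed
    also have "\<dots> = ennreal (B powr p) * emeasure lborel (ball x0 r) * indicator {a..b} t"
      by (subst nn_integral_cmult_indicator) (auto simp: ac_simps)
    finally show "N1 t \<le> ennreal (B powr p) * emeasure lborel (ball x0 r) * indicator {a..b} t" .
  qed
  also have "\<dots> < \<infinity>"
    using emeasure_lborel_ball_finite[of x0 r]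
    by (subst nn_integral_cmult_indicator) (auto simp: ennreal_mult_less_top emeasure_lborel_Icc_eq)
  finally have 1: "(\<integral>\<^sup>+t. N1 t \<partial>lborel) < \<infinity>" .
  have 2: "(\<integral>\<^sup>+t. N2 t \<partial>lborel) < \<infinity>"
    using E unfolding N2_def gagliardo_energy_def
    by (subst (asm) nn_integral_lborel_triple(2)[OF measurable_gagliardo_integrand[OF F]]) auto
  have Nfin: "(\<integral>\<^sup>+t. N t \<partial>lborel) < \<infinity>"
    unfolding Nt using 1 2 by (subst nn_integral_add) auto
  have [measurable]: "N \<in> borel_measurable borel" unfolding Nt[abs_def] by measurable
  have "AE t in lborel. N t \<noteq> \<infinity>"
    using Nfin by (intro nn_integral_PInf_AE) auto
  then have ae: "AE t in lebesgue. N t < \<infinity>"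
    by (auto simp: AE_completion_iff less_top elim!: eventually_mono)
  show ?thesis
    unfolding Lp_loc_Wsp0_def
  proof (intro CollectI conjI allI impI)
    show "AE t in lebesgue. t \<in> {0<..<T} \<longrightarrow> (\<lambda>x. F x t) \<in> Wsp0 s p (ball x0 r)"
      using ae
    proof eventually_elim
      case (elim t)
      have "(\<lambda>x. F x t) \<in> borel_measurable lborel" by measurable
      then have "(\<lambda>x. F x t) \<in> borel_measurable (lebesgue_on UNIV)"
        by (intro measurable_restrict_space1 measurable_completion)
      then show ?case
        using elim supp[of _ t] by (auto simp: Wsp0_def Wsp_def N_def intro!: AE_I2)
    qed
    fix t1 t2 :: real
    show "F \<in> space_time_Lp (Wsp_norm_pow s p UNIV) UNIV {t1..t2}"
      unfolding space_time_Lp_def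
    proof (intro CollectI conjI)
      show "(\<lambda>(x, t). F x t) \<in> borel_measurable (lebesgue_on (UNIV \<times> {t1..t2}))"
        by (rule borel_measurable_lebesgue_on_pair[OF F])
      have "(\<integral>\<^sup>+t\<in>{t1..t2}. N t \<partial>lebesgue) \<le> (\<integral>\<^sup>+t. N t \<partial>lebesgue)"
        by (intro nn_integral_mono) (auto simp: indicator_def)
      then show "(\<integral>\<^sup>+t\<in>{t1..t2}. Wsp_norm_pow s p UNIV (\<lambda>x. F x t) \<partial>lebesgue) < \<infinity>"
        using Nfin by (simp add: N_def[symmetric] nn_integral_completion)
    qed
  qed
qed

text \<open>The test function \<open>G\<close> is supported in \<open>{a..b}\<close>, inside \<open>{t1..t2}\<close>; hence \<open>weak\<close> has no
  boundary terms.\<close>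

locale regular_supersolution =
  fixes p q s \<Lambda> \<mu> M :: real and U :: "'a::euclidean_space \<Rightarrow> real \<Rightarrow> real"
    and \<kappa> :: "'a \<Rightarrow> 'a \<Rightarrow> real \<Rightarrow> real" and x0 :: 'a and r a b t1 t2 :: real
  assumes p: "1 < p" and q: "0 < q" and s: "0 < s" "s < 1" and Lam: "1 \<le> \<Lambda>"
    and U_meas: "case_prod U \<in> borel_measurable (borel \<Otimes>\<^sub>M borel)"
    and U_lower: "\<And>x t. \<mu> \<le> U x t" and U_abs: "\<And>x t. \<bar>U x t\<bar> \<le> M"
    and K_meas: "(\<lambda>(x, y, t). \<kappa> x y t) \<in> borel_measurable (borel \<Otimes>\<^sub>M borel \<Otimes>\<^sub>M borel)"
    and K_lower: "\<And>x y t. gagliardo_weight p s x y / \<Lambda> \<le> \<kappa> x y t"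
    and K_upper: "\<And>x y t. \<kappa> x y t \<le> \<Lambda> * gagliardo_weight p s x y"
    and r: "0 < r" and t: "t1 < a" "a < b" "b < t2"
    and U_energy: "(\<integral>\<^sup>+(x, y, t). ennreal (\<bar>U x t - U y t\<bar> powr p * gagliardo_weight p s x y) *
        indicator (ball x0 r \<times> ball x0 r \<times> {t1..t2}) (x, y, t) \<partial>lborel) < \<infinity>"
    and weak: "\<And>G h C. \<lbrakk>case_prod G \<in> borel_measurable (borel \<Otimes>\<^sub>M borel);
        \<And>x t. 0 \<le> G x t; \<And>x t. G x t \<le> C;
        \<And>x t. G x t \<noteq> 0 \<Longrightarrow> x \<in> ball x0 r \<and> t \<in> {a..b};
        gagliardo_energy (gagliardo_weight p s) p G < \<infinity>; 0 < h; h < a - t1\<rbrakk> \<Longrightarrow>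
      0 \<le> (\<integral>(x, y, t). indicat_real {t1..t2} t * (signed_power (p - 1) (U x t - U y t) *
            (steklov_average h (G x) t - steklov_average h (G y) t) * \<kappa> x y t) \<partial>lborel)
        - (\<integral>(x, t). signed_power q (U x t) * ((G x (t + h) - G x t) / h) \<partial>lborel)"

text \<open>The test function is the average of G. Looking forward, it enlarges the support to
  [a - h, b], which stays inside (t1, t2) because h < a - t1. The one-sided averages at t1 and t2
  then vanish for small windows, so uniqueness of limits gives b1 = b2 = 0.\<close>

lemma weak_supersolution_tested:
  fixes u :: "'a::euclidean_space \<Rightarrow> real \<Rightarrow> real" and K :: "'a \<Rightarrow> 'a \<Rightarrow> real \<Rightarrow> real"
  assumes p: "1 < p" and q: "0 < q" and ws: "weak_supersolution p q s K \<Omega> T u"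
    and U: "case_prod U \<in> borel_measurable (borel \<Otimes>\<^sub>M borel)"
    and uU: "AE z in lborel. snd z \<in> {0<..<T} \<longrightarrow> u (fst z) (snd z) = U (fst z) (snd z)"
    and \<kappa>: "(\<lambda>(x, y, t). \<kappa> x y t) \<in> borel_measurable (borel \<Otimes>\<^sub>M borel \<Otimes>\<^sub>M borel)"
    and Kk: "AE (x, y, t) in lborel. t \<in> {0<..<T} \<longrightarrow> K x y t = \<kappa> x y t"
    and x0: "cball x0 r \<subseteq> \<Omega>" and r: "0 < r" and t: "0 < t1" "t1 < a" "a < b" "b < t2" "t2 < T"
    and G: "case_prod G \<in> borel_measurable (borel \<Otimes>\<^sub>M borel)"
    and G0: "\<And>x t. 0 \<le> G x t" and GC: "\<And>x t. G x t \<le> C"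
    and supp: "\<And>x t. G x t \<noteq> 0 \<Longrightarrow> x \<in> ball x0 r \<and> t \<in> {a..b}"
    and E: "gagliardo_energy (gagliardo_weight p s) p G < \<infinity>" and h: "0 < h" "h < a - t1"
  shows "0 \<le> (\<integral>(x, y, t). indicat_real {t1..t2} t * (signed_power (p - 1) (U x t - U y t) *
            (steklov_average h (G x) t - steklov_average h (G y) t) * \<kappa> x y t) \<partial>lborel)
        - (\<integral>(x, t). signed_power q (U x t) * ((G x (t + h) - G x t) / h) \<partial>lborel)"
proof -
  define \<phi> where "\<phi> x = steklov_average h (G x)" for x
  define \<psi> where "\<psi> x t = (G x (t + h) - G x t) / h" for x t
  have GB: "\<bar>G x t\<bar> \<le> C" for x t using G0[of x t] GC[of x t] by linarith
  have \<phi>m: "case_prod \<phi> \<in> borel_measurable (borel \<Otimes>\<^sub>M borel)"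
    using measurable_steklov_average[OF G, of h] by (simp add: \<phi>_def[abs_def])
  note [measurable] = measurable_compose2[OF G] measurable_compose2[OF \<phi>m] measurable_compose2[OF U] measurable_compose3[OF \<kappa>]
  have \<psi>m: "case_prod \<psi> \<in> borel_measurable (borel \<Otimes>\<^sub>M borel)" unfolding \<psi>_def by measurable
  note [measurable] = measurable_compose2[OF \<psi>m]
  have Gm: "G x \<in> borel_measurable borel" for x using measurable_compose2[OF G, of "\<lambda>_. x" borel "\<lambda>t. t"] by simp
  have \<phi>B: "\<bar>\<phi> x t\<bar> \<le> C" for x t unfolding \<phi>_def by (rule steklov_average_abs_le[OF Gm GB h(1)])
  have \<psi>B: "\<bar>\<psi> x t\<bar> \<le> 2 * C / h" for x t
  proof -
    have "\<bar>G x (t + h) - G x t\<bar> \<le> 2 * C" using GB[of x t] GB[of x "t + h"] by linarith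
    then show ?thesis using h by (simp add: \<psi>_def divide_right_mono)
  qed
  have \<phi>s: "x \<in> ball x0 r \<and> t \<in> {a - h..b}" if "\<phi> x t \<noteq> 0" for x t
  proof -
    have "\<exists>\<sigma>. 0 \<le> \<sigma> \<and> \<sigma> \<le> h \<and> G x (t + \<sigma>) \<noteq> 0"
    proof (rule ccontr)
      assume "\<not> ?thesis"
      then have "\<phi> x t = 0" unfolding \<phi>_def by (intro steklov_average_eq_0) blast
      with that show False by simp
    qed
    then obtain \<sigma> where \<sigma>: "0 \<le> \<sigma>" "\<sigma> \<le> h" "G x (t + \<sigma>) \<noteq> 0" by blast
    from supp[OF this(3)] have "x \<in> ball x0 r" "a \<le> t + \<sigma>" "t + \<sigma> \<le> b" by auto
    then show ?thesis using \<sigma> by simp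
  qed
  have \<psi>s: "x \<in> ball x0 r \<and> t \<in> {a - h..b}" if "\<psi> x t \<noteq> 0" for x t
  proof -
    have "G x t \<noteq> 0 \<or> G x (t + h) \<noteq> 0" using that by (auto simp: \<psi>_def)
    then have "x \<in> ball x0 r \<and> (t \<in> {a..b} \<or> t + h \<in> {a..b})" using supp by blast
    then show ?thesis using h by auto
  qed
  have \<phi>E: "gagliardo_energy (gagliardo_weight p s) p \<phi> < \<infinity>"
    using gagliardo_energy_steklov_le[OF G GB _ _ h(1), of "gagliardo_weight p s" p] E p
    unfolding \<phi>_def by (auto intro: order.strict_trans1)
  have "\<exists>b1 b2.
      ((\<lambda>h'. (1 / h') * (LINT (x, t):ball x0 r \<times> {t1..t1 + h'}|lebesgue. signed_power q (u x t) * \<phi> x t)) \<longlongrightarrow> b1) (at_right 0) \<and>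
      ((\<lambda>h'. (1 / h') * (LINT (x, t):ball x0 r \<times> {t2 - h'..t2}|lebesgue. signed_power q (u x t) * \<phi> x t)) \<longlongrightarrow> b2) (at_right 0) \<and>
      nonlocal_energy p K u \<phi> t1 t2 - (LINT (x, t):ball x0 r \<times> {t1..t2}|lebesgue. signed_power q (u x t) * \<psi> x t) + b2 - b1 \<ge> 0"
  proof -
    have "ball x0 r \<Subset> \<Omega>" using x0 r by (simp add: compactly_contained_def)
    moreover have "W1r_loc_Lr (q + 1) T (ball x0 r) \<phi> \<psi>"
      unfolding W1r_loc_Lr_def
      using bounded_in_Lr_loc_Lr[OF \<phi>m \<phi>B] bounded_in_Lr_loc_Lr[OF \<psi>m \<psi>B] q
        steklov_weak_time_derivative[OF G GB h(1)]
      by (auto simp: \<phi>_def[abs_def] \<psi>_def[abs_def])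
    moreover have "\<phi> \<in> Lp_loc_Wsp0 s p T (ball x0 r)"
      by (rule bounded_in_Lp_loc_Wsp0[OF \<phi>m \<phi>B \<phi>s \<phi>E p])
    moreover have "AE (x, t) in lebesgue. t \<in> {0<..<T} \<longrightarrow> 0 \<le> \<phi> x t"
      using G0 steklov_average_nonneg[OF h(1)] by (auto simp: \<phi>_def intro!: AE_I2)
    moreover have "0 < t1 \<and> t1 < t2 \<and> t2 < T" using t by simp
    ultimately show ?thesis
      using ws unfolding weak_supersolution_def by (elim conjE) (drule spec, drule spec, drule spec, drule spec, drule spec, erule mp, simp)
  qed
  then obtain b1 b2 where
    b1: "((\<lambda>h'. (1 / h') * (LINT (x, t):ball x0 r \<times> {t1..t1 + h'}|lebesgue. signed_power q (u x t) * \<phi> x t)) \<longlongrightarrow> b1) (at_right 0)" and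
    b2: "((\<lambda>h'. (1 / h') * (LINT (x, t):ball x0 r \<times> {t2 - h'..t2}|lebesgue. signed_power q (u x t) * \<phi> x t)) \<longlongrightarrow> b2) (at_right 0)" and
    ineq: "nonlocal_energy p K u \<phi> t1 t2 - (LINT (x, t):ball x0 r \<times> {t1..t2}|lebesgue. signed_power q (u x t) * \<psi> x t) + b2 - b1 \<ge> 0"
    by blast
  have zero: "(LINT (x, t):ball x0 r \<times> I|lebesgue. signed_power q (u x t) * \<phi> x t) = 0"
    if "I \<inter> {a - h..b} = {}" for I
  proof -
    have "(\<lambda>z. indicat_real (ball x0 r \<times> I) z *\<^sub>R (case z of (x, t) \<Rightarrow> signed_power q (u x t) * \<phi> x t)) = (\<lambda>_. 0)"
    proof
      fix z :: "'a \<times> real"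
      obtain x t where z: "z = (x, t)" by (cases z)
      show "indicat_real (ball x0 r \<times> I) z *\<^sub>R (case z of (x, t) \<Rightarrow> signed_power q (u x t) * \<phi> x t) = 0"
        using that \<phi>s[of x t] by (cases "\<phi> x t = 0") (auto simp: z indicator_def)
    qed
    then show ?thesis unfolding set_lebesgue_integral_def by simp
  qed
  have "\<forall>\<^sub>F h' in at_right 0. 0 = (1 / h') * (LINT (x, t):ball x0 r \<times> {t1..t1 + h'}|lebesgue. signed_power q (u x t) * \<phi> x t)"
    using h unfolding eventually_at_right_field by (intro exI[of _ "a - h - t1"]) (auto simp: zero)
  from Lim_transform_eventually[OF tendsto_const this] have "b1 = 0"
    using b1 tendsto_unique[OF trivial_limit_at_right_real] by blast
  have "\<forall>\<^sub>F h' in at_right 0. 0 = (1 / h') * (LINT (x, t):ball x0 r \<times> {t2 - h'..t2}|lebesgue. signed_power q (u x t) * \<phi> x t)"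
    using t unfolding eventually_at_right_field by (intro exI[of _ "t2 - b"]) (auto simp: zero)
  from Lim_transform_eventually[OF tendsto_const this] have "b2 = 0"
    using b2 tendsto_unique[OF trivial_limit_at_right_real] by blast
  have I1: "(LINT (x, t):ball x0 r \<times> {t1..t2}|lebesgue. signed_power q (u x t) * \<psi> x t)
      = (\<integral>(x, t). signed_power q (U x t) * \<psi> x t \<partial>lborel)"
    unfolding set_lebesgue_integral_def
  proof (rule integral_lebesgue_eq_lborel)
    show "(\<lambda>(x, t). signed_power q (U x t) * \<psi> x t) \<in> borel_measurable borel"
      by (simp add: borel_prod[symmetric] case_prod_beta')
    show "AE z in lborel. indicat_real (ball x0 r \<times> {t1..t2}) z *\<^sub>R (case z of (x, t) \<Rightarrow> signed_power q (u x t) * \<psi> x t)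
        = (case z of (x, t) \<Rightarrow> signed_power q (U x t) * \<psi> x t)"
      using uU
    proof eventually_elim
      case (elim z)
      obtain x t where z: "z = (x, t)" by (cases z)
      show ?case
      proof (cases "\<psi> x t = 0")
        case False
        then have "x \<in> ball x0 r" "t \<in> {t1..t2}" "t \<in> {0<..<T}" using \<psi>s[of x t] h t by auto
        then show ?thesis using elim by (simp add: z)
      qed (simp add: z)
    qed
  qed
  have uU1: "AE (x, y, t) in (lborel :: ('a \<times> 'a \<times> real) measure). t \<in> {0<..<T} \<longrightarrow> u x t = U x t"
    using AE_lborel_tripleI(1)[OF uU] by simp
  have uU2: "AE (x, y, t) in (lborel :: ('a \<times> 'a \<times> real) measure). t \<in> {0<..<T} \<longrightarrow> u y t = U y t"
    using AE_lborel_tripleI(2)[OF uU] by simp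
  have I2: "nonlocal_energy p K u \<phi> t1 t2 = (\<integral>(x, y, t). indicat_real {t1..t2} t * (signed_power (p - 1) (U x t - U y t) *
            (\<phi> x t - \<phi> y t) * \<kappa> x y t) \<partial>lborel)"
    unfolding nonlocal_energy_def set_lebesgue_integral_def
  proof (rule integral_lebesgue_eq_lborel)
    show "(\<lambda>(x, y, t). indicat_real {t1..t2} t * (signed_power (p - 1) (U x t - U y t) *
            (\<phi> x t - \<phi> y t) * \<kappa> x y t)) \<in> borel_measurable borel"
      by (simp add: borel_prod[symmetric] case_prod_beta')
    show "AE w in lborel. indicat_real (UNIV \<times> UNIV \<times> {t1..t2}) w *\<^sub>R (case w of (x, y, t) \<Rightarrow>
           signed_power (p - 1) (u x t - u y t) * (\<phi> x t - \<phi> y t) * K x y t)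
        = (case w of (x, y, t) \<Rightarrow> indicat_real {t1..t2} t * (signed_power (p - 1) (U x t - U y t) *
            (\<phi> x t - \<phi> y t) * \<kappa> x y t))"
      using uU1 uU2 Kk
    proof eventually_elim
      case (elim w)
      obtain x y \<tau> where w: "w = (x, y, \<tau>)" by (cases w)
      show ?case
      proof (cases "\<tau> \<in> {t1..t2}")
        case True
        then have "\<tau> \<in> {0<..<T}" using t by auto
        then show ?thesis using elim True by (simp add: w)
      qed (simp add: w)
    qed
  qed
  show ?thesis
    using ineq unfolding I1 I2 \<open>b1 = 0\<close> \<open>b2 = 0\<close> by (simp add: \<phi>_def \<psi>_def)
qed

lemma weak_supersolution_local_energy:
  fixes u :: "'a::euclidean_space \<Rightarrow> real \<Rightarrow> real"
  assumes u: "u \<in> Lp_loc_Wsp_loc s p T \<Omega>"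
    and U: "case_prod U \<in> borel_measurable (borel \<Otimes>\<^sub>M borel)"
    and uU: "AE z in lborel. snd z \<in> {0<..<T} \<longrightarrow> u (fst z) (snd z) = U (fst z) (snd z)"
    and x0: "cball x0 r \<subseteq> \<Omega>" and r: "0 < r" and t: "0 < t1" "t1 < t2" "t2 < T"
  shows "(\<integral>\<^sup>+(x, y, t). ennreal (\<bar>U x t - U y t\<bar> powr p * gagliardo_weight p s x y) *
        indicator (ball x0 r \<times> ball x0 r \<times> {t1..t2}) (x, y, t) \<partial>lborel) < \<infinity>"
proof -
  let ?B = "ball x0 r"
  note [measurable] = measurable_compose2[OF U]
  define f where "f x y t = ennreal (\<bar>U x t - U y t\<bar> powr p * gagliardo_weight p s x y) *
        indicator (?B \<times> ?B \<times> {t1..t2}) (x, y, t)" for x y t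
  have fe: "f x y t = ennreal (\<bar>U x t - U y t\<bar> powr p * gagliardo_weight p s x y) *
        (indicator ?B x * indicator ?B y * indicator {t1..t2} t)" for x y t
    by (auto simp: f_def indicator_def)
  have Bm[measurable]: "?B \<in> sets borel" by simp
  have fm: "(\<lambda>(x, y, t). f x y t) \<in> borel_measurable (borel \<Otimes>\<^sub>M borel \<Otimes>\<^sub>M borel)"
    unfolding fe by measurable
  note [measurable] = measurable_compose3[OF fm]
  have "?B \<Subset> \<Omega>" using x0 r by (simp add: compactly_contained_def)
  then have "u \<in> space_time_Lp (Wsp_norm_pow s p ?B) ?B {t1..t2}"
    using u t unfolding Lp_loc_Wsp_loc_def by auto
  then have fin: "(\<integral>\<^sup>+t. Wsp_norm_pow s p ?B (\<lambda>x. u x t) * indicator {t1..t2} t \<partial>lborel) < \<infinity>"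
    by (simp add: space_time_Lp_def nn_integral_completion)
  have uUt: "AE t in lborel. AE x in lborel. t \<in> {0<..<T} \<longrightarrow> u x t = U x t"
    by (rule AE_lborel_pairD[OF uU])
  have "AE t in lborel. (\<integral>\<^sup>+x. \<integral>\<^sup>+y. f x y t \<partial>lborel \<partial>lborel) \<le> Wsp_norm_pow s p ?B (\<lambda>x. u x t) * indicator {t1..t2} t"
    using uUt
  proof eventually_elim
    case (elim t)
    show ?case
    proof (cases "t \<in> {t1..t2}")
      case True
      then have "t \<in> {0<..<T}" using t by auto
      with elim have ae: "AE x in lborel. u x t = U x t" by simp
      then obtain N where N: "N \<in> null_sets lborel" "{x. u x t \<noteq> U x t} \<subseteq> N"
        unfolding eventually_ae_filter by auto
      \<comment> \<open>An exceptional null set in one variable spoils only a null set of pairs, so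
        the double integrals of u and U agree at time t.\<close>
      have N': "N \<times> UNIV \<in> null_sets (lborel :: ('a \<times> 'a) measure)" "UNIV \<times> N \<in> null_sets (lborel :: ('a \<times> 'a) measure)"
        using N(1) unfolding lborel_prod[symmetric]
        by (auto simp: null_sets_def lborel.emeasure_pair_measure_Times)
      have ae2: "AE z in lborel. u (fst z) t = U (fst z) t \<and> u (snd z) t = U (snd z) t"
        using AE_not_in[OF N'(1)] AE_not_in[OF N'(2)]
        by eventually_elim (use N(2) in auto)
      have "(\<integral>\<^sup>+x. \<integral>\<^sup>+y. f x y t \<partial>lborel \<partial>lborel) = (\<integral>\<^sup>+z. f (fst z) (snd z) t \<partial>lborel)"
        by (rule nn_integral_lborel_pair(1)[symmetric]) measurable
      also have "\<dots> = (\<integral>\<^sup>+z\<in>?B \<times> ?B. ennreal (\<bar>u (fst z) t - u (snd z) t\<bar> powr p /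
        norm (fst z - snd z) powr (real DIM('a) + p * s)) \<partial>lborel)"
      proof (rule nn_integral_cong_AE)
        show "AE z in lborel. f (fst z) (snd z) t = ennreal (\<bar>u (fst z) t - u (snd z) t\<bar> powr p /
          norm (fst z - snd z) powr (real DIM('a) + p * s)) * indicator (?B \<times> ?B) z"
          using ae2
        proof eventually_elim
          case (elim z)
          then show ?case using True by (cases z) (simp add: fe indicator_times)
        qed
      qed
      also have "\<dots> \<le> Wsp_norm_pow s p ?B (\<lambda>x. u x t)"
        by (simp add: Wsp_norm_pow_def nn_integral_completion)
      finally show ?thesis using True by simp
    next
      case False
      then show ?thesis by (simp add: f_def)
    qed
  qed
  then have "(\<integral>\<^sup>+t. \<integral>\<^sup>+x. \<integral>\<^sup>+y. f x y t \<partial>lborel \<partial>lborel \<partial>lborel) \<le> (\<integral>\<^sup>+t. Wsp_norm_pow s p ?B (\<lambda>x. u x t) * indicator {t1..t2} t \<partial>lborel)"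
    by (rule nn_integral_mono_AE)
  then have "(\<integral>\<^sup>+(x, y, t). f x y t \<partial>lborel) < \<infinity>"
    using fin unfolding nn_integral_lborel_triple(2)[OF fm] by (rule order.strict_trans1)
  then show ?thesis by (simp add: f_def)
qed

lemma weak_supersolution_regular:
  fixes u :: "'a::euclidean_space \<Rightarrow> real \<Rightarrow> real" and K :: "'a \<Rightarrow> 'a \<Rightarrow> real \<Rightarrow> real"
  assumes p: "1 < p" and q: "0 < q" and s: "0 < s" "s < 1" and Lam: "1 \<le> \<Lambda>"
    and K: "admissible_kernel p s \<Lambda> T K" and ws: "weak_supersolution p q s K \<Omega> T u"
    and mu: "ereal \<mu> \<le> essinf (lebesgue_on (UNIV \<times> {0<..<T})) (\<lambda>(x, t). u x t)"
    and x0: "cball x0 r \<subseteq> \<Omega>" and r: "0 < r" and ab: "0 < a" "a < b" "b < T"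
  obtains U \<kappa> M t1 t2 where "regular_supersolution p q s \<Lambda> \<mu> M U \<kappa> x0 r a b t1 t2"
    "AE z in lborel. snd z \<in> {0<..<T} \<longrightarrow> u (fst z) (snd z) = U (fst z) (snd z)"
proof -
  have u: "u \<in> Linf_Linf T" "u \<in> Lp_loc_Wsp_loc s p T \<Omega>"
    using ws by (auto simp: weak_supersolution_def)
  obtain U M where U: "case_prod U \<in> borel_measurable (borel \<Otimes>\<^sub>M borel)"
    "\<And>x t. \<mu> \<le> U x t" "\<And>x t. \<bar>U x t\<bar> \<le> M"
    and uU: "AE z in lborel. snd z \<in> {0<..<T} \<longrightarrow> u (fst z) (snd z) = U (fst z) (snd z)"
    by (rule bounded_supersolution_borel_version[OF u(1) mu]) (rule that; assumption)
  obtain \<kappa> where \<kappa>: "(\<lambda>(x, y, t). \<kappa> x y t) \<in> borel_measurable (borel \<Otimes>\<^sub>M borel \<Otimes>\<^sub>M borel)"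
    "\<And>x y t. (1 / \<Lambda>) / norm (x - y) powr (real DIM('a) + p * s) \<le> \<kappa> x y t"
    "\<And>x y t. \<kappa> x y t \<le> \<Lambda> / norm (x - y) powr (real DIM('a) + p * s)"
    and Kk: "AE (x, y, t) in lborel. t \<in> {0<..<T} \<longrightarrow> K x y t = \<kappa> x y t"
    by (rule admissible_kernel_borel_version[OF K Lam]) (rule that; assumption)
  \<comment> \<open>The midpoints leave room on both sides of [a, b]: before a for the backward
    growth of the support under averaging, after b for a vanishing boundary term.\<close>
  define t1 where "t1 = a / 2"
  define t2 where "t2 = (b + T) / 2"
  have t: "0 < t1" "t1 < a" "b < t2" "t2 < T" "t1 < t2" using ab by (auto simp: t1_def t2_def)
  have "regular_supersolution p q s \<Lambda> \<mu> M U \<kappa> x0 r a b t1 t2"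
  proof (unfold_locales; (intro p q s Lam U \<kappa>(1) r ab t)?)
    show "gagliardo_weight p s x y / \<Lambda> \<le> \<kappa> x y t" for x y t using \<kappa>(2)[of x y t] by (simp add: mult.commute)
    show "\<kappa> x y t \<le> \<Lambda> * gagliardo_weight p s x y" for x y t using \<kappa>(3)[of x y t] by simp
    show "(\<integral>\<^sup>+(x, y, t). ennreal (\<bar>U x t - U y t\<bar> powr p * gagliardo_weight p s x y) *
        indicator (ball x0 r \<times> ball x0 r \<times> {t1..t2}) (x, y, t) \<partial>lborel) < \<infinity>"
      by (rule weak_supersolution_local_energy[OF u(2) U(1) uU x0 r t(1,5,4)])
  qed (rule weak_supersolution_tested[OF p q ws U(1) uU \<kappa>(1) Kk x0 r t(1,2) ab(2) t(3,4)])
  then show thesis using uU by (rule that)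
qed

section \<open>The energy estimate\<close>

lemma powr_diff_le:
  fixes x y p :: real
  assumes p: "1 \<le> p"
  shows "0 \<le> x \<Longrightarrow> x \<le> 1 \<Longrightarrow> 0 \<le> y \<Longrightarrow> y \<le> 1 \<Longrightarrow> \<bar>x powr p - y powr p\<bar> \<le> p * \<bar>x - y\<bar>"
proof (induction x y rule: linorder_wlog)
  case (le x y)
  show ?case
  proof (cases "x = y")
    case False
    have "y powr p + p * y powr (p - 1) * (x - y) \<le> x powr p" using le p by (intro powr_tangent_ge) auto
    moreover have "p * y powr (p - 1) * (y - x) \<le> p * 1 * (y - x)"
      using le p powr_mono2[of "p - 1" y 1] by (intro mult_right_mono mult_left_mono) auto
    moreover have "x powr p \<le> y powr p" using le p by (intro powr_mono2) auto
    ultimately show ?thesis using le by (simp add: algebra_simps)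
  qed simp
next
  case (sym x y)
  then show ?case by (simp add: abs_minus_commute)
qed

lemma sum_powr_le:
  fixes x y p :: real
  assumes p: "0 \<le> p" and xy: "0 \<le> x" "0 \<le> y"
  shows "(x + y) powr p \<le> 2 powr p * (x powr p + y powr p)"
proof -
  have "(x + y) powr p \<le> (2 * max x y) powr p" using xy p by (intro powr_mono2) auto
  also have "\<dots> = 2 powr p * (max x y) powr p" using xy by (simp add: powr_mult)
  also have "\<dots> \<le> 2 powr p * (x powr p + y powr p)" by (intro mult_left_mono) (auto simp: max_def)
  finally show ?thesis .
qed

text \<open>A bound of Schur type: integrating out the space variable on which F does not depend
  costs the mass C of the kernel. It serves once with F an indicator, for the cutoff error, and once
  with F the difference of two test functions, away from the diagonal.\<close>

lemma symmetric_kernel_integral_le: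
  fixes f :: "'a::euclidean_space \<Rightarrow> 'a \<Rightarrow> ennreal" and F :: "'a \<Rightarrow> 'b::euclidean_space \<Rightarrow> ennreal"
  assumes f: "case_prod f \<in> borel_measurable (borel \<Otimes>\<^sub>M borel)" and sym: "\<And>x y. f x y = f y x"
    and C: "\<And>x. (\<integral>\<^sup>+y. f x y \<partial>lborel) \<le> C" and F: "case_prod F \<in> borel_measurable (borel \<Otimes>\<^sub>M borel)"
  shows "(\<integral>\<^sup>+(x, y, t). f x y * (F x t + F y t) \<partial>lborel) \<le> 2 * C * (\<integral>\<^sup>+z. F (fst z) (snd z) \<partial>lborel)"
proof -
  note [measurable] = measurable_compose2[OF f] measurable_compose2[OF F]
  have half: "(\<integral>\<^sup>+x. \<integral>\<^sup>+y. \<integral>\<^sup>+t. f x y * F x t \<partial>lborel \<partial>lborel \<partial>lborel) \<le> C * (\<integral>\<^sup>+z. F (fst z) (snd z) \<partial>lborel)"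
  proof -
    have "(\<integral>\<^sup>+x. \<integral>\<^sup>+y. \<integral>\<^sup>+t. f x y * F x t \<partial>lborel \<partial>lborel \<partial>lborel)
        = (\<integral>\<^sup>+x. (\<integral>\<^sup>+y. f x y \<partial>lborel) * (\<integral>\<^sup>+t. F x t \<partial>lborel) \<partial>lborel)"
      by (simp add: nn_integral_cmult nn_integral_multc)
    also have "\<dots> \<le> (\<integral>\<^sup>+x. C * (\<integral>\<^sup>+t. F x t \<partial>lborel) \<partial>lborel)"
      by (intro nn_integral_mono mult_right_mono C) auto
    also have "\<dots> = C * (\<integral>\<^sup>+z. F (fst z) (snd z) \<partial>lborel)"
      by (simp add: nn_integral_cmult nn_integral_lborel_pair(1)[OF F])
    finally show ?thesis .
  qed
  have m1: "(\<lambda>(x, y, t). f x y * F x t) \<in> borel_measurable (borel \<Otimes>\<^sub>M borel \<Otimes>\<^sub>M borel)"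
   and m2: "(\<lambda>(x, y, t). f x y * F y t) \<in> borel_measurable (borel \<Otimes>\<^sub>M borel \<Otimes>\<^sub>M borel)"
    by measurable
  have "(\<integral>\<^sup>+(x, y, t). f x y * (F x t + F y t) \<partial>lborel)
      = (\<integral>\<^sup>+(x, y, t). f x y * F x t \<partial>lborel) + (\<integral>\<^sup>+(x, y, t). f x y * F y t \<partial>lborel)"
    using m1 m2 by (subst nn_integral_add[symmetric]) (auto simp: distrib_left case_prod_beta' borel_prod)
  also have "\<dots> \<le> C * (\<integral>\<^sup>+z. F (fst z) (snd z) \<partial>lborel) + C * (\<integral>\<^sup>+z. F (fst z) (snd z) \<partial>lborel)"
    unfolding nn_integral_lborel_triple(1)[OF m1] nn_integral_lborel_triple(3)[OF m2]
    using half by (intro add_mono) (simp_all add: sym[of _ "_::'a"] cong: nn_integral_cong)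
  finally show ?thesis by (simp add: mult_2 distrib_right)
qed

text \<open>Only \<open>chi_incr\<close> is needed of the time cutoff \<open>\<eta>\<close>: it grows at rate at most \<open>\<beta>\<close>, before \<open>Tb\<close>,
  and decays at rate at least \<open>\<gamma>\<close> on \<open>{c..d}\<close>. It may jump down, since Steklov averaging regularizes.\<close>

locale truncated_test = regular_supersolution p q s \<Lambda> \<mu> M U \<kappa> x0 r a b t1 t2
  for p q s \<Lambda> \<mu> M :: real and U :: "'a::euclidean_space \<Rightarrow> real \<Rightarrow> real"
    and \<kappa> :: "'a \<Rightarrow> 'a \<Rightarrow> real \<Rightarrow> real" and x0 :: 'a and r a b t1 t2 :: real +
  fixes CK L k \<rho> R Ta Tb T0 \<beta> \<gamma> c d h0 :: real and \<eta> :: "real \<Rightarrow> real"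
  assumes CK: "0 < CK" "\<And>(x::'a) \<delta>. 0 < \<delta> \<Longrightarrow>
     (\<integral>\<^sup>+y. ennreal (min 1 ((norm (x - y) / \<delta>) powr p) / norm (x - y) powr (real DIM('a) + p * s)) \<partial>lborel)
       \<le> ennreal (CK * \<delta> powr (- (p * s)))"
    and L: "0 < L" and k: "\<mu> \<le> k" "k \<le> \<mu> + L" and R: "0 < \<rho>" "\<rho> < R" "R < r"
    and T: "a \<le> Ta" "Ta < Tb" "Tb \<le> T0" "T0 \<le> b"
    and chi_meas[measurable]: "\<eta> \<in> borel_measurable borel"
    and chi: "\<And>t. 0 \<le> \<eta> t" "\<And>t. \<eta> t \<le> 1" "\<And>t. \<eta> t \<noteq> 0 \<Longrightarrow> t \<in> {Ta..T0}"
    and bg: "0 \<le> \<beta>" "0 \<le> \<gamma>" and h0: "0 < h0"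
    and chi_incr: "\<And>h t. 0 < h \<Longrightarrow> h < h0 \<Longrightarrow>
      \<eta> (t + h) - \<eta> t \<le> h * (\<beta> * indicat_real {Ta - h..Tb} t - \<gamma> * indicat_real {c..d} t)"
begin

abbreviation W :: "'a \<Rightarrow> 'a \<Rightarrow> real" where "W \<equiv> gagliardo_weight p s"

definition cutoff :: "'a \<Rightarrow> real"
  where "cutoff x = max 0 (min 1 ((R - dist x0 x) / (R - \<rho>)))"

definition G :: "'a \<Rightarrow> real \<Rightarrow> real"
  where "G x t = \<eta> t * (cutoff x powr p * max 0 (k - U x t))"

definition S :: "('a \<times> real) set"
  where "S = {z. fst z \<in> ball x0 R \<and> snd z \<in> {Ta..T0} \<and> U (fst z) (snd z) < k}"

lemma cutoff: "0 \<le> cutoff x" "cutoff x \<le> 1" "cutoff x > 0 \<longleftrightarrow> x \<in> ball x0 R"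
  "x \<in> ball x0 \<rho> \<Longrightarrow> cutoff x = 1"
  using R by (auto simp: cutoff_def less_max_iff_disj zero_less_divide_iff)

lemma cutoff_eq_0: "x \<notin> ball x0 R \<Longrightarrow> cutoff x = 0"
  using cutoff(1,3)[of x] by linarith

lemma cutoff_lipschitz: "\<bar>cutoff x - cutoff y\<bar> \<le> norm (x - y) / (R - \<rho>)"
proof -
  have "\<bar>(R - dist x0 x) / (R - \<rho>) - (R - dist x0 y) / (R - \<rho>)\<bar> = \<bar>dist x0 y - dist x0 x\<bar> / (R - \<rho>)"
    using R by (simp add: diff_divide_distrib[symmetric])
  also have "\<dots> \<le> norm (x - y) / (R - \<rho>)"
  proof (intro divide_right_mono)
    show "\<bar>dist x0 y - dist x0 x\<bar> \<le> norm (x - y)"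
      using dist_triangle[of x0 y x] dist_triangle[of x0 x y]
      by (simp add: dist_norm[symmetric] dist_commute abs_le_iff)
  qed (use R in auto)
  finally show ?thesis unfolding cutoff_def by linarith
qed

lemma cutoff_diff_powr_le:
  "\<bar>cutoff x - cutoff y\<bar> powr p \<le> min 1 ((norm (x - y) / (R - \<rho>)) powr p)"
proof -
  have "\<bar>cutoff x - cutoff y\<bar> \<le> 1" using cutoff(1,2)[of x] cutoff(1,2)[of y] by linarith
  then have "\<bar>cutoff x - cutoff y\<bar> powr p \<le> 1 powr p" using p by (intro powr_mono2) auto
  moreover have "\<bar>cutoff x - cutoff y\<bar> powr p \<le> (norm (x - y) / (R - \<rho>)) powr p"
    using p cutoff_lipschitz by (intro powr_mono2) auto
  ultimately show ?thesis by simp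
qed

lemma cutoff_meas[measurable]: "cutoff \<in> borel_measurable borel"
  unfolding cutoff_def by measurable

lemmas U_comp[measurable] = measurable_compose2[OF U_meas]
lemmas K_comp[measurable] = measurable_compose3[OF K_meas]

lemma G_meas: "case_prod G \<in> borel_measurable (borel \<Otimes>\<^sub>M borel)"
  unfolding G_def by measurable

lemmas G_comp[measurable] = measurable_compose2[OF G_meas]

lemma ball_meas[measurable]: "ball (x::'a) R' \<in> sets borel" by simp

lemma S_meas[measurable]: "S \<in> sets (borel \<Otimes>\<^sub>M borel)"
proof -
  have "S = {z \<in> space (borel \<Otimes>\<^sub>M borel). fst z \<in> ball x0 R \<and> snd z \<in> {Ta..T0} \<and> U (fst z) (snd z) < k}"
    by (auto simp: S_def space_pair_measure)
  also have "\<dots> \<in> sets (borel \<Otimes>\<^sub>M borel)" by measurable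
  finally show ?thesis .
qed

lemma S_finite: "emeasure lborel S = ennreal (measure lborel S)"
proof (rule emeasure_eq_ennreal_measure)
  have "emeasure lborel S \<le> emeasure lborel (ball x0 R \<times> {Ta..T0})"
    by (intro emeasure_mono) (auto simp: S_def borel_prod[symmetric])
  also have "\<dots> = emeasure lborel (ball x0 R) * emeasure lborel {Ta..T0}"
    unfolding lborel_prod[symmetric] by (subst lborel.emeasure_pair_measure_Times) auto
  also have "\<dots> < \<infinity>"
    using emeasure_lborel_ball_finite[of x0 R] by (auto simp: ennreal_mult_less_top emeasure_lborel_Icc_eq)
  finally show "emeasure lborel S \<noteq> top" by simp
qed

lemma G_bounds: "0 \<le> G x t" "G x t \<le> L"
proof -
  have "cutoff x powr p \<le> 1 powr p" using cutoff p by (intro powr_mono2) auto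
  then have "\<eta> t * (cutoff x powr p * max 0 (k - U x t)) \<le> 1 * (1 * L)"
    using chi cutoff L k U_lower[of x t] by (intro mult_mono) auto
  then show "G x t \<le> L" by (simp add: G_def)
  show "0 \<le> G x t" using chi by (auto simp: G_def intro!: mult_nonneg_nonneg)
qed

lemma G_support: "G x t \<noteq> 0 \<Longrightarrow> x \<in> ball x0 R \<and> t \<in> {Ta..T0}"
  using chi(3)[of t] cutoff_eq_0[of x] p by (auto simp: G_def)

lemma cutoff_kernel_integral:
  assumes A[measurable]: "A \<in> sets (borel \<Otimes>\<^sub>M borel)"
  shows "(\<integral>\<^sup>+(x, y, t). ennreal (\<bar>cutoff x - cutoff y\<bar> powr p * W x y) * (indicator A (x, t) + indicator A (y, t)) \<partial>lborel)
    \<le> ennreal (2 * CK * (R - \<rho>) powr (- (p * s))) * emeasure lborel A"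
proof -
  define f where "f x y = ennreal (\<bar>cutoff x - cutoff y\<bar> powr p * W x y)" for x y :: 'a
  have fm: "case_prod f \<in> borel_measurable (borel \<Otimes>\<^sub>M borel)" unfolding f_def by measurable
  note [measurable] = measurable_compose2[OF fm]
  have sym: "f x y = f y x" for x y by (simp add: f_def norm_minus_commute abs_minus_commute)
  have fC: "(\<integral>\<^sup>+y. f x y \<partial>lborel) \<le> ennreal (CK * (R - \<rho>) powr (- (p * s)))" for x
  proof -
    have "(\<integral>\<^sup>+y. f x y \<partial>lborel) \<le> (\<integral>\<^sup>+y. ennreal (min 1 ((norm (x - y) / (R - \<rho>)) powr p) / norm (x - y) powr (real DIM('a) + p * s)) \<partial>lborel)"
      unfolding f_def using cutoff_diff_powr_le[of x]
      by (intro nn_integral_mono ennreal_leI) (auto intro!: divide_right_mono)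
    also have "\<dots> \<le> ennreal (CK * (R - \<rho>) powr (- (p * s)))" using CK(2) R by simp
    finally show ?thesis .
  qed
  have Am: "case_prod (\<lambda>x t. indicator A (x, t) :: ennreal) \<in> borel_measurable (borel \<Otimes>\<^sub>M borel)"
    by (simp add: case_prod_beta')
  have "A \<in> sets lborel" using A by (metis borel_prod sets_lborel)
  then have "(\<integral>\<^sup>+(x, y, t). f x y * (indicator A (x, t) + indicator A (y, t)) \<partial>lborel)
      \<le> 2 * ennreal (CK * (R - \<rho>) powr (- (p * s))) * emeasure lborel A"
    using symmetric_kernel_integral_le[OF fm sym fC Am] by (simp add: nn_integral_indicator)
  also have "2 * ennreal (CK * (R - \<rho>) powr (- (p * s))) = ennreal (2 * CK * (R - \<rho>) powr (- (p * s)))"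
    using CK(1) by (simp add: mult_2[symmetric] ennreal_mult' mult.assoc ennreal_numeral[symmetric] del: ennreal_numeral)
  finally show ?thesis by (simp add: f_def)
qed

text \<open>The energy of U is known to be finite only on the ball of radius r. If one of the points
  lies outside it, the cutoff vanishes there and the difference is paid by the cutoff alone;
  otherwise the product rule splits it.\<close>

lemma G_diff_le:
  "\<bar>G x t - G y t\<bar> \<le> \<bar>U x t - U y t\<bar> * indicat_real (ball x0 r \<times> ball x0 r \<times> {t1..t2}) (x, y, t)
     + (L * p) * (\<bar>cutoff x - cutoff y\<bar> * indicat_real {a..b} t)"
proof (cases "\<eta> t = 0 \<or> x \<notin> ball x0 R \<and> y \<notin> ball x0 R")
  case True
  then have "G x t = 0" "G y t = 0" using cutoff_eq_0 p by (auto simp: G_def)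
  then show ?thesis using L p by (auto simp: indicator_def)
next
  case False
  then have tt: "t \<in> {a..b}" "t \<in> {t1..t2}" using chi(3)[of t] T t by auto
  define w where "w x = max 0 (k - U x t)" for x
  have w: "0 \<le> w x" "w x \<le> L" for x using U_lower[of x t] k L by (auto simp: w_def)
  define Z where "Z x = cutoff x powr p" for x
  have Z: "0 \<le> Z x" "Z x \<le> 1" for x
    using cutoff[of x] p powr_mono2[of p "cutoff x" 1] by (auto simp: Z_def)
  have ZZ: "\<bar>Z x - Z y\<bar> \<le> p * \<bar>cutoff x - cutoff y\<bar>"
    unfolding Z_def using p by (intro powr_diff_le cutoff) auto
  have D: "\<bar>G x t - G y t\<bar> \<le> \<bar>Z x * w x - Z y * w y\<bar>"
  proof -
    have "G x t - G y t = \<eta> t * (Z x * w x - Z y * w y)" by (simp add: G_def Z_def w_def algebra_simps)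
    then have "\<bar>G x t - G y t\<bar> = \<eta> t * \<bar>Z x * w x - Z y * w y\<bar>" using chi(1)[of t] by (simp add: abs_mult)
    also have "\<dots> \<le> 1 * \<bar>Z x * w x - Z y * w y\<bar>" using chi(2)[of t] by (intro mult_right_mono) auto
    finally show ?thesis by simp
  qed
  show ?thesis
  proof (cases "x \<in> ball x0 r \<and> y \<in> ball x0 r")
    case True
    have "Z x * w x - Z y * w y = Z x * (w x - w y) + (Z x - Z y) * w y" by (simp add: algebra_simps)
    then have "\<bar>Z x * w x - Z y * w y\<bar> \<le> Z x * \<bar>w x - w y\<bar> + \<bar>Z x - Z y\<bar> * w y"
      using Z[of x] w[of y] by (metis abs_mult abs_of_nonneg abs_triangle_ineq)
    also have "\<dots> \<le> 1 * \<bar>U x t - U y t\<bar> + (p * \<bar>cutoff x - cutoff y\<bar>) * L"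
      using Z w ZZ p by (intro add_mono mult_mono) (auto simp: w_def)
    finally show ?thesis using D True tt by (simp add: algebra_simps)
  next
    case False
    then have "Z x = 0 \<or> Z y = 0" using cutoff_eq_0[of x] cutoff_eq_0[of y] R p by (auto simp: Z_def)
    then have "\<bar>Z x * w x - Z y * w y\<bar> \<le> \<bar>Z x - Z y\<bar> * L"
      using Z w L by (auto simp: abs_mult intro!: mult_left_mono)
    also have "\<dots> \<le> (p * \<bar>cutoff x - cutoff y\<bar>) * L" using ZZ L by (intro mult_right_mono) auto
    finally show ?thesis using D tt \<open>\<not> (x \<in> ball x0 r \<and> y \<in> ball x0 r)\<close>
      by (auto simp: algebra_simps indicator_def)
  qed
qed

text \<open>This is purely qualitative: the bound involves the local energy of U, which enters none
  of the constants of the iteration.\<close>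

lemma G_energy_finite: "gagliardo_energy W p G < \<infinity>"
proof -
  let ?I = "indicat_real (ball x0 r \<times> ball x0 r \<times> {t1..t2})"
  let ?A = "ball x0 R \<times> {a..b}"
  define f where "f w = (case w of (x, y, t) \<Rightarrow> ennreal (\<bar>U x t - U y t\<bar> powr p * W x y) *
        indicator (ball x0 r \<times> ball x0 r \<times> {t1..t2}) (x, y, t))" for w
  define g where "g w = (case w of (x, y, t) \<Rightarrow> ennreal (\<bar>cutoff x - cutoff y\<bar> powr p * W x y) * (indicator ?A (x, t) + indicator ?A (y, t)))" for w
  have Bm: "ball x0 r \<times> ball x0 r \<times> {t1..t2} \<in> sets (borel \<Otimes>\<^sub>M borel \<Otimes>\<^sub>M borel)"
    by (intro pair_measureI) auto
  have Am[measurable]: "?A \<in> sets (borel \<Otimes>\<^sub>M borel)" by (intro pair_measureI) auto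
  have fm[measurable]: "f \<in> borel_measurable borel" unfolding f_def borel_prod[symmetric] using Bm by measurable
  have gm[measurable]: "g \<in> borel_measurable borel" unfolding g_def borel_prod[symmetric] by measurable
  have ptw: "(case w of (x, y, t) \<Rightarrow> ennreal (\<bar>G x t - G y t\<bar> powr p * W x y))
      \<le> ennreal (2 powr p) * f w + ennreal (2 powr p * (L * p) powr p) * g w" for w
  proof -
    obtain x y t where w: "w = (x, y, t)" by (cases w)
    have "ennreal (\<bar>G x t - G y t\<bar> powr p * W x y) \<le> ennreal ((2 powr p * ((\<bar>U x t - U y t\<bar> * ?I (x, y, t)) powr p
        + ((L * p) * (\<bar>cutoff x - cutoff y\<bar> * indicat_real {a..b} t)) powr p)) * W x y)"
    proof (intro ennreal_leI mult_right_mono)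
      have "\<bar>G x t - G y t\<bar> powr p \<le> (\<bar>U x t - U y t\<bar> * ?I (x, y, t) + (L * p) * (\<bar>cutoff x - cutoff y\<bar> * indicat_real {a..b} t)) powr p"
        using p by (intro powr_mono2 G_diff_le) auto
      also have "\<dots> \<le> 2 powr p * ((\<bar>U x t - U y t\<bar> * ?I (x, y, t)) powr p
        + ((L * p) * (\<bar>cutoff x - cutoff y\<bar> * indicat_real {a..b} t)) powr p)"
        using p L by (intro sum_powr_le) auto
      finally show "\<bar>G x t - G y t\<bar> powr p \<le> 2 powr p * ((\<bar>U x t - U y t\<bar> * ?I (x, y, t)) powr p
        + ((L * p) * (\<bar>cutoff x - cutoff y\<bar> * indicat_real {a..b} t)) powr p)" .
    qed auto
    also have "\<dots> = ennreal (2 powr p) * (ennreal (\<bar>U x t - U y t\<bar> powr p * W x y) * ennreal (?I (x, y, t)))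
       + ennreal (2 powr p * (L * p) powr p) * (ennreal (\<bar>cutoff x - cutoff y\<bar> powr p * W x y) * ennreal (indicat_real {a..b} t))"
    proof -
      have "(2 powr p * ((\<bar>U x t - U y t\<bar> * ?I (x, y, t)) powr p
        + ((L * p) * (\<bar>cutoff x - cutoff y\<bar> * indicat_real {a..b} t)) powr p)) * W x y
        = 2 powr p * ((\<bar>U x t - U y t\<bar> powr p * W x y) * ?I (x, y, t))
         + (2 powr p * (L * p) powr p) * ((\<bar>cutoff x - cutoff y\<bar> powr p * W x y) * indicat_real {a..b} t)"
        using L p by (simp add: indicator_def powr_mult algebra_simps add_divide_distrib)
      then show ?thesis by (simp only:) (simp add: ennreal_mult'[symmetric] ennreal_plus[symmetric] del: ennreal_plus)
    qed
    also have "\<dots> \<le> ennreal (2 powr p) * f w + ennreal (2 powr p * (L * p) powr p) * g w"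
    proof (intro add_mono mult_left_mono)
      show "ennreal (\<bar>U x t - U y t\<bar> powr p * W x y) * ennreal (?I (x, y, t)) \<le> f w"
        by (simp add: f_def w ennreal_indicator)
      show "ennreal (\<bar>cutoff x - cutoff y\<bar> powr p * W x y) * ennreal (indicat_real {a..b} t) \<le> g w"
      proof (cases "x \<in> ball x0 R \<or> y \<in> ball x0 R")
        case True
        have "ennreal (indicat_real {a..b} t) \<le> indicator ?A (x, t) + indicator ?A (y, t)"
          using True by (auto simp: indicator_def)
        then show ?thesis unfolding g_def w by (simp add: mult_left_mono)
      next
        case False
        then have "cutoff x = 0" "cutoff y = 0" using cutoff_eq_0 by auto
        then show ?thesis by simp
      qed
    qed auto
    finally show ?thesis by (simp add: w)
  qed
  have "gagliardo_energy W p G \<le> (\<integral>\<^sup>+w. ennreal (2 powr p) * f w + ennreal (2 powr p * (L * p) powr p) * g w \<partial>lborel)"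
    unfolding gagliardo_energy_def by (intro nn_integral_mono ptw)
  also have "\<dots> = ennreal (2 powr p) * (\<integral>\<^sup>+w. f w \<partial>lborel) + ennreal (2 powr p * (L * p) powr p) * (\<integral>\<^sup>+w. g w \<partial>lborel)"
    by (simp add: nn_integral_add nn_integral_cmult)
  also have "\<dots> < \<infinity>"
  proof -
    have 1: "(\<integral>\<^sup>+w. f w \<partial>lborel) < \<infinity>" using U_energy by (simp add: f_def)
    have "emeasure lborel ?A = emeasure lborel (ball x0 R) * emeasure lborel {a..b}"
      unfolding lborel_prod[symmetric] by (subst lborel.emeasure_pair_measure_Times) auto
    also have "\<dots> < \<infinity>"
      using emeasure_lborel_ball_finite[of x0 R] by (auto simp: ennreal_mult_less_top emeasure_lborel_Icc_eq)
    finally have "(\<integral>\<^sup>+w. g w \<partial>lborel) < \<infinity>"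
      using cutoff_kernel_integral[OF Am] unfolding g_def
      by (auto intro: order.strict_trans1 simp: ennreal_mult_less_top)
    then show ?thesis using 1 by (auto simp: ennreal_mult_less_top)
  qed
  finally show ?thesis .
qed

end

section \<open>Replacing the Steklov average of the test function by the test function
  itself\<close>

lemma borel_measurable_triple:
  fixes f :: "'b::euclidean_space \<times> 'c::euclidean_space \<times> 'd::euclidean_space \<Rightarrow> 'e::topological_space"
  assumes "f \<in> borel_measurable (borel \<Otimes>\<^sub>M borel \<Otimes>\<^sub>M borel)"
  shows "f \<in> borel_measurable lborel"
  using assms by (simp add: borel_prod)

lemma powr_mixed_le:
  fixes x y p :: real
  assumes p: "1 < p" and xy: "0 \<le> x" "0 \<le> y"
  shows "x powr (p - 1) * y \<le> x powr p + y powr p"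
proof (cases "y \<le> x")
  case True
  then have "x powr (p - 1) * y \<le> x powr (p - 1) * x" by (intro mult_left_mono) auto
  also have "\<dots> = x powr p" using xy by (cases "x = 0") (auto simp: powr_diff)
  finally show ?thesis by (simp add: add_increasing2)
next
  case False
  then have "x powr (p - 1) * y \<le> y powr (p - 1) * y" using xy p by (intro mult_right_mono powr_mono2) auto
  also have "\<dots> = y powr p" using False xy by (auto simp: powr_diff)
  finally show ?thesis by (simp add: add_increasing)
qed

text \<open>The neighbourhoods shrink to the diagonal, where F vanishes, so dominated convergence
  applies with F as its own majorant.\<close>

lemma nn_integral_near_diagonal_tendsto_0:
  fixes F :: "'a::euclidean_space \<times> 'a \<times> 'b::euclidean_space \<Rightarrow> ennreal"
  assumes F[measurable]: "F \<in> borel_measurable borel" and fin: "(\<integral>\<^sup>+w. F w \<partial>lborel) < \<infinity>"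
    and diag: "\<And>x t. F (x, x, t) = 0"
  shows "(\<lambda>n. \<integral>\<^sup>+w. F w * indicator {w. norm (fst w - fst (snd w)) < inverse (real (Suc n))} w \<partial>lborel) \<longlonglongrightarrow> 0"
proof -
  have m[measurable]: "{w :: 'a \<times> 'a \<times> 'b. norm (fst w - fst (snd w)) < e} \<in> sets borel" for e
    by (intro borel_open open_Collect_less continuous_intros)
  have "(\<lambda>n. \<integral>\<^sup>+w. F w * indicator {w. norm (fst w - fst (snd w)) < inverse (real (Suc n))} w \<partial>lborel)
      \<longlonglongrightarrow> (\<integral>\<^sup>+w. 0 \<partial>(lborel :: ('a \<times> 'a \<times> 'b) measure))"
  proof (rule nn_integral_dominated_convergence[where w = F])
    show "(\<integral>\<^sup>+w. F w \<partial>lborel) < \<infinity>" by (rule fin)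
    show "AE w in lborel. F w * indicator {w. norm (fst w - fst (snd w)) < inverse (real (Suc n))} w \<le> F w" for n
      by (auto simp: indicator_def)
    show "AE w in lborel. (\<lambda>n. F w * indicator {w. norm (fst w - fst (snd w)) < inverse (real (Suc n))} w) \<longlonglongrightarrow> 0"
    proof (intro AE_I2)
      fix w :: "'a \<times> 'a \<times> 'b"
      obtain x y t where w: "w = (x, y, t)" by (cases w)
      show "(\<lambda>n. F w * indicator {w. norm (fst w - fst (snd w)) < inverse (real (Suc n))} w) \<longlonglongrightarrow> 0"
      proof (cases "x = y")
        case True then show ?thesis using diag by (simp add: w)
      next
        case False
        then obtain N where N: "inverse (real (Suc N)) < norm (x - y)" using reals_Archimedean[of "norm (x - y)"] by auto
        have "F w * indicator {w. norm (fst w - fst (snd w)) < inverse (real (Suc n))} w = 0" if "N \<le> n" for n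
        proof -
          have "inverse (real (Suc n)) \<le> inverse (real (Suc N))" using that by (simp add: le_imp_inverse_le)
          then have "\<not> norm (x - y) < inverse (real (Suc n))" using N by linarith
          then show ?thesis by (simp add: w indicator_def del: of_nat_Suc)
        qed
        then show ?thesis by (intro tendsto_eventually) (auto simp: eventually_sequentially)
      qed
    qed
  qed measurable
  then show ?thesis by simp
qed

lemma integrable_bounded_cylinder:
  fixes f :: "'a::euclidean_space \<Rightarrow> real \<Rightarrow> real"
  assumes f: "case_prod f \<in> borel_measurable (borel \<Otimes>\<^sub>M borel)" and B: "\<And>x t. \<bar>f x t\<bar> \<le> B"
    and supp: "\<And>x t. f x t \<noteq> 0 \<Longrightarrow> x \<in> ball x0 R \<and> t \<in> {\<alpha>..\<omega>}"
  shows "integrable lborel (\<lambda>z. f (fst z) (snd z))"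
proof (rule integrableI_bounded_set)
  show "(\<lambda>z. f (fst z) (snd z)) \<in> borel_measurable lborel"
    using f by (simp add: borel_prod case_prod_beta')
  show "ball x0 R \<times> {\<alpha>..\<omega>} \<in> sets lborel" by (simp add: borel_prod[symmetric])
  have "emeasure lborel (ball x0 R \<times> {\<alpha>..\<omega>}) = emeasure lborel (ball x0 R) * emeasure lborel {\<alpha>..\<omega>}"
    unfolding lborel_prod[symmetric] by (subst lborel.emeasure_pair_measure_Times) auto
  also have "\<dots> < \<infinity>"
    using emeasure_lborel_ball_finite[of x0 R] by (auto simp: ennreal_mult_less_top emeasure_lborel_Icc_eq)
  finally show "emeasure lborel (ball x0 R \<times> {\<alpha>..\<omega>}) < \<infinity>" .
  show "AE z in lborel. z \<in> ball x0 R \<times> {\<alpha>..\<omega>} \<longrightarrow> norm (f (fst z) (snd z)) \<le> B" using B by simp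
  show "AE z in lborel. z \<notin> ball x0 R \<times> {\<alpha>..\<omega>} \<longrightarrow> f (fst z) (snd z) = 0"
  proof (intro AE_I2 impI)
    fix z assume "z \<notin> ball x0 R \<times> {\<alpha>..\<omega>}"
    then show "f (fst z) (snd z) = 0" using supp[of "fst z" "snd z"] by (cases z) auto
  qed
qed

lemma integral_lborel_shift:
  fixes f :: "'b::euclidean_space \<Rightarrow> real"
  assumes [measurable]: "f \<in> borel_measurable borel"
  shows "(\<integral>z. f (z + c) \<partial>lborel) = (\<integral>z. f z \<partial>lborel)"
proof -
  have "(\<integral>z. f z \<partial>lborel) = (\<integral>z. f z \<partial>distr lborel borel ((+) c))" by (simp only: lborel_distr_plus)
  also have "\<dots> = (\<integral>z. f (c + z) \<partial>lborel)" by (subst integral_distr) auto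
  finally show ?thesis by (simp add: add.commute)
qed

context truncated_test
begin

definition energy_form :: "('a \<Rightarrow> real \<Rightarrow> real) \<Rightarrow> 'a \<times> 'a \<times> real \<Rightarrow> real"
  where "energy_form \<Phi> w = (case w of (x, y, t) \<Rightarrow> indicat_real {t1..t2} t *
    (signed_power (p - 1) (U x t - U y t) * (\<Phi> x t - \<Phi> y t) * \<kappa> x y t))"

definition far :: "real \<Rightarrow> ('a \<times> 'a \<times> real) set"
  where "far \<delta> = {w. \<delta> \<le> norm (fst w - fst (snd w))}"

lemma far_meas[measurable]: "far \<delta> \<in> sets borel" "- far \<delta> \<in> sets borel"
proof -
  show "far \<delta> \<in> sets borel" unfolding far_def by (intro borel_closed closed_Collect_le continuous_intros)
  then show "- far \<delta> \<in> sets borel" by simp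
qed

lemma energy_form_meas:
  assumes "case_prod \<Phi> \<in> borel_measurable (borel \<Otimes>\<^sub>M borel)"
  shows "energy_form \<Phi> \<in> borel_measurable borel"
proof -
  note [measurable] = measurable_compose2[OF assms]
  show ?thesis unfolding energy_form_def borel_prod[symmetric] by measurable
qed

lemma K_nonneg: "0 \<le> \<kappa> x y t"
  by (rule order_trans[OF _ K_lower]) (use Lam in auto)

text \<open>A Young majorant of the energy form near the diagonal, up to the factor \<Lambda>. The
  part from U is confined to the region where its energy is finite.\<close>

definition near_energy :: "('a \<Rightarrow> real \<Rightarrow> real) \<Rightarrow> 'a \<times> 'a \<times> real \<Rightarrow> ennreal"
  where "near_energy \<Phi> w = (case w of (x, y, t) \<Rightarrow>
     ennreal (\<bar>U x t - U y t\<bar> powr p * W x y) * indicator (ball x0 r \<times> ball x0 r \<times> {t1..t2}) (x, y, t)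
     + ennreal (\<bar>\<Phi> x t - \<Phi> y t\<bar> powr p * W x y))"

lemma U_energy_meas: "(\<lambda>(x, y, t). ennreal (\<bar>U x t - U y t\<bar> powr p * W x y) *
    indicator (ball x0 r \<times> ball x0 r \<times> {t1..t2}) (x, y, t)) \<in> borel_measurable (borel \<Otimes>\<^sub>M borel \<Otimes>\<^sub>M borel)"
proof -
  have [measurable]: "ball x0 r \<times> ball x0 r \<times> {t1..t2} \<in> sets (borel \<Otimes>\<^sub>M borel \<Otimes>\<^sub>M borel)"
    by (intro pair_measureI) auto
  show ?thesis by measurable
qed

lemma near_energy_meas:
  assumes "case_prod \<Phi> \<in> borel_measurable (borel \<Otimes>\<^sub>M borel)"
  shows "near_energy \<Phi> \<in> borel_measurable borel"
proof -
  have "near_energy \<Phi> = (\<lambda>w. (\<lambda>(x, y, t). ennreal (\<bar>U x t - U y t\<bar> powr p * W x y) *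
    indicator (ball x0 r \<times> ball x0 r \<times> {t1..t2}) (x, y, t)) w + (\<lambda>(x, y, t). ennreal (\<bar>\<Phi> x t - \<Phi> y t\<bar> powr p * W x y)) w)"
    by (auto simp: near_energy_def)
  then show ?thesis
    using U_energy_meas measurable_gagliardo_integrand[OF assms measurable_gagliardo_weight, of p p s]
    unfolding borel_prod[symmetric] by (simp only: borel_measurable_add)
qed

lemma near_energy_integral:
  assumes \<Phi>: "case_prod \<Phi> \<in> borel_measurable (borel \<Otimes>\<^sub>M borel)" and E: "gagliardo_energy W p \<Phi> < \<infinity>"
  shows "(\<integral>\<^sup>+w. near_energy \<Phi> w \<partial>lborel) < \<infinity>"
proof -
  let ?f = "\<lambda>(x, y, t). ennreal (\<bar>U x t - U y t\<bar> powr p * W x y) * indicator (ball x0 r \<times> ball x0 r \<times> {t1..t2}) (x, y, t)"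
  let ?g = "\<lambda>(x, y, t). ennreal (\<bar>\<Phi> x t - \<Phi> y t\<bar> powr p * W x y)"
  have m: "?f \<in> borel_measurable lborel" "?g \<in> borel_measurable lborel"
    by (rule borel_measurable_triple[OF U_energy_meas],
        rule borel_measurable_triple[OF measurable_gagliardo_integrand[OF \<Phi> measurable_gagliardo_weight]])
  have "(\<integral>\<^sup>+w. near_energy \<Phi> w \<partial>lborel) = (\<integral>\<^sup>+w. ?f w + ?g w \<partial>lborel)"
    by (rule nn_integral_cong) (auto simp: near_energy_def)
  also have "\<dots> = (\<integral>\<^sup>+w. ?f w \<partial>lborel) + (\<integral>\<^sup>+w. ?g w \<partial>lborel)" by (rule nn_integral_add[OF m])
  also have "\<dots> < \<infinity>" using U_energy E unfolding gagliardo_energy_def by simp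
  finally show ?thesis .
qed

text \<open>Since \<delta> \<le> r - R, both points of a close pair lie in the ball of radius r as
  soon as one of them lies in the support of the test function; the local energy of U is available
  there.\<close>

lemma near_bound:
  assumes supp: "\<And>x t. \<Phi> x t \<noteq> 0 \<Longrightarrow> x \<in> ball x0 R" and d: "\<delta> \<le> r - R"
  shows "ennreal \<bar>energy_form \<Phi> w\<bar> * indicator (- far \<delta>) w \<le> ennreal \<Lambda> * (near_energy \<Phi> w * indicator (- far \<delta>) w)"
proof -
  obtain x y t where w: "w = (x, y, t)" by (cases w)
  have "ennreal \<bar>energy_form \<Phi> w\<bar> \<le> ennreal \<Lambda> * near_energy \<Phi> w" if near: "norm (x - y) < \<delta>"
  proof (cases "t \<in> {t1..t2} \<and> \<Phi> x t \<noteq> \<Phi> y t")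
    case True
    then have "x \<in> ball x0 R \<or> y \<in> ball x0 R" using supp[of x t] supp[of y t] by metis
    then have xy: "x \<in> ball x0 r" "y \<in> ball x0 r"
      using dist_triangle[of x0 y x] dist_triangle[of x0 x y] near d norm_ge_zero[of "x - y"]
      by (auto simp: dist_norm[of x y] dist_norm[of y x] norm_minus_commute[of y x])
    have "\<bar>energy_form \<Phi> w\<bar> = (\<bar>U x t - U y t\<bar> powr (p - 1) * \<bar>\<Phi> x t - \<Phi> y t\<bar>) * \<kappa> x y t"
      using True p K_nonneg by (simp add: energy_form_def w abs_mult abs_signed_power)
    also have "\<dots> \<le> (\<bar>U x t - U y t\<bar> powr p + \<bar>\<Phi> x t - \<Phi> y t\<bar> powr p) * (\<Lambda> * W x y)"
      using p K_nonneg K_upper by (intro mult_mono powr_mixed_le) auto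
    also have "\<dots> = \<Lambda> * (\<bar>U x t - U y t\<bar> powr p * W x y + \<bar>\<Phi> x t - \<Phi> y t\<bar> powr p * W x y)"
      by (simp add: algebra_simps add_divide_distrib)
    finally have "ennreal \<bar>energy_form \<Phi> w\<bar> \<le> ennreal \<dots>" by (rule ennreal_leI)
    also have "\<dots> = ennreal \<Lambda> * (ennreal (\<bar>U x t - U y t\<bar> powr p * W x y) + ennreal (\<bar>\<Phi> x t - \<Phi> y t\<bar> powr p * W x y))"
      using Lam by (subst ennreal_mult') (auto simp: ennreal_plus)
    finally show ?thesis using True xy by (simp add: near_energy_def w)
  next
    case False
    then have "energy_form \<Phi> w = 0" by (auto simp: energy_form_def w)
    then show ?thesis by simp
  qed
  then show ?thesis by (auto simp: w far_def indicator_def)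
qed

text \<open>Away from the diagonal the factor
  \<open>min 1 ((norm (x - y) / \<delta>) powr p)\<close> equals 1, and inserting it makes the
  kernel integrable with the constant \<open>CK\<close>. The form is linear in the test function,
  and its factor in U is simply bounded by means of M.\<close>

lemma far_bound:
  assumes d: "0 < \<delta>"
  shows "ennreal \<bar>energy_form \<Phi> w - energy_form \<Psi> w\<bar> * indicator (far \<delta>) w \<le>
    (case w of (x, y, t) \<Rightarrow> ennreal (\<Lambda> * (2 * M) powr (p - 1)) * (ennreal (min 1 ((norm (x - y) / \<delta>) powr p) * W x y) *
      (ennreal \<bar>\<Phi> x t - \<Psi> x t\<bar> + ennreal \<bar>\<Phi> y t - \<Psi> y t\<bar>)))"
proof -
  obtain x y t where w: "w = (x, y, t)" by (cases w)
  show ?thesis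
  proof (cases "w \<in> far \<delta>")
    case True
    then have "1 \<le> (norm (x - y) / \<delta>) powr p"
      using d p by (intro ge_one_powr_ge_zero) (auto simp: far_def w)
    then have m: "min 1 ((norm (x - y) / \<delta>) powr p) = 1" by simp
    have M: "0 \<le> M" using U_abs[of x t] by linarith
    have UM: "\<bar>U x t - U y t\<bar> \<le> 2 * M" using U_abs[of x t] U_abs[of y t] by linarith
    have "energy_form \<Phi> w - energy_form \<Psi> w = indicat_real {t1..t2} t * (signed_power (p - 1) (U x t - U y t) *
        ((\<Phi> x t - \<Psi> x t) - (\<Phi> y t - \<Psi> y t)) * \<kappa> x y t)"
      by (simp add: energy_form_def w algebra_simps)
    then have "\<bar>energy_form \<Phi> w - energy_form \<Psi> w\<bar> = indicat_real {t1..t2} t * (\<bar>U x t - U y t\<bar> powr (p - 1) *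
        \<bar>(\<Phi> x t - \<Psi> x t) - (\<Phi> y t - \<Psi> y t)\<bar> * \<kappa> x y t)"
      using p K_nonneg by (simp add: abs_mult abs_signed_power)
    also have "\<dots> \<le> 1 * ((2 * M) powr (p - 1) * (\<bar>\<Phi> x t - \<Psi> x t\<bar> + \<bar>\<Phi> y t - \<Psi> y t\<bar>) * (\<Lambda> * W x y))"
      using p K_nonneg K_upper UM M by (intro mult_mono powr_mono2) (auto simp: indicator_def)
    also have "\<dots> = (\<Lambda> * (2 * M) powr (p - 1)) * (W x y * (\<bar>\<Phi> x t - \<Psi> x t\<bar> + \<bar>\<Phi> y t - \<Psi> y t\<bar>))"
      by (simp add: algebra_simps)
    finally have "ennreal \<bar>energy_form \<Phi> w - energy_form \<Psi> w\<bar> \<le> ennreal \<dots>" by (rule ennreal_leI)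
    also have "\<dots> = ennreal (\<Lambda> * (2 * M) powr (p - 1)) * (ennreal (W x y) * (ennreal \<bar>\<Phi> x t - \<Psi> x t\<bar> + ennreal \<bar>\<Phi> y t - \<Psi> y t\<bar>))"
      using Lam by (subst ennreal_mult', simp, subst ennreal_mult', simp, simp)
    finally show ?thesis using True m by (simp add: w)
  qed simp
qed

lemma far_integral:
  assumes d: "0 < \<delta>" and \<Phi>: "case_prod \<Phi> \<in> borel_measurable (borel \<Otimes>\<^sub>M borel)" and \<Psi>: "case_prod \<Psi> \<in> borel_measurable (borel \<Otimes>\<^sub>M borel)"
  shows "(\<integral>\<^sup>+w. ennreal \<bar>energy_form \<Phi> w - energy_form \<Psi> w\<bar> * indicator (far \<delta>) w \<partial>lborel)
    \<le> ennreal (\<Lambda> * (2 * M) powr (p - 1)) * (2 * ennreal (CK * \<delta> powr (- (p * s))) *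
        (\<integral>\<^sup>+z. ennreal \<bar>\<Phi> (fst z) (snd z) - \<Psi> (fst z) (snd z)\<bar> \<partial>lborel))"
proof -
  note [measurable] = measurable_compose2[OF \<Phi>] measurable_compose2[OF \<Psi>]
  define f where "f x y = ennreal (min 1 ((norm (x - y) / \<delta>) powr p) * W x y)" for x y :: 'a
  define F where "F x t = ennreal \<bar>\<Phi> x t - \<Psi> x t\<bar>" for x t
  have fm: "case_prod f \<in> borel_measurable (borel \<Otimes>\<^sub>M borel)" unfolding f_def by measurable
  have Fm: "case_prod F \<in> borel_measurable (borel \<Otimes>\<^sub>M borel)" unfolding F_def by measurable
  note [measurable] = measurable_compose2[OF fm] measurable_compose2[OF Fm]
  have "(\<integral>\<^sup>+w. ennreal \<bar>energy_form \<Phi> w - energy_form \<Psi> w\<bar> * indicator (far \<delta>) w \<partial>lborel)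
      \<le> (\<integral>\<^sup>+w. (case w of (x, y, t) \<Rightarrow> ennreal (\<Lambda> * (2 * M) powr (p - 1)) * (f x y * (F x t + F y t))) \<partial>lborel)"
    unfolding f_def F_def by (intro nn_integral_mono far_bound d)
  also have "\<dots> = ennreal (\<Lambda> * (2 * M) powr (p - 1)) * (\<integral>\<^sup>+(x, y, t). f x y * (F x t + F y t) \<partial>lborel)"
    by (subst nn_integral_cmult[symmetric]) (auto simp: case_prod_beta' borel_prod[symmetric])
  also have "\<dots> \<le> ennreal (\<Lambda> * (2 * M) powr (p - 1)) * (2 * ennreal (CK * \<delta> powr (- (p * s))) * (\<integral>\<^sup>+z. F (fst z) (snd z) \<partial>lborel))"
  proof (intro mult_left_mono symmetric_kernel_integral_le[OF fm _ _ Fm])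
    show "f x y = f y x" for x y by (simp add: f_def norm_minus_commute)
    show "(\<integral>\<^sup>+y. f x y \<partial>lborel) \<le> ennreal (CK * \<delta> powr (- (p * s)))" for x using CK(2)[OF d, of x] by (simp add: f_def)
  qed auto
  finally show ?thesis by (simp add: F_def)
qed

text \<open>What G shares with all its averages and what makes the energy form integrable. The
  initial time e is left open because averaging moves it backwards.\<close>

definition admissible :: "('a \<Rightarrow> real \<Rightarrow> real) \<Rightarrow> bool"
  where "admissible \<Phi> \<longleftrightarrow> case_prod \<Phi> \<in> borel_measurable (borel \<Otimes>\<^sub>M borel) \<and>
    (\<forall>x t. \<bar>\<Phi> x t\<bar> \<le> L) \<and> (\<exists>e. \<forall>x t. \<Phi> x t \<noteq> 0 \<longrightarrow> x \<in> ball x0 R \<and> t \<in> {e..b}) \<and>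
    gagliardo_energy W p \<Phi> < \<infinity>"

lemma admissible_integrable:
  assumes "admissible \<Phi>"
  shows "integrable lborel (\<lambda>z. \<Phi> (fst z) (snd z))" and "integrable lborel (energy_form \<Phi>)"
proof -
  have \<Phi>: "case_prod \<Phi> \<in> borel_measurable (borel \<Otimes>\<^sub>M borel)" and E: "gagliardo_energy W p \<Phi> < \<infinity>"
    using assms by (auto simp: admissible_def)
  obtain e where supp: "\<And>x t. \<Phi> x t \<noteq> 0 \<Longrightarrow> x \<in> ball x0 R \<and> t \<in> {e..b}" using assms by (auto simp: admissible_def)
  show i: "integrable lborel (\<lambda>z. \<Phi> (fst z) (snd z))"
    using assms supp by (intro integrable_bounded_cylinder[where B = L and \<alpha> = e and \<omega> = b and R = R and ?x0.0 = x0]) (auto simp: admissible_def)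
  note [measurable] = energy_form_meas[OF \<Phi>] near_energy_meas[OF \<Phi>]
  define \<delta> where "\<delta> = r - R"
  have d: "0 < \<delta>" using R by (simp add: \<delta>_def)
  have z: "energy_form (\<lambda>_ _. 0) = (\<lambda>_. 0)" by (auto simp: energy_form_def)
  have "(\<integral>\<^sup>+w. ennreal (norm (energy_form \<Phi> w)) \<partial>lborel) = (\<integral>\<^sup>+w. ennreal \<bar>energy_form \<Phi> w\<bar> * indicator (- far \<delta>) w \<partial>lborel)
      + (\<integral>\<^sup>+w. ennreal \<bar>energy_form \<Phi> w\<bar> * indicator (far \<delta>) w \<partial>lborel)"
    by (subst nn_integral_add[symmetric]) (auto intro!: nn_integral_cong simp: indicator_def)
  also have "\<dots> < \<infinity>"
  proof -
    have "(\<integral>\<^sup>+w. ennreal \<bar>energy_form \<Phi> w\<bar> * indicator (- far \<delta>) w \<partial>lborel) \<le> (\<integral>\<^sup>+w. ennreal \<Lambda> * near_energy \<Phi> w \<partial>lborel)"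
    proof (intro nn_integral_mono)
      fix w
      have "ennreal \<bar>energy_form \<Phi> w\<bar> * indicator (- far \<delta>) w \<le> ennreal \<Lambda> * (near_energy \<Phi> w * indicator (- far \<delta>) w)"
        using supp by (intro near_bound) (auto simp: \<delta>_def)
      also have "\<dots> \<le> ennreal \<Lambda> * near_energy \<Phi> w" by (intro mult_left_mono) (auto simp: indicator_def)
      finally show "ennreal \<bar>energy_form \<Phi> w\<bar> * indicator (- far \<delta>) w \<le> ennreal \<Lambda> * near_energy \<Phi> w" .
    qed
    also have "\<dots> = ennreal \<Lambda> * (\<integral>\<^sup>+w. near_energy \<Phi> w \<partial>lborel)" by (rule nn_integral_cmult) measurable
    also have "\<dots> < \<infinity>" using near_energy_integral[OF \<Phi> E] by (auto simp: ennreal_mult_less_top)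
    finally have 1: "(\<integral>\<^sup>+w. ennreal \<bar>energy_form \<Phi> w\<bar> * indicator (- far \<delta>) w \<partial>lborel) < \<infinity>" .
    have "(\<integral>\<^sup>+z. ennreal \<bar>\<Phi> (fst z) (snd z)\<bar> \<partial>lborel) < \<infinity>" using i by (simp add: integrable_iff_bounded)
    then have "(\<integral>\<^sup>+w. ennreal \<bar>energy_form \<Phi> w\<bar> * indicator (far \<delta>) w \<partial>lborel) < \<infinity>"
      using far_integral[OF d \<Phi>, of "\<lambda>_ _. 0"] unfolding z
      by (auto intro: order.strict_trans1 simp: ennreal_mult_less_top)
    then show ?thesis using 1 by simp
  qed
  finally show "integrable lborel (energy_form \<Phi>)" by (simp add: integrable_iff_bounded)
qed

lemma G_admissible: "admissible G"
  unfolding admissible_def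
proof (intro conjI allI exI[of _ Ta] impI G_meas G_energy_finite)
  show "\<bar>G x t\<bar> \<le> L" for x t using G_bounds[of x t] by simp
  show "x \<in> ball x0 R" if "G x t \<noteq> 0" for x t using G_support[OF that] by simp
  show "t \<in> {Ta..b}" if "G x t \<noteq> 0" for x t using G_support[OF that] T by simp
qed

lemma G_section: "G x \<in> borel_measurable borel"
  using measurable_compose2[OF G_meas, of "\<lambda>_. x" borel "\<lambda>t. t"] by simp

lemma G_abs: "\<bar>G x t\<bar> \<le> L" using G_bounds[of x t] by simp

lemma steklov_support:
  assumes "steklov_average h (G x) t \<noteq> 0"
  shows "x \<in> ball x0 R \<and> t \<in> {Ta - h..T0}"
proof -
  have "\<exists>\<sigma>. 0 \<le> \<sigma> \<and> \<sigma> \<le> h \<and> G x (t + \<sigma>) \<noteq> 0"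
  proof (rule ccontr)
    assume "\<not> ?thesis"
    then have "steklov_average h (G x) t = 0" by (intro steklov_average_eq_0) blast
    with assms show False by simp
  qed
  then obtain \<sigma> where \<sigma>: "0 \<le> \<sigma>" "\<sigma> \<le> h" "G x (t + \<sigma>) \<noteq> 0" by blast
  from G_support[OF this(3)] have "x \<in> ball x0 R" "Ta \<le> t + \<sigma>" "t + \<sigma> \<le> T0" by auto
  then show ?thesis using \<sigma> by simp
qed

lemma steklov_admissible: "0 < h \<Longrightarrow> admissible (\<lambda>x. steklov_average h (G x))"
  unfolding admissible_def
proof (intro conjI allI exI[of _ "Ta - h"] impI)
  assume h: "0 < h"
  show "case_prod (\<lambda>x. steklov_average h (G x)) \<in> borel_measurable (borel \<Otimes>\<^sub>M borel)"
    using measurable_steklov_average[OF G_meas, of h] by simp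
  show "\<bar>steklov_average h (G x) t\<bar> \<le> L" for x t by (rule steklov_average_abs_le[OF G_section G_abs h])
  show "x \<in> ball x0 R" if "steklov_average h (G x) t \<noteq> 0" for x t using steklov_support[OF that] by simp
  show "t \<in> {Ta - h..b}" if "steklov_average h (G x) t \<noteq> 0" for x t using steklov_support[OF that] T by auto
  show "gagliardo_energy W p (\<lambda>x. steklov_average h (G x)) < \<infinity>"
    using gagliardo_energy_steklov_le[OF G_meas G_abs measurable_gagliardo_weight _ h, of p s p] G_energy_finite p
    by (auto intro: order.strict_trans1)
qed

text \<open>The part of \<open>near_energy\<close> that comes from U is the same on both sides. In
  the other part the restriction to |x - y| < \<delta> is moved into the weight \<open>Wn\<close>,
  so that \<open>gagliardo_energy_steklov_le\<close> applies.\<close>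

lemma near_energy_steklov_le:
  assumes h: "0 < h"
  shows "(\<integral>\<^sup>+w. near_energy (\<lambda>x. steklov_average h (G x)) w * indicator (- far \<delta>) w \<partial>lborel)
    \<le> (\<integral>\<^sup>+w. near_energy G w * indicator (- far \<delta>) w \<partial>lborel)"
proof -
  define Wn where "Wn x y = W x y * (if norm (x - y) < \<delta> then 1 else 0)" for x y
  have Wn: "case_prod Wn \<in> borel_measurable (borel \<Otimes>\<^sub>M borel)" unfolding Wn_def by measurable
  have Wn0: "0 \<le> Wn x y" for x y by (simp add: Wn_def)
  have split: "(\<integral>\<^sup>+w. near_energy \<Phi> w * indicator (- far \<delta>) w \<partial>lborel)
      = (\<integral>\<^sup>+w. (case w of (x, y, t) \<Rightarrow> ennreal (\<bar>U x t - U y t\<bar> powr p * W x y) *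
        indicator (ball x0 r \<times> ball x0 r \<times> {t1..t2}) (x, y, t)) * indicator (- far \<delta>) w \<partial>lborel) + gagliardo_energy Wn p \<Phi>"
    if \<Phi>: "case_prod \<Phi> \<in> borel_measurable (borel \<Otimes>\<^sub>M borel)" for \<Phi>
  proof -
    have "near_energy \<Phi> w * indicator (- far \<delta>) w = (case w of (x, y, t) \<Rightarrow> ennreal (\<bar>U x t - U y t\<bar> powr p * W x y) *
        indicator (ball x0 r \<times> ball x0 r \<times> {t1..t2}) (x, y, t)) * indicator (- far \<delta>) w
        + (case w of (x, y, t) \<Rightarrow> ennreal (\<bar>\<Phi> x t - \<Phi> y t\<bar> powr p * Wn x y))" for w
      by (cases w) (auto simp: near_energy_def Wn_def far_def indicator_def)
    then show ?thesis
      unfolding gagliardo_energy_def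
      using U_energy_meas measurable_gagliardo_integrand[OF \<Phi> Wn, of p]
      by (simp add: nn_integral_add borel_prod)
  qed
  show ?thesis
    unfolding split[OF measurable_steklov_average[OF G_meas, of h, folded case_prod_eta]] split[OF G_meas]
    using gagliardo_energy_steklov_le[OF G_meas G_abs Wn Wn0 h, of p] p by (intro add_left_mono) auto
qed

text \<open>The kernel is not integrable at the diagonal. Near it, Jensen's inequality bounds the energy of
  the averages by that of \<open>G\<close>, uniformly in \<open>h\<close>; away from it, \<open>L\<^sup>1\<close> convergence of the averages suffices.\<close>

lemma energy_form_steklov_L1:
  "((\<lambda>h. \<integral>\<^sup>+w. ennreal \<bar>energy_form (\<lambda>x. steklov_average h (G x)) w - energy_form G w\<bar> \<partial>lborel) \<longlongrightarrow> 0) (at_right 0)"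
proof (rule tendsto_zero_ennreal)
  fix e :: real assume e: "0 < e"
  note [measurable] = near_energy_meas[OF G_meas] energy_form_meas[OF G_meas]
  have "(\<lambda>n. \<integral>\<^sup>+w. near_energy G w * indicator {w. norm (fst w - fst (snd w)) < inverse (real (Suc n))} w \<partial>lborel) \<longlonglongrightarrow> 0"
  proof (rule nn_integral_near_diagonal_tendsto_0)
    show "near_energy G \<in> borel_measurable borel" by measurable
    show "(\<integral>\<^sup>+w. near_energy G w \<partial>lborel) < \<infinity>" by (rule near_energy_integral[OF G_meas G_energy_finite])
    show "near_energy G (x, x, t) = 0" for x :: 'a and t by (simp add: near_energy_def)
  qed
  then have "(\<lambda>n. ennreal (2 * \<Lambda>) * (\<integral>\<^sup>+w. near_energy G w * indicator {w. norm (fst w - fst (snd w)) < inverse (real (Suc n))} w \<partial>lborel)) \<longlonglongrightarrow> ennreal (2 * \<Lambda>) * 0"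
    by (intro ennreal_tendsto_cmult) auto
  then have "\<forall>\<^sub>F n in sequentially. ennreal (2 * \<Lambda>) * (\<integral>\<^sup>+w. near_energy G w * indicator {w. norm (fst w - fst (snd w)) < inverse (real (Suc n))} w \<partial>lborel) < ennreal (e / 2)"
    using order_tendstoD(2)[of _ "0::ennreal" sequentially "ennreal (e / 2)"] e by simp
  moreover have "\<forall>\<^sub>F n in sequentially. inverse (real (Suc n)) < r - R"
    using order_tendstoD(2)[OF LIMSEQ_inverse_real_of_nat, of "r - R"] R by simp
  ultimately have "\<forall>\<^sub>F n in sequentially. ennreal (2 * \<Lambda>) * (\<integral>\<^sup>+w. near_energy G w * indicator {w. norm (fst w - fst (snd w)) < inverse (real (Suc n))} w \<partial>lborel) < ennreal (e / 2) \<and> inverse (real (Suc n)) < r - R"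
    by eventually_elim simp
  then obtain n where n: "ennreal (2 * \<Lambda>) * (\<integral>\<^sup>+w. near_energy G w * indicator {w. norm (fst w - fst (snd w)) < inverse (real (Suc n))} w \<partial>lborel) < ennreal (e / 2)"
      "inverse (real (Suc n)) < r - R"
    using eventually_happens'[OF sequentially_bot] by blast
  \<comment> \<open>The width \<delta> is fixed here, before h tends to 0. The constant
    \<open>C\<close> below blows up as \<delta> shrinks, but it multiplies a quantity that vanishes
    with h.\<close>
  define \<delta> where "\<delta> = inverse (real (Suc n))"
  have d: "0 < \<delta>" "\<delta> \<le> r - R" using n(2) by (auto simp: \<delta>_def)
  have ff: "{w :: 'a \<times> 'a \<times> real. norm (fst w - fst (snd w)) < \<delta>} = - far \<delta>" by (auto simp: far_def)
  define N where "N = (\<integral>\<^sup>+w. near_energy G w * indicator (- far \<delta>) w \<partial>lborel)"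
  have N: "ennreal (2 * \<Lambda>) * N < ennreal (e / 2)" using n(1) unfolding \<delta>_def[symmetric] ff N_def .
  define C where "C = \<Lambda> * (2 * M) powr (p - 1) * (2 * (CK * \<delta> powr (- (p * s))))"
  have "((\<lambda>h. ennreal C * (\<integral>\<^sup>+z. ennreal \<bar>steklov_average h (G (fst z)) (snd z) - G (fst z) (snd z)\<bar> \<partial>lborel)) \<longlongrightarrow> ennreal C * 0) (at_right 0)"
  proof (intro ennreal_tendsto_cmult steklov_average_converges_L1[OF G_meas G_abs, of "norm x0 + R + \<bar>Ta\<bar> + \<bar>T0\<bar>"])
    fix x :: 'a and t :: real assume big: "norm x0 + R + \<bar>Ta\<bar> + \<bar>T0\<bar> < norm (x, t)"
    show "G x t = 0"
    proof (rule ccontr)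
      assume "G x t \<noteq> 0"
      then have "dist x0 x < R" "Ta \<le> t" "t \<le> T0" using G_support[of x t] by auto
      moreover have "norm x \<le> norm x0 + dist x0 x" using norm_triangle_sub[of x x0] by (simp add: dist_norm norm_minus_commute)
      moreover have "norm (x, t) \<le> norm x + \<bar>t\<bar>" using norm_Pair_le[of x t] by simp
      ultimately show False using big by linarith
    qed
  qed auto
  then have "\<forall>\<^sub>F h in at_right 0. ennreal C * (\<integral>\<^sup>+z. ennreal \<bar>steklov_average h (G (fst z)) (snd z) - G (fst z) (snd z)\<bar> \<partial>lborel) < ennreal (e / 2)"
    using order_tendstoD(2)[of _ "0::ennreal" "at_right 0" "ennreal (e / 2)"] e by simp
  moreover have "\<forall>\<^sub>F h in at_right 0. 0 < (h::real)" by (simp add: eventually_at_right_less)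
  ultimately show "\<forall>\<^sub>F h in at_right 0. (\<integral>\<^sup>+w. ennreal \<bar>energy_form (\<lambda>x. steklov_average h (G x)) w - energy_form G w\<bar> \<partial>lborel) < ennreal e"
  proof eventually_elim
    case (elim h)
    let ?P = "\<lambda>x. steklov_average h (G x)"
    have Pm: "case_prod ?P \<in> borel_measurable (borel \<Otimes>\<^sub>M borel)" using measurable_steklov_average[OF G_meas, of h] by simp
    note [measurable] = energy_form_meas[OF Pm] near_energy_meas[OF Pm]
    have "(\<integral>\<^sup>+w. ennreal \<bar>energy_form ?P w - energy_form G w\<bar> \<partial>lborel)
        \<le> (\<integral>\<^sup>+w. (ennreal \<bar>energy_form ?P w\<bar> * indicator (- far \<delta>) w + ennreal \<bar>energy_form G w\<bar> * indicator (- far \<delta>) w)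
            + ennreal \<bar>energy_form ?P w - energy_form G w\<bar> * indicator (far \<delta>) w \<partial>lborel)"
    proof (intro nn_integral_mono)
      fix w
      have "ennreal \<bar>energy_form ?P w - energy_form G w\<bar> \<le> ennreal (\<bar>energy_form ?P w\<bar> + \<bar>energy_form G w\<bar>)"
        by (intro ennreal_leI) linarith
      then show "ennreal \<bar>energy_form ?P w - energy_form G w\<bar> \<le> (ennreal \<bar>energy_form ?P w\<bar> * indicator (- far \<delta>) w + ennreal \<bar>energy_form G w\<bar> * indicator (- far \<delta>) w)
            + ennreal \<bar>energy_form ?P w - energy_form G w\<bar> * indicator (far \<delta>) w"
        by (auto simp: indicator_def)
    qed
    also have "\<dots> = ((\<integral>\<^sup>+w. ennreal \<bar>energy_form ?P w\<bar> * indicator (- far \<delta>) w \<partial>lborel) + (\<integral>\<^sup>+w. ennreal \<bar>energy_form G w\<bar> * indicator (- far \<delta>) w \<partial>lborel))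
        + (\<integral>\<^sup>+w. ennreal \<bar>energy_form ?P w - energy_form G w\<bar> * indicator (far \<delta>) w \<partial>lborel)"
      by (subst nn_integral_add, measurable, subst nn_integral_add, measurable)
    also have "\<dots> \<le> (ennreal \<Lambda> * N + ennreal \<Lambda> * N) + ennreal C * (\<integral>\<^sup>+z. ennreal \<bar>?P (fst z) (snd z) - G (fst z) (snd z)\<bar> \<partial>lborel)"
    proof (intro add_mono)
      have "(\<integral>\<^sup>+w. ennreal \<bar>energy_form ?P w\<bar> * indicator (- far \<delta>) w \<partial>lborel) \<le> (\<integral>\<^sup>+w. ennreal \<Lambda> * (near_energy ?P w * indicator (- far \<delta>) w) \<partial>lborel)"
        using steklov_support by (intro nn_integral_mono near_bound d) blast
      also have "\<dots> = ennreal \<Lambda> * (\<integral>\<^sup>+w. near_energy ?P w * indicator (- far \<delta>) w \<partial>lborel)" by (rule nn_integral_cmult) measurable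
      also have "\<dots> \<le> ennreal \<Lambda> * N" unfolding N_def using elim by (intro mult_left_mono near_energy_steklov_le) auto
      finally show "(\<integral>\<^sup>+w. ennreal \<bar>energy_form ?P w\<bar> * indicator (- far \<delta>) w \<partial>lborel) \<le> ennreal \<Lambda> * N" .
      have "(\<integral>\<^sup>+w. ennreal \<bar>energy_form G w\<bar> * indicator (- far \<delta>) w \<partial>lborel) \<le> (\<integral>\<^sup>+w. ennreal \<Lambda> * (near_energy G w * indicator (- far \<delta>) w) \<partial>lborel)"
        using G_support by (intro nn_integral_mono near_bound d) blast
      also have "\<dots> = ennreal \<Lambda> * N" unfolding N_def by (rule nn_integral_cmult) measurable
      finally show "(\<integral>\<^sup>+w. ennreal \<bar>energy_form G w\<bar> * indicator (- far \<delta>) w \<partial>lborel) \<le> ennreal \<Lambda> * N" .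
      have "ennreal C = ennreal (\<Lambda> * (2 * M) powr (p - 1)) * (2 * ennreal (CK * \<delta> powr (- (p * s))))"
        unfolding C_def using CK(1) Lam by (subst ennreal_mult') (auto simp: ennreal_mult')
      then show "(\<integral>\<^sup>+w. ennreal \<bar>energy_form ?P w - energy_form G w\<bar> * indicator (far \<delta>) w \<partial>lborel)
          \<le> ennreal C * (\<integral>\<^sup>+z. ennreal \<bar>?P (fst z) (snd z) - G (fst z) (snd z)\<bar> \<partial>lborel)"
        using far_integral[OF d(1) Pm G_meas] by (simp add: mult.assoc)
    qed
    also have "ennreal \<Lambda> * N + ennreal \<Lambda> * N = ennreal (2 * \<Lambda>) * N"
      using Lam by (subst ennreal_mult') (auto simp: mult_2[symmetric] mult.assoc)
    also have "ennreal (2 * \<Lambda>) * N + ennreal C * (\<integral>\<^sup>+z. ennreal \<bar>?P (fst z) (snd z) - G (fst z) (snd z)\<bar> \<partial>lborel) < ennreal (e / 2) + ennreal (e / 2)"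
      using N elim by (intro add_strict_mono) auto
    also have "\<dots> = ennreal e" using e by (simp add: ennreal_plus[symmetric] del: ennreal_plus)
    finally show ?case .
  qed
qed

lemma energy_form_steklov_tendsto:
  "((\<lambda>h. \<integral>w. energy_form (\<lambda>x. steklov_average h (G x)) w \<partial>lborel) \<longlongrightarrow> (\<integral>w. energy_form G w \<partial>lborel)) (at_right 0)"
proof -
  \<comment> \<open>Integrability of the averaged form is available for h > 0, while the convergence
    theorem asks for it at every h; the limit itself fills in for h \<le> 0.\<close>
  let ?u = "\<lambda>h. if 0 < h then energy_form (\<lambda>x. steklov_average h (G x)) else energy_form G"
  have ev: "\<forall>\<^sub>F h in at_right 0. 0 < (h::real)" by (simp add: eventually_at_right_less)
  have "((\<lambda>h. \<integral>w. ?u h w \<partial>lborel) \<longlongrightarrow> (\<integral>w. energy_form G w \<partial>lborel)) (at_right 0)"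
  proof (rule tendsto_L1_int)
    show "integrable lborel (?u h)" for h
      using admissible_integrable(2)[OF steklov_admissible] admissible_integrable(2)[OF G_admissible] by simp
    show "integrable lborel (energy_form G)" by (rule admissible_integrable(2)[OF G_admissible])
    show "((\<lambda>h. \<integral>\<^sup>+w. ennreal (norm (?u h w - energy_form G w)) \<partial>lborel) \<longlongrightarrow> 0) (at_right 0)"
      by (rule Lim_transform_eventually[OF energy_form_steklov_L1]) (use ev in \<open>eventually_elim, simp\<close>)
  qed
  then show ?thesis
    by (rule Lim_transform_eventually) (use ev in \<open>eventually_elim, simp\<close>)
qed

end

section \<open>The time term, estimated through the truncation energy\<close>

context truncated_test
begin

definition H :: "'a \<Rightarrow> real \<Rightarrow> real" where "H x t = truncation_energy q k (U x t)"

definition Z :: "'a \<Rightarrow> real" where "Z x = cutoff x powr p"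

text \<open>Where U < k, the numbers U and k both lie in [\<mu>, \<mu> + L], so
  \<open>truncation_energy_le\<close> applies with |\<mu>| + L as its bound.\<close>

definition CH :: real where "CH = 4 * (\<bar>\<mu>\<bar> + L) * (\<bar>\<mu>\<bar> + L) powr q"

lemma H_bounds: "0 \<le> H x t" "H x t \<le> CH" "\<not> U x t < k \<Longrightarrow> H x t = 0"
proof -
  show "0 \<le> H x t" unfolding H_def by (rule truncation_energy_nonneg[OF q])
  show z: "H x t = 0" if "\<not> U x t < k" using that by (simp add: H_def truncation_energy_def)
  have "0 \<le> CH" using L by (simp add: CH_def)
  moreover have "H x t \<le> CH" if "U x t < k"
    unfolding H_def CH_def using that U_lower[of x t] k L by (intro truncation_energy_le q) auto
  ultimately show "H x t \<le> CH" using z by (cases "U x t < k") auto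
qed

lemma CH_nonneg: "0 \<le> CH" using L by (simp add: CH_def)

lemma Z_bounds: "0 \<le> Z x" "Z x \<le> 1" "x \<notin> ball x0 R \<Longrightarrow> Z x = 0"
  using cutoff[of x] p powr_mono2[of p "cutoff x" 1] cutoff_eq_0[of x] by (auto simp: Z_def)

lemma H_meas: "case_prod H \<in> borel_measurable (borel \<Otimes>\<^sub>M borel)"
  unfolding H_def truncation_energy_def power_primitive_def by measurable

lemmas H_comp[measurable] = measurable_compose2[OF H_meas]

lemma Z_meas[measurable]: "Z \<in> borel_measurable borel" unfolding Z_def by measurable

lemma ZH_bounds: "0 \<le> Z x * H x t" "Z x * H x t \<le> CH"
proof -
  show "0 \<le> Z x * H x t" by (intro mult_nonneg_nonneg Z_bounds H_bounds)
  have "Z x * H x t \<le> 1 * CH" by (intro mult_mono Z_bounds H_bounds) auto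
  then show "Z x * H x t \<le> CH" by simp
qed

lemma shift_time:
  fixes f :: "'a \<Rightarrow> real \<Rightarrow> real"
  assumes f: "case_prod f \<in> borel_measurable (borel \<Otimes>\<^sub>M borel)"
  shows "(\<integral>z. f (fst z) (snd z + h) \<partial>lborel) = (\<integral>z. f (fst z) (snd z) \<partial>lborel)"
proof -
  have "(\<lambda>z. f (fst z) (snd z)) \<in> borel_measurable borel" using f by (simp add: borel_prod case_prod_beta')
  from integral_lborel_shift[OF this, of "(0, h)"] show ?thesis by simp
qed

lemma ZH_integrable:
  assumes [measurable]: "g \<in> borel_measurable borel" and B: "\<And>t. \<bar>g t\<bar> \<le> B" and supp: "\<And>t. g t \<noteq> 0 \<Longrightarrow> t \<in> {\<alpha>..\<omega>}"
  shows "integrable lborel (\<lambda>z. Z (fst z) * H (fst z) (snd z) * g (snd z))"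
proof (rule integrable_bounded_cylinder[where f = "\<lambda>x t. Z x * H x t * g t" and B = "CH * B" and R = R and ?x0.0 = x0 and \<alpha> = \<alpha> and \<omega> = \<omega>])
  show "(\<lambda>(x, t). Z x * H x t * g t) \<in> borel_measurable (borel \<Otimes>\<^sub>M borel)" by measurable
  fix x t
  show "\<bar>Z x * H x t * g t\<bar> \<le> CH * B"
    using ZH_bounds[of x t] CH_nonneg B[of t] unfolding abs_mult[of "Z x * H x t"] by (intro mult_mono) auto
  show "Z x * H x t * g t \<noteq> 0 \<Longrightarrow> x \<in> ball x0 R \<and> t \<in> {\<alpha>..\<omega>}"
    using Z_bounds(3)[of x] supp[of t] by (metis mult_zero_left mult_zero_right)
qed

lemma ZH_shifted_integrable:
  assumes [measurable]: "g \<in> borel_measurable borel" and B: "\<And>t. \<bar>g t\<bar> \<le> B" and supp: "\<And>t. g t \<noteq> 0 \<Longrightarrow> t \<in> {\<alpha>..\<omega>}"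
  shows "integrable lborel (\<lambda>z. Z (fst z) * H (fst z) (snd z - h) * g (snd z))"
proof (rule integrable_bounded_cylinder[where f = "\<lambda>x t. Z x * H x (t - h) * g t" and B = "CH * B" and R = R and ?x0.0 = x0 and \<alpha> = \<alpha> and \<omega> = \<omega>])
  show "(\<lambda>(x, t). Z x * H x (t - h) * g t) \<in> borel_measurable (borel \<Otimes>\<^sub>M borel)" by measurable
  fix x t
  show "\<bar>Z x * H x (t - h) * g t\<bar> \<le> CH * B"
    using ZH_bounds[of x "t - h"] CH_nonneg B[of t] unfolding abs_mult[of "Z x * H x (t - h)"] by (intro mult_mono) auto
  show "Z x * H x (t - h) * g t \<noteq> 0 \<Longrightarrow> x \<in> ball x0 R \<and> t \<in> {\<alpha>..\<omega>}"
    using Z_bounds(3)[of x] supp[of t] by (metis mult_zero_left mult_zero_right)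
qed

lemma vG_integrable:
  shows "integrable lborel (\<lambda>z. signed_power q (U (fst z) (snd z - e)) * G (fst z) (snd z + e'))"
proof (rule integrable_bounded_cylinder[where f = "\<lambda>x t. signed_power q (U x (t - e)) * G x (t + e')" and B = "M powr q * L" and R = R and ?x0.0 = x0 and \<alpha> = "Ta - e'" and \<omega> = "T0 - e'"])
  show "(\<lambda>(x, t). signed_power q (U x (t - e)) * G x (t + e')) \<in> borel_measurable (borel \<Otimes>\<^sub>M borel)" by measurable
  fix x t
  have "\<bar>signed_power q (U x (t - e))\<bar> \<le> M powr q"
    using U_abs[of x "t - e"] q by (auto simp: abs_signed_power intro!: powr_mono2)
  then show "\<bar>signed_power q (U x (t - e)) * G x (t + e')\<bar> \<le> M powr q * L"
    unfolding abs_mult using G_abs[of x "t + e'"] by (intro mult_mono) auto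
  show "signed_power q (U x (t - e)) * G x (t + e') \<noteq> 0 \<Longrightarrow> x \<in> ball x0 R \<and> t \<in> {Ta - e'..T0 - e'}"
    using G_support[of x "t + e'"] by auto
qed

definition J :: real where "J = (\<integral>z. Z (fst z) * H (fst z) (snd z) * indicat_real {c..d} (snd z) \<partial>lborel)"

lemma J_nonneg: "0 \<le> J"
  unfolding J_def by (intro integral_nonneg_AE AE_I2 mult_nonneg_nonneg Z_bounds H_bounds) auto

text \<open>The window of growth reaches back to Ta - h, before the time range of S. The surplus has
  measure at most h times that of the ball and disappears as h tends to 0.\<close>

lemma early_time_integral:
  assumes h: "0 < h"
  shows "(\<integral>z. Z (fst z) * H (fst z) (snd z) * indicat_real {Ta - h..Tb} (snd z) \<partial>lborel)
    \<le> CH * (measure lborel S + measure lborel (ball x0 R) * h)"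
proof -
  let ?B = "ball x0 R \<times> {Ta - h..Ta}"
  have Sl: "S \<in> sets lborel" using S_meas by (metis borel_prod sets_lborel)
  have Bl: "?B \<in> sets lborel" by (simp add: borel_prod[symmetric])
  have eB: "emeasure lborel ?B = ennreal (measure lborel (ball x0 R) * h)"
  proof -
    have "emeasure lborel ?B = emeasure lborel (ball x0 R) * emeasure lborel {Ta - h..Ta}"
      unfolding lborel_prod[symmetric] by (subst lborel.emeasure_pair_measure_Times) auto
    also have "emeasure lborel (ball x0 R) = ennreal (measure lborel (ball x0 R))"
      using emeasure_lborel_ball_finite[of x0 R] by (intro emeasure_eq_ennreal_measure) auto
    finally show ?thesis using h by (simp add: ennreal_mult')
  qed
  have iS: "integrable lborel (\<lambda>z. CH * indicat_real S z)" "integrable lborel (\<lambda>z. CH * indicat_real ?B z)"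
    using Sl Bl S_finite eB by (auto intro!: integrable_mult_right integrable_real_indicator)
  have "(\<integral>z. Z (fst z) * H (fst z) (snd z) * indicat_real {Ta - h..Tb} (snd z) \<partial>lborel)
      \<le> (\<integral>z. CH * indicat_real S z + CH * indicat_real ?B z \<partial>lborel)"
  proof (rule integral_mono)
    show "integrable lborel (\<lambda>z. Z (fst z) * H (fst z) (snd z) * indicat_real {Ta - h..Tb} (snd z))"
      by (rule ZH_integrable[where B = 1 and \<alpha> = "Ta - h" and \<omega> = Tb]) (auto simp: indicator_def split: if_splits)
    show "integrable lborel (\<lambda>z. CH * indicat_real S z + CH * indicat_real ?B z)" using iS by simp
    fix z :: "'a \<times> real"
    obtain x t where z: "z = (x, t)" by (cases z)
    show "Z (fst z) * H (fst z) (snd z) * indicat_real {Ta - h..Tb} (snd z) \<le> CH * indicat_real S z + CH * indicat_real ?B z"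
    proof (cases "t \<in> {Ta - h..Tb} \<and> x \<in> ball x0 R \<and> U x t < k")
      case True
      then have "z \<in> S \<or> z \<in> ?B" using T by (auto simp: S_def z)
      then show ?thesis using ZH_bounds[of x t] CH_nonneg True by (auto simp: z indicator_def)
    next
      case False
      then have "Z x * H x t * indicat_real {Ta - h..Tb} t = 0" using Z_bounds(3)[of x] H_bounds(3)[of x t] by auto
      moreover have "0 \<le> CH * indicat_real S z + CH * indicat_real ?B z"
        using CH_nonneg by (intro add_nonneg_nonneg mult_nonneg_nonneg) auto
      ultimately show ?thesis unfolding z fst_conv snd_conv by linarith
    qed
  qed
  also have "\<dots> = CH * measure lborel S + CH * measure lborel ?B"
    using iS Sl Bl by (simp add: Bochner_Integration.integral_add)
  also have "measure lborel ?B = measure lborel (ball x0 R) * h"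
    using eB h by (simp add: measure_def)
  finally show ?thesis by (simp add: algebra_simps)
qed

text \<open>Two shifts in time. The first moves the difference quotient from G to
  \<open>signed_power q (U x t)\<close>, where \<open>truncation_energy_chain\<close> applies with
  the value at t as the later one and turns it into a difference of H. The second moves that
  difference from H to \<eta>, where \<open>chi_incr\<close> bounds it.\<close>

lemma time_term_le:
  assumes h: "0 < h" "h < h0"
  shows "- (\<integral>z. signed_power q (U (fst z) (snd z)) * ((G (fst z) (snd z + h) - G (fst z) (snd z)) / h) \<partial>lborel)
    \<le> \<beta> * CH * (measure lborel S + measure lborel (ball x0 R) * h) - \<gamma> * J"
proof -
  let ?v = "\<lambda>x t. signed_power q (U x t)"
  have i1: "integrable lborel (\<lambda>z. ?v (fst z) (snd z) * G (fst z) (snd z + h))" using vG_integrable[of 0 h] by simp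
  have i2: "integrable lborel (\<lambda>z. ?v (fst z) (snd z) * G (fst z) (snd z))" using vG_integrable[of 0 0] by simp
  have i3: "integrable lborel (\<lambda>z. ?v (fst z) (snd z - h) * G (fst z) (snd z))" using vG_integrable[of h 0] by simp
  have "(\<integral>z. ?v (fst z) (snd z) * ((G (fst z) (snd z + h) - G (fst z) (snd z)) / h) \<partial>lborel)
      = (\<integral>z. (?v (fst z) (snd z) * G (fst z) (snd z + h) - ?v (fst z) (snd z) * G (fst z) (snd z)) / h \<partial>lborel)"
    by (intro Bochner_Integration.integral_cong refl) (simp add: field_simps)
  also have "\<dots> = ((\<integral>z. ?v (fst z) (snd z) * G (fst z) (snd z + h) \<partial>lborel) - (\<integral>z. ?v (fst z) (snd z) * G (fst z) (snd z) \<partial>lborel)) / h"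
    using i1 i2 by simp
  also have "(\<integral>z. ?v (fst z) (snd z) * G (fst z) (snd z + h) \<partial>lborel) = (\<integral>z. ?v (fst z) (snd z - h) * G (fst z) (snd z) \<partial>lborel)"
    using shift_time[of "\<lambda>x t. ?v x (t - h) * G x t" h] by simp
  finally have "- (\<integral>z. ?v (fst z) (snd z) * ((G (fst z) (snd z + h) - G (fst z) (snd z)) / h) \<partial>lborel)
      = (\<integral>z. (?v (fst z) (snd z) - ?v (fst z) (snd z - h)) * G (fst z) (snd z) \<partial>lborel) / h"
    using i2 i3 by (simp add: left_diff_distrib diff_divide_distrib)
  also have "\<dots> \<le> (h * (\<beta> * (\<integral>z. Z (fst z) * H (fst z) (snd z) * indicat_real {Ta - h..Tb} (snd z) \<partial>lborel) - \<gamma> * J)) / h"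
  proof (rule divide_right_mono)
    have j1: "integrable lborel (\<lambda>z. Z (fst z) * H (fst z) (snd z - h) * \<eta> (snd z))"
      by (rule ZH_shifted_integrable[where B = 1 and \<alpha> = Ta and \<omega> = T0]) (use chi in auto)
    have j2: "integrable lborel (\<lambda>z. Z (fst z) * H (fst z) (snd z) * \<eta> (snd z))"
      by (rule ZH_integrable[where B = 1 and \<alpha> = Ta and \<omega> = T0]) (use chi in auto)
    have j3: "integrable lborel (\<lambda>z. Z (fst z) * H (fst z) (snd z) * \<eta> (snd z + h))"
      by (rule ZH_integrable[where g = "\<lambda>t. \<eta> (t + h)" and B = 1 and \<alpha> = "Ta - h" and \<omega> = "T0 - h"]) (use chi(1,2) chi(3)[of "_ + h"] in \<open>auto simp: algebra_simps\<close>)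
    have j4: "integrable lborel (\<lambda>z. Z (fst z) * H (fst z) (snd z) * indicat_real {Ta - h..Tb} (snd z))"
      by (rule ZH_integrable[where B = 1 and \<alpha> = "Ta - h" and \<omega> = Tb]) (auto simp: indicator_def split: if_splits)
    have j5: "integrable lborel (\<lambda>z. Z (fst z) * H (fst z) (snd z) * indicat_real {c..d} (snd z))"
      by (rule ZH_integrable[where B = 1 and \<alpha> = c and \<omega> = d]) (auto simp: indicator_def split: if_splits)
    have "(\<integral>z. (?v (fst z) (snd z) - ?v (fst z) (snd z - h)) * G (fst z) (snd z) \<partial>lborel)
        \<le> (\<integral>z. Z (fst z) * H (fst z) (snd z - h) * \<eta> (snd z) - Z (fst z) * H (fst z) (snd z) * \<eta> (snd z) \<partial>lborel)"
    proof (rule integral_mono)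
      show "integrable lborel (\<lambda>z. (?v (fst z) (snd z) - ?v (fst z) (snd z - h)) * G (fst z) (snd z))"
        using i2 i3 by (simp add: left_diff_distrib)
      show "integrable lborel (\<lambda>z. Z (fst z) * H (fst z) (snd z - h) * \<eta> (snd z) - Z (fst z) * H (fst z) (snd z) * \<eta> (snd z))"
        using j1 j2 by simp
      fix z :: "'a \<times> real"
      let ?x = "fst z" and ?t = "snd z"
      have "(\<eta> ?t * Z ?x) * ((?v ?x ?t - ?v ?x (?t - h)) * max 0 (k - U ?x ?t)) \<le> (\<eta> ?t * Z ?x) * (H ?x (?t - h) - H ?x ?t)"
        unfolding H_def using chi Z_bounds by (intro mult_left_mono truncation_energy_chain q mult_nonneg_nonneg) auto
      then show "(?v ?x ?t - ?v ?x (?t - h)) * G ?x ?t \<le> Z ?x * H ?x (?t - h) * \<eta> ?t - Z ?x * H ?x ?t * \<eta> ?t"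
        by (simp add: G_def Z_def algebra_simps)
    qed
    also have "\<dots> = (\<integral>z. Z (fst z) * H (fst z) (snd z - h) * \<eta> (snd z) \<partial>lborel) - (\<integral>z. Z (fst z) * H (fst z) (snd z) * \<eta> (snd z) \<partial>lborel)"
      using j1 j2 by simp
    also have "(\<integral>z. Z (fst z) * H (fst z) (snd z - h) * \<eta> (snd z) \<partial>lborel) = (\<integral>z. Z (fst z) * H (fst z) (snd z) * \<eta> (snd z + h) \<partial>lborel)"
      using shift_time[of "\<lambda>x t. Z x * H x (t - h) * \<eta> t" h] by simp
    also have "(\<integral>z. Z (fst z) * H (fst z) (snd z) * \<eta> (snd z + h) \<partial>lborel) - (\<integral>z. Z (fst z) * H (fst z) (snd z) * \<eta> (snd z) \<partial>lborel)
        = (\<integral>z. Z (fst z) * H (fst z) (snd z) * (\<eta> (snd z + h) - \<eta> (snd z)) \<partial>lborel)"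
      using j2 j3 by (simp add: right_diff_distrib)
    also have "\<dots> \<le> (\<integral>z. h * (\<beta> * (Z (fst z) * H (fst z) (snd z) * indicat_real {Ta - h..Tb} (snd z))
        - \<gamma> * (Z (fst z) * H (fst z) (snd z) * indicat_real {c..d} (snd z))) \<partial>lborel)"
    proof (rule integral_mono)
      show "integrable lborel (\<lambda>z. Z (fst z) * H (fst z) (snd z) * (\<eta> (snd z + h) - \<eta> (snd z)))"
        using j2 j3 by (simp add: right_diff_distrib)
      show "integrable lborel (\<lambda>z. h * (\<beta> * (Z (fst z) * H (fst z) (snd z) * indicat_real {Ta - h..Tb} (snd z))
        - \<gamma> * (Z (fst z) * H (fst z) (snd z) * indicat_real {c..d} (snd z))))"
        by (intro integrable_mult_right Bochner_Integration.integrable_diff j4 j5)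
      fix z :: "'a \<times> real"
      have "(Z (fst z) * H (fst z) (snd z)) * (\<eta> (snd z + h) - \<eta> (snd z))
          \<le> (Z (fst z) * H (fst z) (snd z)) * (h * (\<beta> * indicat_real {Ta - h..Tb} (snd z) - \<gamma> * indicat_real {c..d} (snd z)))"
        by (intro mult_left_mono chi_incr h ZH_bounds)
      then show "Z (fst z) * H (fst z) (snd z) * (\<eta> (snd z + h) - \<eta> (snd z)) \<le> h * (\<beta> * (Z (fst z) * H (fst z) (snd z) * indicat_real {Ta - h..Tb} (snd z))
        - \<gamma> * (Z (fst z) * H (fst z) (snd z) * indicat_real {c..d} (snd z)))"
        by (simp add: algebra_simps)
    qed
    also have "\<dots> = h * (\<beta> * (\<integral>z. Z (fst z) * H (fst z) (snd z) * indicat_real {Ta - h..Tb} (snd z) \<partial>lborel) - \<gamma> * J)"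
      using j4 j5 by (simp add: J_def)
    finally show "(\<integral>z. (?v (fst z) (snd z) - ?v (fst z) (snd z - h)) * G (fst z) (snd z) \<partial>lborel)
        \<le> h * (\<beta> * (\<integral>z. Z (fst z) * H (fst z) (snd z) * indicat_real {Ta - h..Tb} (snd z) \<partial>lborel) - \<gamma> * J)" .
  qed (use h in simp)
  also have "\<dots> = \<beta> * (\<integral>z. Z (fst z) * H (fst z) (snd z) * indicat_real {Ta - h..Tb} (snd z) \<partial>lborel) - \<gamma> * J"
    using h by simp
  also have "\<dots> \<le> \<beta> * (CH * (measure lborel S + measure lborel (ball x0 R) * h)) - \<gamma> * J"
    using early_time_integral[OF h(1)] bg by (intro diff_right_mono mult_left_mono) auto
  finally show ?thesis by (simp add: mult.assoc)
qed

text \<open>The weak inequality for the averaged test function in the limit h \<rightarrow> 0. The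
  threshold \<open>h1\<close> respects both the range of \<open>chi_incr\<close> and the room
  between t1 and a.\<close>

lemma energy_form_integral_lower:
  "\<gamma> * J - \<beta> * CH * measure lborel S \<le> (\<integral>w. energy_form G w \<partial>lborel)"
proof -
  define h1 where "h1 = min h0 (a - t1)"
  have h1: "0 < h1" using h0 t by (simp add: h1_def)
  have "0 \<le> (\<integral>w. energy_form (\<lambda>x. steklov_average h (G x)) w \<partial>lborel)
      + (\<beta> * CH * (measure lborel S + measure lborel (ball x0 R) * h) - \<gamma> * J)" if h: "0 < h" "h < h1" for h
  proof -
    have supp: "x \<in> ball x0 r \<and> t \<in> {a..b}" if "G x t \<noteq> 0" for x t
      using G_support[OF that] R T by auto
    have "0 \<le> (\<integral>(x, y, t). indicat_real {t1..t2} t * (signed_power (p - 1) (U x t - U y t) *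
            (steklov_average h (G x) t - steklov_average h (G y) t) * \<kappa> x y t) \<partial>lborel)
        - (\<integral>(x, t). signed_power q (U x t) * ((G x (t + h) - G x t) / h) \<partial>lborel)"
      by (rule weak[where C = L]) (use G_meas G_bounds supp G_energy_finite h in \<open>auto simp: h1_def\<close>)
    then show ?thesis
      using time_term_le[of h] h by (simp add: energy_form_def[abs_def] case_prod_beta' h1_def)
  qed
  then have ev: "\<forall>\<^sub>F h in at_right 0. 0 \<le> (\<integral>w. energy_form (\<lambda>x. steklov_average h (G x)) w \<partial>lborel)
      + (\<beta> * CH * (measure lborel S + measure lborel (ball x0 R) * h) - \<gamma> * J)"
    using h1 unfolding eventually_at_right_field by blast
  have "((\<lambda>h. (\<integral>w. energy_form (\<lambda>x. steklov_average h (G x)) w \<partial>lborel)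
      + (\<beta> * CH * (measure lborel S + measure lborel (ball x0 R) * h) - \<gamma> * J)) \<longlongrightarrow>
     (\<integral>w. energy_form G w \<partial>lborel) + (\<beta> * CH * (measure lborel S + measure lborel (ball x0 R) * 0) - \<gamma> * J)) (at_right 0)"
    by (intro tendsto_intros energy_form_steklov_tendsto)
  from tendsto_lowerbound[OF this ev] show ?thesis by simp
qed

section \<open>The master estimate: kept energy and time term against the cutoff error\<close>

definition bad :: "'a \<times> 'a \<times> real \<Rightarrow> real"
  where "bad w = (case w of (x, y, t) \<Rightarrow> (2 * \<Lambda> * (2 powr p * p * L) powr p) *
    ((\<bar>cutoff x - cutoff y\<bar> powr p * W x y) * (indicat_real S (x, t) + indicat_real S (y, t))))"

definition good :: "'a \<times> 'a \<times> real \<Rightarrow> real"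
  where "good w = (case w of (x, y, t) \<Rightarrow> \<eta> t * (W x y / \<Lambda>) *
    (if U x t < k \<and> 0 < cutoff x \<and> \<not> (U y t < k \<and> 0 < cutoff y) then ((k - U x t) * cutoff x) powr p else 0))"

text \<open>The 4 is the factor 2 of \<open>caccioppoli_pointwise\<close> times 2 for the two points
  of a pair, either of which may lie in S.\<close>

definition total :: real
  where "total = 4 * \<Lambda> * (2 powr p * p * L) powr p * CK * (R - \<rho>) powr (- (p * s)) * measure lborel S
    + \<beta> * CH * measure lborel S"

lemma bad_nonneg: "0 \<le> bad w"
  using Lam by (auto simp: bad_def split: prod.split intro!: mult_nonneg_nonneg)

lemma good_nonneg: "0 \<le> good w"
  using Lam chi by (auto simp: good_def split: prod.split intro!: mult_nonneg_nonneg)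

lemma bad_integral:
  "integrable lborel bad" "(\<integral>w. bad w \<partial>lborel) \<le> 4 * \<Lambda> * (2 powr p * p * L) powr p * CK * (R - \<rho>) powr (- (p * s)) * measure lborel S"
proof -
  let ?C = "2 * \<Lambda> * (2 powr p * p * L) powr p"
  have C: "0 \<le> ?C" using Lam by simp
  have Sm: "case_prod (\<lambda>x t. indicat_real S (x, t)) \<in> borel_measurable (borel \<Otimes>\<^sub>M borel)"
    by (simp add: case_prod_beta')
  note [measurable] = measurable_compose2[OF Sm]
  have bm: "bad \<in> borel_measurable lborel"
    unfolding bad_def by (intro borel_measurable_triple) measurable
  have "(\<integral>\<^sup>+w. ennreal (bad w) \<partial>lborel) = (\<integral>\<^sup>+w. ennreal ?C * (case w of (x, y, t) \<Rightarrow>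
      ennreal (\<bar>cutoff x - cutoff y\<bar> powr p * W x y) * (indicator S (x, t) + indicator S (y, t))) \<partial>lborel)"
  proof (rule nn_integral_cong)
    fix w :: "'a \<times> 'a \<times> real"
    obtain x y t where w: "w = (x, y, t)" by (cases w)
    have "ennreal (indicat_real S (x, t) + indicat_real S (y, t)) = indicator S (x, t) + indicator S (y, t)"
      by (auto simp: indicator_def)
    then show "ennreal (bad w) = ennreal ?C * (case w of (x, y, t) \<Rightarrow>
      ennreal (\<bar>cutoff x - cutoff y\<bar> powr p * W x y) * (indicator S (x, t) + indicator S (y, t)))"
      unfolding bad_def w prod.case using C by (subst ennreal_mult', simp, subst ennreal_mult', simp, simp)
  qed
  also have "\<dots> = ennreal ?C * (\<integral>\<^sup>+(x, y, t). ennreal (\<bar>cutoff x - cutoff y\<bar> powr p * W x y) * (indicator S (x, t) + indicator S (y, t)) \<partial>lborel)"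
  proof (rule nn_integral_cmult)
    have Sm': "case_prod (\<lambda>x t. indicator S (x, t) :: ennreal) \<in> borel_measurable (borel \<Otimes>\<^sub>M borel)"
      by (simp add: case_prod_beta')
    note [measurable] = measurable_compose2[OF Sm']
    show "(\<lambda>(x, y, t). ennreal (\<bar>cutoff x - cutoff y\<bar> powr p * W x y) * (indicator S (x, t) + indicator S (y, t))) \<in> borel_measurable lborel"
      by (intro borel_measurable_triple) measurable
  qed
  also have "\<dots> \<le> ennreal ?C * (ennreal (2 * CK * (R - \<rho>) powr (- (p * s))) * emeasure lborel S)"
    by (intro mult_left_mono cutoff_kernel_integral S_meas) auto
  also have "\<dots> = ennreal (4 * \<Lambda> * (2 powr p * p * L) powr p * CK * (R - \<rho>) powr (- (p * s)) * measure lborel S)"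
    unfolding S_finite using C CK(1) by (simp add: ennreal_mult'[symmetric] mult_ac)
  finally have le: "(\<integral>\<^sup>+w. ennreal (bad w) \<partial>lborel) \<le> ennreal (4 * \<Lambda> * (2 powr p * p * L) powr p * CK * (R - \<rho>) powr (- (p * s)) * measure lborel S)" .
  show i: "integrable lborel bad"
    using le bad_nonneg by (intro integrableI_nonneg bm) (auto intro: order.strict_trans1)
  have "ennreal (\<integral>w. bad w \<partial>lborel) \<le> ennreal (4 * \<Lambda> * (2 powr p * p * L) powr p * CK * (R - \<rho>) powr (- (p * s)) * measure lborel S)"
    using le nn_integral_eq_integral[OF i] bad_nonneg by simp
  then show "(\<integral>w. bad w \<partial>lborel) \<le> 4 * \<Lambda> * (2 powr p * p * L) powr p * CK * (R - \<rho>) powr (- (p * s)) * measure lborel S"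
    using Lam CK(1) by (subst (asm) ennreal_le_iff) auto
qed

text \<open>This is \<open>caccioppoli_pointwise\<close> multiplied by \<eta> and the kernel. The
  lower kernel bound goes to the kept part, the upper one to the error.\<close>

lemma good_le: "good w \<le> bad w - energy_form G w"
proof -
  obtain x y t where w: "w = (x, y, t)" by (cases w)
  show ?thesis
  proof (cases "\<eta> t = 0")
    case True
    then show ?thesis using bad_nonneg[of w] by (simp add: w good_def energy_form_def G_def)
  next
    case False
    then have tt: "t \<in> {Ta..T0}" "t \<in> {t1..t2}" using chi(3)[of t] T local.t by auto
    define g where "g = (if U x t < k \<and> 0 < cutoff x \<and> \<not> (U y t < k \<and> 0 < cutoff y) then ((k - U x t) * cutoff x) powr p else 0)"
    define Q where "Q = signed_power (p - 1) (U x t - U y t) * (max 0 (k - U x t) * cutoff x powr p - max 0 (k - U y t) * cutoff y powr p)"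
    define P where "P = (if (U x t < k \<and> 0 < cutoff x) \<or> (U y t < k \<and> 0 < cutoff y)
        then 2 * ((2 powr p * p) * L * \<bar>cutoff x - cutoff y\<bar>) powr p else 0)"
    have gQP: "g + Q \<le> P"
      unfolding g_def Q_def P_def
      using caccioppoli_pointwise[OF p, of "cutoff x" "cutoff y" k "U x t" L "U y t"] cutoff[of x] cutoff[of y]
        U_lower[of x t] U_lower[of y t] k by simp
    have g0: "0 \<le> g" "0 \<le> P" by (auto simp: g_def P_def)
    have "energy_form G w = \<eta> t * \<kappa> x y t * Q"
      using tt by (simp add: energy_form_def w G_def Q_def algebra_simps)
    moreover have "good w = \<eta> t * (W x y / \<Lambda>) * g" by (simp add: good_def w g_def)
    moreover have "\<eta> t * (W x y / \<Lambda>) * g \<le> \<eta> t * \<kappa> x y t * g"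
      using chi g0 K_lower by (intro mult_right_mono mult_left_mono) auto
    moreover have "\<eta> t * \<kappa> x y t * (g + Q) \<le> \<eta> t * \<kappa> x y t * P"
      using chi K_nonneg gQP by (intro mult_left_mono) auto
    moreover have "\<eta> t * \<kappa> x y t * P \<le> 1 * (\<Lambda> * W x y) * P"
      using chi K_nonneg K_upper g0 Lam by (intro mult_right_mono mult_mono) auto
    moreover have "(\<Lambda> * W x y) * P \<le> bad w"
    proof (cases "(U x t < k \<and> 0 < cutoff x) \<or> (U y t < k \<and> 0 < cutoff y)")
      case True
      then have "1 \<le> indicat_real S (x, t) + indicat_real S (y, t)"
        using tt cutoff(3)[of x] cutoff(3)[of y] by (auto simp: S_def indicator_def)
      moreover have "P = 2 * (2 powr p * p * L) powr p * \<bar>cutoff x - cutoff y\<bar> powr p"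
        using True L p by (simp add: P_def powr_mult)
      then have "(\<Lambda> * W x y) * P = (2 * \<Lambda> * (2 powr p * p * L) powr p) * ((\<bar>cutoff x - cutoff y\<bar> powr p * W x y) * 1)"
        by (simp add: mult_ac)
      ultimately show ?thesis
        unfolding bad_def w prod.case using Lam by (simp only:) (intro mult_left_mono; simp)
    next
      case False
      then have "P = 0" by (simp only: P_def if_False)
      then show ?thesis using bad_nonneg[of w] by simp
    qed
    ultimately show ?thesis by (simp add: algebra_simps)
  qed
qed

text \<open>Integrating \<open>good_le\<close> and inserting
  \<open>energy_form_integral_lower\<close> puts two nonnegative quantities on one side, the kept
  energy and \<gamma> * J. Dropping either one bounds the other, and the two conclusions drive the
  two halves of an iteration step.\<close>

lemma master_good: "(\<integral>\<^sup>+w. ennreal (good w) \<partial>lborel) \<le> ennreal total"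
  and master_time: "\<gamma> * J \<le> total"
proof -
  have i: "integrable lborel (\<lambda>w. bad w - energy_form G w)"
    using bad_integral(1) admissible_integrable(2)[OF G_admissible] by simp
  have nn: "0 \<le> bad w - energy_form G w" for w using good_le[of w] good_nonneg[of w] by linarith
  have I: "(\<integral>w. bad w - energy_form G w \<partial>lborel) = (\<integral>w. bad w \<partial>lborel) - (\<integral>w. energy_form G w \<partial>lborel)"
    using bad_integral(1) admissible_integrable(2)[OF G_admissible] by simp
  have le: "(\<integral>w. bad w - energy_form G w \<partial>lborel) \<le> total - \<gamma> * J"
    unfolding I total_def using bad_integral(2) energy_form_integral_lower by linarith
  have "(\<integral>\<^sup>+w. ennreal (good w) \<partial>lborel) \<le> (\<integral>\<^sup>+w. ennreal (bad w - energy_form G w) \<partial>lborel)"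
    by (intro nn_integral_mono ennreal_leI good_le)
  also have "\<dots> = ennreal (\<integral>w. bad w - energy_form G w \<partial>lborel)"
    using nn by (intro nn_integral_eq_integral i) auto
  also have "\<dots> \<le> ennreal total"
    using le bg J_nonneg mult_nonneg_nonneg[of \<gamma> J] by (intro ennreal_leI) linarith
  finally show "(\<integral>\<^sup>+w. ennreal (good w) \<partial>lborel) \<le> ennreal total" .
  have "0 \<le> (\<integral>w. bad w - energy_form G w \<partial>lborel)" using nn by (intro integral_nonneg_AE) auto
  then show "\<gamma> * J \<le> total" using le by linarith
qed

end

section \<open>De Giorgi iteration\<close>

text \<open>\<open>L\<^sup>1\<close> convergence of Steklov averages replaces the Lebesgue differentiation theorem.\<close>

lemma AE_slice_bound:
  fixes A :: "('a::euclidean_space \<times> real) set"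
  assumes A[measurable]: "A \<in> sets (borel \<Otimes>\<^sub>M borel)" and Ab: "A \<subseteq> ball x0 R \<times> {\<alpha>..\<beta>}" and m: "0 \<le> m"
    and avg: "\<And>c d. \<alpha> \<le> c \<Longrightarrow> c < d \<Longrightarrow> d < \<beta> \<Longrightarrow> emeasure lborel (A \<inter> UNIV \<times> {c..d}) \<le> ennreal ((d - c) * m)"
  shows "AE t in lborel. t \<in> {\<alpha>..\<beta>} \<longrightarrow> emeasure lborel {x. (x, t) \<in> A} \<le> ennreal m"
proof -
  define F where "F x t = indicat_real A (x, t)" for x t
  define f where "f t = (\<integral>\<^sup>+x. ennreal (F x t) \<partial>lborel)" for t
  have Fm: "case_prod F \<in> borel_measurable (borel \<Otimes>\<^sub>M borel)" by (simp add: F_def case_prod_beta')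
  note [measurable] = measurable_compose2[OF Fm] measurable_compose2[OF measurable_steklov_average[OF Fm]]
  have FB: "\<bar>F x t\<bar> \<le> 1" for x t by (simp add: F_def)
  have Fx: "F x \<in> borel_measurable borel" for x using measurable_compose2[OF Fm, of "\<lambda>_. x" borel "\<lambda>t. t"] by simp
  have F0: "F x t = 0" if "norm x0 + R + \<bar>\<alpha>\<bar> + \<bar>\<beta>\<bar> < norm (x, t)" for x t
  proof (rule ccontr)
    assume "F x t \<noteq> 0"
    then have "(x, t) \<in> A" by (simp add: F_def indicator_def split: if_splits)
    then have "dist x0 x < R" "\<alpha> \<le> t" "t \<le> \<beta>" using Ab by auto
    moreover have "norm x \<le> norm x0 + dist x0 x" using norm_triangle_sub[of x x0] by (simp add: dist_norm norm_minus_commute)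
    moreover have "norm (x, t) \<le> norm x + \<bar>t\<bar>" using norm_Pair_le[of x t] by simp
    ultimately show False using that by linarith
  qed
  define err where "err h = (\<integral>\<^sup>+z. ennreal \<bar>steklov_average h (F (fst z)) (snd z) - F (fst z) (snd z)\<bar> \<partial>lborel)" for h
  have err0: "(err \<longlongrightarrow> 0) (at_right 0)"
    using steklov_average_converges_L1[OF Fm FB F0] by (simp add: err_def[abs_def])
  have fA: "f t = emeasure lborel {x. (x, t) \<in> A}" for t
  proof -
    have "{x. (x, t) \<in> A} = (\<lambda>x. (x, t)) -` A \<inter> space borel" by auto
    also have "\<dots> \<in> sets borel" by (rule measurable_sets[OF _ A]) measurable
    finally have "{x. (x, t) \<in> A} \<in> sets lborel" by simp
    moreover have "(\<lambda>x. ennreal (F x t)) = indicator {x. (x, t) \<in> A}" by (auto simp: F_def indicator_def)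
    ultimately show ?thesis by (simp add: f_def)
  qed
  have [measurable]: "f \<in> borel_measurable borel" unfolding f_def by measurable
  \<comment> \<open>Subtraction in \<open>ennreal\<close> is truncated at 0, so the left side is the
    excess of the slice measure over m. The average over [t, t + h] is at most m by
    \<open>avg\<close>, where h < e keeps t + h below \<beta>; only the deviation from the average
    remains.\<close>
  have key: "(f t - ennreal m) * indicator {\<alpha>..<\<beta> - e} t \<le> (\<integral>\<^sup>+x. ennreal \<bar>steklov_average h (F x) t - F x t\<bar> \<partial>lborel)"
    if h: "0 < h" "h < e" for h e t
  proof (cases "t \<in> {\<alpha>..<\<beta> - e}")
    case True
    have "f t \<le> (\<integral>\<^sup>+x. ennreal \<bar>steklov_average h (F x) t - F x t\<bar> + ennreal (steklov_average h (F x) t) \<partial>lborel)"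
      unfolding f_def
    proof (intro nn_integral_mono)
      fix x
      have sn: "0 \<le> steklov_average h (F x) t" by (rule steklov_average_nonneg[OF h(1)]) (simp add: F_def)
      have "F x t \<le> \<bar>steklov_average h (F x) t - F x t\<bar> + steklov_average h (F x) t" by linarith
      from ennreal_leI[OF this] show "ennreal (F x t) \<le> ennreal \<bar>steklov_average h (F x) t - F x t\<bar> + ennreal (steklov_average h (F x) t)"
        using sn by simp
    qed
    also have "\<dots> = (\<integral>\<^sup>+x. ennreal \<bar>steklov_average h (F x) t - F x t\<bar> \<partial>lborel) + (\<integral>\<^sup>+x. ennreal (steklov_average h (F x) t) \<partial>lborel)"
      by (rule nn_integral_add) measurable
    also have "(\<integral>\<^sup>+x. ennreal (steklov_average h (F x) t) \<partial>lborel) \<le> ennreal m"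
    proof -
      have "(\<integral>\<^sup>+x. ennreal (steklov_average h (F x) t) \<partial>lborel) \<le> (\<integral>\<^sup>+x. ennreal (1 / h) * (\<integral>\<^sup>+\<sigma>. ennreal (F x (t + \<sigma>)) * indicator {0..h} \<sigma> \<partial>lborel) \<partial>lborel)"
      proof (intro nn_integral_mono)
        fix x
        have sn: "0 \<le> steklov_average h (F x) t" by (rule steklov_average_nonneg[OF h(1)]) (simp add: F_def)
        have Fn: "\<bar>F x t\<bar> = F x t" for t by (simp add: F_def)
        show "ennreal (steklov_average h (F x) t) \<le> ennreal (1 / h) * (\<integral>\<^sup>+\<sigma>. ennreal (F x (t + \<sigma>)) * indicator {0..h} \<sigma> \<partial>lborel)"
          using steklov_average_jensen[OF Fx FB h(1), of 1 x t] sn by (simp add: Fn)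
      qed
      also have "\<dots> = ennreal (1 / h) * (\<integral>\<^sup>+x. \<integral>\<^sup>+\<sigma>. ennreal (F x (t + \<sigma>)) * indicator {0..h} \<sigma> \<partial>lborel \<partial>lborel)"
        by (rule nn_integral_cmult) measurable
      also have "(\<integral>\<^sup>+x. \<integral>\<^sup>+\<sigma>. ennreal (F x (t + \<sigma>)) * indicator {0..h} \<sigma> \<partial>lborel \<partial>lborel)
          = (\<integral>\<^sup>+x. \<integral>\<^sup>+\<tau>. indicator (A \<inter> UNIV \<times> {t..t + h}) (x, \<tau>) \<partial>lborel \<partial>lborel)"
      proof (rule nn_integral_cong)
        fix x
        have Am: "(\<lambda>\<tau>. indicator (A \<inter> UNIV \<times> {t..t + h}) (x, \<tau>) :: ennreal) \<in> borel_measurable borel"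
        proof -
          have "(\<lambda>\<tau>. indicator (A \<inter> UNIV \<times> {t..t + h}) (x, \<tau>) :: ennreal) = (\<lambda>\<tau>. ennreal (F x \<tau>) * indicator {t..t + h} \<tau>)"
            by (auto simp: F_def indicator_def)
          then show ?thesis by simp
        qed
        have "(\<integral>\<^sup>+\<sigma>. ennreal (F x (t + \<sigma>)) * indicator {0..h} \<sigma> \<partial>lborel) = (\<integral>\<^sup>+\<sigma>. indicator (A \<inter> UNIV \<times> {t..t + h}) (x, \<sigma> + t) \<partial>lborel)"
          by (intro nn_integral_cong) (auto simp: F_def indicator_def add.commute)
        also have "\<dots> = (\<integral>\<^sup>+\<tau>. indicator (A \<inter> UNIV \<times> {t..t + h}) (x, \<tau>) \<partial>lborel)"
          by (rule nn_integral_lborel_shift[OF Am])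
        finally show "(\<integral>\<^sup>+\<sigma>. ennreal (F x (t + \<sigma>)) * indicator {0..h} \<sigma> \<partial>lborel) = (\<integral>\<^sup>+\<tau>. indicator (A \<inter> UNIV \<times> {t..t + h}) (x, \<tau>) \<partial>lborel)" .
      qed
      also have "\<dots> = emeasure lborel (A \<inter> UNIV \<times> {t..t + h})"
      proof -
        have B: "A \<inter> UNIV \<times> {t..t + h} \<in> sets (borel \<Otimes>\<^sub>M borel)" by (intro sets.Int A pair_measureI) auto
        then have B': "A \<inter> UNIV \<times> {t..t + h} \<in> sets lborel" by (metis borel_prod sets_lborel)
        have "case_prod (\<lambda>x \<tau>. indicator (A \<inter> UNIV \<times> {t..t + h}) (x, \<tau>) :: ennreal) \<in> borel_measurable (borel \<Otimes>\<^sub>M borel)"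
          using B by (simp add: case_prod_beta')
        from nn_integral_lborel_pair(1)[OF this] B' show ?thesis by simp
      qed
      also have "\<dots> \<le> ennreal (h * m)" using avg[of t "t + h"] True h by simp
      finally have "(\<integral>\<^sup>+x. ennreal (steklov_average h (F x) t) \<partial>lborel) \<le> ennreal (1 / h) * ennreal (h * m)" by (simp add: mult_left_mono)
      also have "\<dots> = ennreal m" using h m by (simp add: ennreal_mult'[symmetric])
      finally show ?thesis .
    qed
    finally have "f t \<le> ennreal m + (\<integral>\<^sup>+x. ennreal \<bar>steklov_average h (F x) t - F x t\<bar> \<partial>lborel)"
      by (simp add: add.commute add_left_mono)
    then show ?thesis using True by (simp add: ennreal_minus_le_iff)
  qed simp
  have step: "AE t in lborel. t \<in> {\<alpha>..<\<beta> - e} \<longrightarrow> f t \<le> ennreal m" if e: "0 < e" for e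
  proof -
    have le: "(\<integral>\<^sup>+t. (f t - ennreal m) * indicator {\<alpha>..<\<beta> - e} t \<partial>lborel) \<le> err h" if h: "0 < h" "h < e" for h
    proof -
      have "(\<integral>\<^sup>+t. (f t - ennreal m) * indicator {\<alpha>..<\<beta> - e} t \<partial>lborel) \<le> (\<integral>\<^sup>+t. \<integral>\<^sup>+x. ennreal \<bar>steklov_average h (F x) t - F x t\<bar> \<partial>lborel \<partial>lborel)"
        by (intro nn_integral_mono key h)
      also have "\<dots> = err h"
        unfolding err_def by (rule nn_integral_lborel_pair(2)[symmetric]) measurable
      finally show ?thesis .
    qed
    have "\<forall>\<^sub>F h in at_right 0. (\<integral>\<^sup>+t. (f t - ennreal m) * indicator {\<alpha>..<\<beta> - e} t \<partial>lborel) \<le> err h"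
      using e le unfolding eventually_at_right_field by blast
    from tendsto_lowerbound[OF err0 this] have "(\<integral>\<^sup>+t. (f t - ennreal m) * indicator {\<alpha>..<\<beta> - e} t \<partial>lborel) = 0" by simp
    then have "AE t in lborel. (f t - ennreal m) * indicator {\<alpha>..<\<beta> - e} t = 0"
      by (subst (asm) nn_integral_0_iff_AE) auto
    then show ?thesis
      by eventually_elim (auto simp: indicator_def diff_eq_0_iff_ennreal split: if_splits)
  qed
  \<comment> \<open>Countably many intervals exhaust all times before \<beta>, and the one remaining
    point is null.\<close>
  have "AE t in lborel. \<forall>n. t \<in> {\<alpha>..<\<beta> - inverse (real (Suc n))} \<longrightarrow> f t \<le> ennreal m"
    unfolding AE_all_countable by (intro allI step) simp
  moreover have "AE t in lborel. t \<noteq> \<beta>" by (rule AE_lborel_singleton)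
  ultimately show ?thesis
  proof eventually_elim
    case (elim t)
    show ?case
    proof
      assume "t \<in> {\<alpha>..\<beta>}"
      then have "0 < \<beta> - t" "\<alpha> \<le> t" using elim by auto
      then obtain n where "inverse (real (Suc n)) < \<beta> - t" using reals_Archimedean by blast
      then have "t \<in> {\<alpha>..<\<beta> - inverse (real (Suc n))}" using \<open>\<alpha> \<le> t\<close> by auto
      then show "emeasure lborel {x. (x, t) \<in> A} \<le> ennreal m" using elim fA by metis
    qed
  qed
qed

text \<open>The cutoff behind the slice bound: it rises on [Ta, Tb], stays at 1 until c and then
  falls linearly to 0 at d1. Since h < d1 - d, a step of length h from a point of {c..d} does not
  pass d1, so the full slope of the descent is seen there.\<close>

lemma trapezoid_increment:
  fixes Ta Tb c d d1 h t :: real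
  assumes T: "Ta < Tb" "Tb \<le> c" "c \<le> d" "d < d1" and h: "0 < h" "h < d1 - d"
  defines "f \<equiv> \<lambda>t. max 0 (min ((t - Ta) / (Tb - Ta)) (min 1 ((d1 - t) / (d1 - c))))"
  shows "f (t + h) - f t \<le> h * (1 / (Tb - Ta) * indicat_real {Ta - h..Tb} t - 1 / (d1 - c) * indicat_real {c..d} t)"
proof -
  have A: "(t + h - Ta) / (Tb - Ta) = (t - Ta) / (Tb - Ta) + h / (Tb - Ta)" by (simp add: add_divide_distrib diff_divide_distrib)
  have B: "(d1 - (t + h)) / (d1 - c) = (d1 - t) / (d1 - c) - h / (d1 - c)" by (simp add: add_divide_distrib diff_divide_distrib)
  have pos: "0 < h / (Tb - Ta)" "0 < h / (d1 - c)" using T h by auto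
  consider "t \<in> {c..d}" | "t \<notin> {c..d}" "t \<in> {Ta - h..Tb}" | "t \<notin> {c..d}" "t < Ta - h" | "t \<notin> {c..d}" "Tb < t" by fastforce
  then show ?thesis
  proof cases
    case 1
    then have tt: "Tb \<le> t" "c \<le> t" "t \<le> d" using T by auto
    have 2: "1 \<le> (t - Ta) / (Tb - Ta)" "(d1 - t) / (d1 - c) \<le> 1" "0 \<le> (d1 - (t + h)) / (d1 - c)"
      using tt T h by auto
    have "f t = (d1 - t) / (d1 - c)" unfolding f_def using 2 pos B by auto
    moreover have "f (t + h) = (d1 - (t + h)) / (d1 - c)" unfolding f_def using 2 pos A B by auto
    ultimately have "f (t + h) - f t = - (h / (d1 - c))" using B by simp
    also have "\<dots> \<le> h * (1 / (Tb - Ta) * indicat_real {Ta - h..Tb} t - 1 / (d1 - c))"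
      using pos by (auto simp: indicator_def right_diff_distrib)
    finally show ?thesis using 1 by simp
  next
    case 2
    have "f (t + h) - f t \<le> h / (Tb - Ta)" unfolding f_def A B using pos by linarith
    then show ?thesis using 2 by simp
  next
    case 3
    have "(t + h - Ta) / (Tb - Ta) \<le> 0" using 3 T by (intro divide_nonpos_pos) auto
    then have "f (t + h) = 0" unfolding f_def by auto
    moreover have "0 \<le> f t" unfolding f_def by simp
    moreover have "indicat_real {Ta - h..Tb} t = 0" "indicat_real {c..d} t = 0" using 3 by (auto simp: indicator_def)
    ultimately show ?thesis by simp
  next
    case 4
    have "1 \<le> (t - Ta) / (Tb - Ta)" using 4 T by simp
    then have "f (t + h) \<le> f t" unfolding f_def using A B pos by linarith
    moreover have "indicat_real {Ta - h..Tb} t = 0" "indicat_real {c..d} t = 0" using 4 by (auto simp: indicator_def)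
    ultimately show ?thesis by simp
  qed
qed

text \<open>The cutoff behind the measure gain: it stays at 1 up to the final time T0 and then jumps
  to 0. The downward jump only lowers the increment, and no decay is claimed, so the rate \<gamma>
  is 0.\<close>

lemma ramp_increment:
  fixes Ta Tb T0 h t :: real
  assumes T: "Ta < Tb" "Tb \<le> T0" and h: "0 < h"
  defines "f \<equiv> \<lambda>t. max 0 (min 1 ((t - Ta) / (Tb - Ta))) * indicat_real {..T0} t"
  shows "f (t + h) - f t \<le> h * (1 / (Tb - Ta) * indicat_real {Ta - h..Tb} t - 0 * indicat_real I t)"
proof -
  have A: "(t + h - Ta) / (Tb - Ta) = (t - Ta) / (Tb - Ta) + h / (Tb - Ta)" by (simp add: add_divide_distrib diff_divide_distrib)
  have pos: "0 < h / (Tb - Ta)" using T h by auto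
  have f0: "0 \<le> f t" unfolding f_def by (simp add: indicator_def)
  show ?thesis
  proof (cases "t + h \<le> T0")
    case False
    then have "f (t + h) = 0" by (simp add: f_def)
    then show ?thesis using f0 pos by (auto simp: indicator_def)
  next
    case True
    then have e: "f (t + h) = max 0 (min 1 ((t - Ta) / (Tb - Ta) + h / (Tb - Ta)))" "f t = max 0 (min 1 ((t - Ta) / (Tb - Ta)))"
      using h A by (auto simp: f_def)
    consider "t \<in> {Ta - h..Tb}" | "t < Ta - h" | "Tb < t" by fastforce
    then show ?thesis
    proof cases
      case 1
      have "f (t + h) - f t \<le> h / (Tb - Ta)" unfolding e using pos by linarith
      then show ?thesis using 1 by simp
    next
      case 2
      have "(t + h - Ta) / (Tb - Ta) \<le> 0" using 2 T by (intro divide_nonpos_pos) auto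
      then have "f (t + h) = 0" unfolding e A by auto
      then show ?thesis using f0 2 T by (simp add: indicator_def)
    next
      case 3
      have "1 \<le> (t - Ta) / (Tb - Ta)" using 3 T by simp
      then have "f (t + h) \<le> f t" unfolding e by linarith
      then show ?thesis using 3 T by (simp add: indicator_def)
    qed
  qed
qed

text \<open>Collects what stays fixed along the iteration. Level, radii and time cutoff vary, and
  \<open>truncated_test\<close> is interpreted anew for each choice of them.\<close>

locale levelled_supersolution = regular_supersolution p q s \<Lambda> \<mu> M U \<kappa> x0 r a b t1 t2
  for p q s \<Lambda> \<mu> M :: real and U :: "'a::euclidean_space \<Rightarrow> real \<Rightarrow> real"
    and \<kappa> :: "'a \<Rightarrow> 'a \<Rightarrow> real \<Rightarrow> real" and x0 :: 'a and r a b t1 t2 :: real +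
  fixes CK L :: real
  assumes CK: "0 < CK" "\<And>(x::'a) \<delta>. 0 < \<delta> \<Longrightarrow>
     (\<integral>\<^sup>+y. ennreal (min 1 ((norm (x - y) / \<delta>) powr p) / norm (x - y) powr (real DIM('a) + p * s)) \<partial>lborel)
       \<le> ennreal (CK * \<delta> powr (- (p * s)))"
    and L: "0 < L"
begin

definition sublevel :: "real \<Rightarrow> real \<Rightarrow> real \<Rightarrow> ('a \<times> real) set"
  where "sublevel R k Ta = {z. fst z \<in> ball x0 R \<and> snd z \<in> {Ta..b} \<and> U (fst z) (snd z) < k}"

text \<open>The coefficient of the measure of S in \<open>total\<close>, for the radius gap \<delta>
  and the growth rate \<beta> = 1/\<tau>.\<close>

definition energy_factor :: "real \<Rightarrow> real \<Rightarrow> real"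
  where "energy_factor \<delta> \<tau> = 4 * \<Lambda> * (2 powr p * p * L) powr p * CK * \<delta> powr (- (p * s))
    + 4 * (\<bar>\<mu>\<bar> + L) * (\<bar>\<mu>\<bar> + L) powr q / \<tau>"

definition level_gap :: "real \<Rightarrow> real"
  where "level_gap \<epsilon> = min 1 q * (\<epsilon> / 4) powr (q + 2) / (\<bar>\<mu>\<bar> + L)"

lemmas U_comp'[measurable] = measurable_compose2[OF U_meas]

lemma sublevel_meas[measurable]: "sublevel R k Ta \<in> sets (borel \<Otimes>\<^sub>M borel)"
proof -
  have [measurable]: "ball x0 R \<in> sets borel" by simp
  have "sublevel R k Ta = {z \<in> space (borel \<Otimes>\<^sub>M borel). fst z \<in> ball x0 R \<and> snd z \<in> {Ta..b} \<and> U (fst z) (snd z) < k}"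
    by (auto simp: sublevel_def space_pair_measure)
  also have "\<dots> \<in> sets (borel \<Otimes>\<^sub>M borel)" by measurable
  finally show ?thesis .
qed

lemma sublevel_sets: "sublevel R k Ta \<in> sets lborel"
  using sublevel_meas by (metis borel_prod sets_lborel)

lemma sublevel_finite: "emeasure lborel (sublevel R k Ta) = ennreal (measure lborel (sublevel R k Ta))"
proof (rule emeasure_eq_ennreal_measure)
  have "emeasure lborel (sublevel R k Ta) \<le> emeasure lborel (ball x0 R \<times> {Ta..b})"
    by (intro emeasure_mono) (auto simp: sublevel_def borel_prod[symmetric])
  also have "\<dots> = emeasure lborel (ball x0 R) * emeasure lborel {Ta..b}"
    unfolding lborel_prod[symmetric] by (subst lborel.emeasure_pair_measure_Times) auto
  also have "\<dots> < \<infinity>"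
    using emeasure_lborel_ball_finite[of x0 R] by (auto simp: ennreal_mult_less_top emeasure_lborel_Icc_eq)
  finally show "emeasure lborel (sublevel R k Ta) \<noteq> top" by simp
qed

lemma sublevel_mono:
  assumes "R \<le> R'" "k \<le> k'" "Ta' \<le> Ta"
  shows "measure lborel (sublevel R k Ta) \<le> measure lborel (sublevel R' k' Ta')"
proof (rule measure_mono_fmeasurable)
  show "sublevel R k Ta \<subseteq> sublevel R' k' Ta'" using assms by (auto simp: sublevel_def)
  show "sublevel R k Ta \<in> sets lborel" by (rule sublevel_sets)
  show "sublevel R' k' Ta' \<in> fmeasurable lborel" by (intro fmeasurableI sublevel_sets) (simp add: sublevel_finite)
qed

lemma energy_factor_pos: "0 < \<tau> \<Longrightarrow> 0 < \<delta> \<Longrightarrow> 0 < energy_factor \<delta> \<tau>"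
  unfolding energy_factor_def using CK(1) Lam p L
  by (intro add_pos_nonneg mult_pos_pos divide_nonneg_pos mult_nonneg_nonneg) auto

lemma level_gap_pos: "0 < \<epsilon> \<Longrightarrow> 0 < level_gap \<epsilon>"
  unfolding level_gap_def using q L by (intro divide_pos_pos mult_pos_pos) auto

text \<open>The trapezoidal cutoff with descent on [c, d1]. On the smaller set the truncation energy
  is at least \<open>level_gap \<epsilon>\<close> and the spatial cutoff is 1, so J controls the
  measure. The rate \<gamma> = 1/(d1 - c) makes the bound proportional to d1 - c, and d1
  \<rightarrow> d yields the averages that \<open>AE_slice_bound\<close> asks for.\<close>

lemma sublevel_time_average:
  assumes k: "\<mu> \<le> k" "k \<le> \<mu> + L" and e: "0 < \<epsilon>" and R: "0 < \<rho>" "\<rho> < R" "R < r"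
    and T: "a \<le> Ta" "Ta < Tb" "Tb \<le> c" "c < d" "d < b"
  shows "emeasure lborel (sublevel \<rho> (k - \<epsilon>) Tb \<inter> UNIV \<times> {c..d})
    \<le> ennreal ((d - c) * (energy_factor (R - \<rho>) (Tb - Ta) * measure lborel (sublevel R k Ta) / level_gap \<epsilon>))"
proof -
  define X where "X = energy_factor (R - \<rho>) (Tb - Ta) * measure lborel (sublevel R k Ta)"
  define A where "A = sublevel \<rho> (k - \<epsilon>) Tb \<inter> UNIV \<times> {c..d}"
  have A[measurable]: "A \<in> sets (borel \<Otimes>\<^sub>M borel)" unfolding A_def by (intro sets.Int sublevel_meas pair_measureI) auto
  have Al: "A \<in> sets lborel" using A by (metis borel_prod sets_lborel)
  have "emeasure lborel A \<le> emeasure lborel (sublevel \<rho> (k - \<epsilon>) Tb)"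
    unfolding A_def by (intro emeasure_mono sublevel_sets) auto
  then have Af: "emeasure lborel A = ennreal (measure lborel A)"
    by (intro emeasure_eq_ennreal_measure) (auto simp: sublevel_finite top_unique)
  note TT = T
  have main: "level_gap \<epsilon> * measure lborel A \<le> (d1 - c) * X" if d1: "d < d1" "d1 < b" for d1
  proof -
    define \<eta> where "\<eta> t = max 0 (min ((t - Ta) / (Tb - Ta)) (min 1 ((d1 - t) / (d1 - c))))" for t
    interpret truncated_test p q s \<Lambda> \<mu> M U \<kappa> x0 r a b t1 t2 CK L k \<rho> R Ta Tb b "1 / (Tb - Ta)" "1 / (d1 - c)" c d "d1 - d" \<eta>
    proof (unfold_locales; (intro CK L k R)?)
      show "\<eta> \<in> borel_measurable borel" unfolding \<eta>_def by measurable
      show "0 \<le> \<eta> t" "\<eta> t \<le> 1" for t unfolding \<eta>_def by auto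
      show "t \<in> {Ta..b}" if "\<eta> t \<noteq> 0" for t
      proof -
        have "0 < \<eta> t" using that by (auto simp: \<eta>_def)
        then have "0 < (t - Ta) / (Tb - Ta)" "0 < (d1 - t) / (d1 - c)" unfolding \<eta>_def by linarith+
        then show ?thesis using T d1 by (auto simp: zero_less_divide_iff)
      qed
      show "\<eta> (t + h) - \<eta> t \<le> h * (1 / (Tb - Ta) * indicat_real {Ta - h..Tb} t - 1 / (d1 - c) * indicat_real {c..d} t)"
        if "0 < h" "h < d1 - d" for h t
        unfolding \<eta>_def using T d1 that by (intro trapezoid_increment) auto
    qed (use T d1 in auto)
    have S_eq: "S = sublevel R k Ta" by (simp add: S_def sublevel_def)
    have tot: "total = X"
      proof -
      have "E1 * m' + 1 / \<tau> * E2 * m' = (E1 + E2 / \<tau>) * m'" for E1 E2 \<tau> m' :: real by (simp add: algebra_simps)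
      then show ?thesis unfolding total_def X_def energy_factor_def S_eq CH_def .
    qed
    have "level_gap \<epsilon> * measure lborel A = (\<integral>z. level_gap \<epsilon> * indicat_real A z \<partial>lborel)"
      using Al by simp
    also have "\<dots> \<le> J"
      unfolding J_def
    proof (rule integral_mono)
      show "integrable lborel (\<lambda>z. level_gap \<epsilon> * indicat_real A z)"
        using Al Af by (intro integrable_mult_right integrable_real_indicator) auto
      show "integrable lborel (\<lambda>z. Z (fst z) * H (fst z) (snd z) * indicat_real {c..d} (snd z))"
        by (rule ZH_integrable[where B = 1 and \<alpha> = c and \<omega> = d]) (auto simp: indicator_def split: if_splits)
      fix z :: "'a \<times> real"
      show "level_gap \<epsilon> * indicat_real A z \<le> Z (fst z) * H (fst z) (snd z) * indicat_real {c..d} (snd z)"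
      proof (cases "z \<in> A")
        case True
        then have z: "fst z \<in> ball x0 \<rho>" "snd z \<in> {c..d}" "U (fst z) (snd z) < k - \<epsilon>"
          by (auto simp: A_def sublevel_def)
        then have "Z (fst z) = 1" using cutoff(4)[of "fst z"] by (simp add: Z_def)
        moreover have "level_gap \<epsilon> \<le> H (fst z) (snd z)"
          unfolding level_gap_def H_def using z k e L U_lower[of "fst z" "snd z"] q
          by (intro truncation_energy_ge) auto
        ultimately show ?thesis using True z by simp
      next
        case False
        have "0 \<le> Z (fst z) * H (fst z) (snd z) * indicat_real {c..d} (snd z)" by (intro mult_nonneg_nonneg ZH_bounds) auto
        then show ?thesis using False by simp
      qed
    qed
    also have "\<dots> \<le> (d1 - c) * X"
      using master_time TT d1 unfolding tot by (simp add: pos_divide_le_eq mult.commute)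
    finally show ?thesis .
  qed
  have "((\<lambda>d1. (d1 - c) * X) \<longlongrightarrow> (d - c) * X) (at_right d)" by (intro tendsto_intros)
  moreover have "\<forall>\<^sub>F d1 in at_right d. level_gap \<epsilon> * measure lborel A \<le> (d1 - c) * X"
    unfolding eventually_at_right_field using T main by blast
  ultimately have "level_gap \<epsilon> * measure lborel A \<le> (d - c) * X"
    by (rule tendsto_lowerbound) (simp add: trivial_limit_at_right_real)
  then have "measure lborel A \<le> (d - c) * (X / level_gap \<epsilon>)"
    using level_gap_pos[OF e] by (simp add: field_simps)
  then show ?thesis unfolding Af[unfolded A_def, folded A_def] X_def[symmetric] A_def[symmetric]
    by (intro ennreal_leI)
qed

lemma sublevel_slices:
  assumes k: "\<mu> \<le> k" "k \<le> \<mu> + L" and e: "0 < \<epsilon>" and R: "0 < \<rho>" "\<rho> < R" "R < r"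
    and T: "a \<le> Ta" "Ta < Tb" "Tb < b"
  shows "AE t in lborel. t \<in> {Tb..b} \<longrightarrow> emeasure lborel {x \<in> ball x0 \<rho>. U x t < k - \<epsilon>}
    \<le> ennreal (energy_factor (R - \<rho>) (Tb - Ta) * measure lborel (sublevel R k Ta) / level_gap \<epsilon>)"
proof -
  have nn: "0 \<le> energy_factor (R - \<rho>) (Tb - Ta) * measure lborel (sublevel R k Ta) / level_gap \<epsilon>"
    using energy_factor_pos[of "Tb - Ta" "R - \<rho>"] level_gap_pos[OF e] R T by simp
  have "AE t in lborel. t \<in> {Tb..b} \<longrightarrow> emeasure lborel {x. (x, t) \<in> sublevel \<rho> (k - \<epsilon>) Tb}
    \<le> ennreal (energy_factor (R - \<rho>) (Tb - Ta) * measure lborel (sublevel R k Ta) / level_gap \<epsilon>)"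
  proof (rule AE_slice_bound[OF sublevel_meas _ nn])
    show "sublevel \<rho> (k - \<epsilon>) Tb \<subseteq> ball x0 \<rho> \<times> {Tb..b}" by (auto simp: sublevel_def)
  qed (intro sublevel_time_average k e R T)
  then show ?thesis
  proof eventually_elim
    case (elim t)
    show ?case
    proof
      assume t: "t \<in> {Tb..b}"
      then have "{x. (x, t) \<in> sublevel \<rho> (k - \<epsilon>) Tb} = {x \<in> ball x0 \<rho>. U x t < k - \<epsilon>}"
        by (auto simp: sublevel_def)
      then show "emeasure lborel {x \<in> ball x0 \<rho>. U x t < k - \<epsilon>}
         \<le> ennreal (energy_factor (R - \<rho>) (Tb - Ta) * measure lborel (sublevel R k Ta) / level_gap \<epsilon>)"
        using elim t by simp
    qed
  qed
qed

text \<open>A point x of the smaller set has k - U > \<epsilon> and cutoff 1, and it jumps to zero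
  at every y outside a set of measure at most m. By \<open>kernel_complement_lower_bound\<close>
  these jumps weigh at least a multiple of \<open>m powr (- (p * s) / n)\<close>, so small slices
  amplify the kept energy.\<close>

lemma sublevel_measure_gain:
  assumes k: "\<mu> \<le> k" "k \<le> \<mu> + L" and e: "0 < \<epsilon>" and R: "0 < \<rho>" "\<rho> < R" "R < r"
    and T: "a \<le> Ta" "Ta < Tb" "Tb \<le> b" and m: "0 < m"
    and slices: "AE t in lborel. t \<in> {Tb..b} \<longrightarrow> emeasure lborel {x \<in> ball x0 R. U x t < k} \<le> ennreal m"
  shows "(\<epsilon> powr p / \<Lambda> * ((unit_ball_vol (real DIM('a)) / 2) powr (1 + p * s / real DIM('a)) * m powr (- (p * s) / real DIM('a)))) *
     measure lborel (sublevel \<rho> (k - \<epsilon>) Tb) \<le> energy_factor (R - \<rho>) (Tb - Ta) * measure lborel (sublevel R k Ta)"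
proof -
  define X where "X = energy_factor (R - \<rho>) (Tb - Ta) * measure lborel (sublevel R k Ta)"
  define c0 where "c0 = (unit_ball_vol (real DIM('a)) / 2) powr (1 + p * s / real DIM('a)) * m powr (- (p * s) / real DIM('a))"
  define \<eta> where "\<eta> t = max 0 (min 1 ((t - Ta) / (Tb - Ta))) * indicat_real {..b} t" for t
  interpret truncated_test p q s \<Lambda> \<mu> M U \<kappa> x0 r a b t1 t2 CK L k \<rho> R Ta Tb b "1 / (Tb - Ta)" 0 0 0 1 \<eta>
  proof (unfold_locales; (intro CK L k R)?)
    show "\<eta> \<in> borel_measurable borel" unfolding \<eta>_def by measurable
    show "0 \<le> \<eta> t" "\<eta> t \<le> 1" for t unfolding \<eta>_def by (auto simp: indicator_def)
    show "t \<in> {Ta..b}" if "\<eta> t \<noteq> 0" for t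
    proof -
      have tb: "t \<le> b" and "0 < max 0 (min 1 ((t - Ta) / (Tb - Ta)))"
        using that by (auto simp: \<eta>_def indicator_def split: if_splits)
      then have "0 < (t - Ta) / (Tb - Ta)" "t \<le> b" by linarith+
      then show ?thesis using T by (auto simp: zero_less_divide_iff)
    qed
    show "\<eta> (t + h) - \<eta> t \<le> h * (1 / (Tb - Ta) * indicat_real {Ta - h..Tb} t - 0 * indicat_real {0..0} t)"
      if "0 < h" "h < 1" for h t
      unfolding \<eta>_def using T that by (intro ramp_increment) auto
  qed (use T in auto)
  have S_eq: "S = sublevel R k Ta" by (simp add: S_def sublevel_def)
  have tot: "total = X"
    proof -
      have "E1 * m' + 1 / \<tau> * E2 * m' = (E1 + E2 / \<tau>) * m'" for E1 E2 \<tau> m' :: real by (simp add: algebra_simps)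
      then show ?thesis unfolding total_def X_def energy_factor_def S_eq CH_def .
    qed
  define A where "A = sublevel \<rho> (k - \<epsilon>) Tb"
  have Am: "case_prod (\<lambda>x t. indicator A (x, t) :: ennreal) \<in> borel_measurable (borel \<Otimes>\<^sub>M borel)"
    unfolding A_def by (simp add: case_prod_beta')
  note [measurable] = measurable_compose2[OF Am]
  have gm: "(\<lambda>(x, y, t). ennreal (good (x, y, t))) \<in> borel_measurable (borel \<Otimes>\<^sub>M borel \<Otimes>\<^sub>M borel)"
    unfolding good_def by measurable
  have slice: "AE t in lborel. (\<integral>\<^sup>+x. ennreal (\<epsilon> powr p / \<Lambda> * c0) * indicator A (x, t) \<partial>lborel) \<le> (\<integral>\<^sup>+x. \<integral>\<^sup>+y. ennreal (good (x, y, t)) \<partial>lborel \<partial>lborel)"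
    using slices
  proof eventually_elim
    case (elim t)
    show ?case
    proof (intro nn_integral_mono)
      fix x
      show "ennreal (\<epsilon> powr p / \<Lambda> * c0) * indicator A (x, t) \<le> (\<integral>\<^sup>+y. ennreal (good (x, y, t)) \<partial>lborel)"
      proof (cases "(x, t) \<in> A")
        case True
        then have xt: "x \<in> ball x0 \<rho>" "t \<in> {Tb..b}" "U x t < k - \<epsilon>" by (auto simp: A_def sublevel_def)
        \<comment> \<open>Outside B either U \<ge> k or the cutoff vanishes, so every such y is a
          partner to which x jumps to zero.\<close>
        define B where "B = {y \<in> ball x0 R. U y t < k}"
        have Bm[measurable]: "B \<in> sets borel"
        proof -
          have "B = {y \<in> space borel. y \<in> ball x0 R \<and> U y t < k}" by (auto simp: B_def)
          also have "\<dots> \<in> sets borel" by measurable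
          finally show ?thesis .
        qed
        have et: "\<eta> t = 1" using xt T by (auto simp: \<eta>_def)
        have cx: "cutoff x = 1" by (rule cutoff(4)[OF xt(1)])
        have ptw: "ennreal (\<epsilon> powr p / \<Lambda>) * (ennreal (W x y) * indicator (- B) y) \<le> ennreal (good (x, y, t))" for y
        proof (cases "y \<in> B")
          case False
          then have nb: "\<not> (U y t < k \<and> 0 < cutoff y)" using cutoff(3)[of y] by (auto simp: B_def)
          have "\<epsilon> powr p \<le> (k - U x t) powr p" using xt e p by (intro powr_mono2) auto
          then have "\<epsilon> powr p / \<Lambda> * W x y \<le> (W x y / \<Lambda>) * (k - U x t) powr p"
            using Lam by (simp add: divide_right_mono mult.commute[of \<Lambda>])
          moreover have "good (x, y, t) = (W x y / \<Lambda>) * (k - U x t) powr p"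
            using nb xt e cx et by (simp add: good_def)
          ultimately show ?thesis using False Lam by (simp add: ennreal_mult'[symmetric] ennreal_leI)
        qed simp
        have "ennreal (\<epsilon> powr p / \<Lambda> * c0) = ennreal (\<epsilon> powr p / \<Lambda>) * ennreal c0"
          using Lam by (intro ennreal_mult') auto
        also have "\<dots> \<le> ennreal (\<epsilon> powr p / \<Lambda>) * (\<integral>\<^sup>+y. ennreal (W x y) * indicator (- B) y \<partial>lborel)"
        proof (intro mult_left_mono)
          have "emeasure lborel B \<le> ennreal m" using elim xt by (simp add: B_def)
          then show "ennreal c0 \<le> (\<integral>\<^sup>+y. ennreal (W x y) * indicator (- B) y \<partial>lborel)"
            unfolding c0_def by (rule kernel_complement_lower_bound[OF Bm _ m]) (use p s in simp)
        qed simp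
        also have "\<dots> = (\<integral>\<^sup>+y. ennreal (\<epsilon> powr p / \<Lambda>) * (ennreal (W x y) * indicator (- B) y) \<partial>lborel)"
          by (rule nn_integral_cmult[symmetric]) measurable
        also have "\<dots> \<le> (\<integral>\<^sup>+y. ennreal (good (x, y, t)) \<partial>lborel)" by (intro nn_integral_mono ptw)
        finally show ?thesis using True by simp
      qed simp
    qed
  qed
  have "ennreal (\<epsilon> powr p / \<Lambda> * c0) * emeasure lborel A = (\<integral>\<^sup>+t. \<integral>\<^sup>+x. ennreal (\<epsilon> powr p / \<Lambda> * c0) * indicator A (x, t) \<partial>lborel \<partial>lborel)"
    using nn_integral_lborel_pair(2)[OF Am] sublevel_sets by (simp add: nn_integral_cmult A_def)
  also have "\<dots> \<le> (\<integral>\<^sup>+t. \<integral>\<^sup>+x. \<integral>\<^sup>+y. ennreal (good (x, y, t)) \<partial>lborel \<partial>lborel \<partial>lborel)"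
    by (intro nn_integral_mono_AE slice)
  also have "\<dots> = (\<integral>\<^sup>+w. ennreal (good w) \<partial>lborel)"
    using nn_integral_lborel_triple(2)[OF gm] by (simp add: case_prod_beta')
  also have "\<dots> \<le> ennreal X" using master_good tot by simp
  finally have "ennreal (\<epsilon> powr p / \<Lambda> * c0 * measure lborel A) \<le> ennreal X"
    using Lam unfolding A_def sublevel_finite by (subst ennreal_mult') (auto simp: c0_def)
  moreover have "0 \<le> X" unfolding X_def using energy_factor_pos[of "Tb - Ta" "R - \<rho>"] R T by simp
  ultimately show ?thesis by (simp add: X_def c0_def A_def)
qed

end

section \<open>Constants of the iteration and scaling in the radius\<close>

definition energy_const :: "real \<Rightarrow> real \<Rightarrow> real \<Rightarrow> real \<Rightarrow> real \<Rightarrow> real \<Rightarrow> real \<Rightarrow> real \<Rightarrow> real"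
  where "energy_const p q s \<Lambda> \<mu> L CK \<theta> = 4 * \<Lambda> * (2 powr p * p * L) powr p * CK * 16 powr (p * s)
    + 4 * (\<bar>\<mu>\<bar> + L) * (\<bar>\<mu>\<bar> + L) powr q * 16 powr (p * s + 1) / (\<theta> * min 1 (p * s))"

text \<open>\<open>level_gap\<close> of the first drop (1 - \<sigma>) * L * x / 2, with its power of
  x split off.\<close>

definition gap_const :: "real \<Rightarrow> real \<Rightarrow> real \<Rightarrow> real \<Rightarrow> real"
  where "gap_const q \<mu> L \<sigma> = min 1 q * ((1 - \<sigma>) * L / 8) powr (q + 2) / (\<bar>\<mu>\<bar> + L)"

text \<open>The powers of 1/x lost in one step: p s + 1 from the energy factor, raised to 1 + p s /
  n; q + 2 from the level gap, raised to p s / n; and p from the second level drop.\<close>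

definition rate :: "real \<Rightarrow> real \<Rightarrow> real \<Rightarrow> real \<Rightarrow> real"
  where "rate p q s n = (p * s + 1) * (1 + p * s / n) + p * s / n * (q + 2) + p"

text \<open>The constants stand outside the locale, as functions of the data alone, because \<tau>
  has to be computed from them before a solution is given.\<close>

definition step_const :: "real \<Rightarrow> real \<Rightarrow> real \<Rightarrow> real \<Rightarrow> real \<Rightarrow> real \<Rightarrow> real \<Rightarrow> real \<Rightarrow> real \<Rightarrow> real \<Rightarrow> real"
  where "step_const p q s \<Lambda> \<mu> L CK \<theta> \<sigma> n =
    (energy_const p q s \<Lambda> \<mu> L CK \<theta> * 2 powr (p * s + 1)) powr (1 + p * s / n) * gap_const q \<mu> L \<sigma> powr (- (p * s / n)) * \<Lambda>
      / (((1 - \<sigma>) * L / 4) powr p * (unit_ball_vol n / 2) powr (1 + p * s / n))"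

context levelled_supersolution
begin

text \<open>Two drops in level, each with its own radii and starting times. The first turns the
  truncation energy into the slice bound m = Q * D / \<open>level_gap \<epsilon>1\<close>,
  proportional to D. The second feeds m into \<open>sublevel_measure_gain\<close>, and the resulting
  factor \<open>m powr (p * s / n)\<close> lifts the exponent of D above 1.\<close>

lemma sublevel_step:
  assumes k: "\<mu> \<le> k - \<epsilon>1" "k \<le> \<mu> + L" and e: "0 < \<epsilon>1" "0 < \<epsilon>2"
    and R: "0 < \<rho>2" "\<rho>2 < \<rho>1" "\<rho>1 < \<rho>0" "\<rho>0 < r"
    and T: "a \<le> \<tau>0" "\<tau>0 < \<tau>1" "\<tau>1 < \<tau>2" "\<tau>2 \<le> b"
    and Q: "energy_factor (\<rho>0 - \<rho>1) (\<tau>1 - \<tau>0) \<le> Q" "energy_factor (\<rho>1 - \<rho>2) (\<tau>2 - \<tau>1) \<le> Q"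
  defines "n \<equiv> real DIM('a)" and "D \<equiv> measure lborel (sublevel \<rho>0 k \<tau>0)"
  shows "measure lborel (sublevel \<rho>2 (k - \<epsilon>1 - \<epsilon>2) \<tau>2)
    \<le> Q * (Q / level_gap \<epsilon>1) powr (p * s / n) * \<Lambda> / (\<epsilon>2 powr p * (unit_ball_vol n / 2) powr (1 + p * s / n)) * D powr (1 + p * s / n)"
proof -
  have D0: "0 \<le> D" by (simp add: D_def)
  have D2: "measure lborel (sublevel \<rho>2 (k - \<epsilon>1 - \<epsilon>2) \<tau>2) \<le> D"
    and D1: "measure lborel (sublevel \<rho>1 (k - \<epsilon>1) \<tau>1) \<le> D"
    unfolding D_def using R T e by (auto intro!: sublevel_mono)
  show ?thesis
  proof (cases "D = 0")
    \<comment> \<open>D = 0 would give m = 0, whereas the kernel bound needs m > 0; monotonicity of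
      sublevel sets settles this case.\<close>
    case True
    then show ?thesis using D2 by simp
  next
    case False
    then have D: "0 < D" using D0 by simp
    have ef: "0 < energy_factor (\<rho>0 - \<rho>1) (\<tau>1 - \<tau>0)" using R T by (intro energy_factor_pos) auto
    then have Qp: "0 < Q" using Q by linarith
    have gp: "0 < level_gap \<epsilon>1" by (rule level_gap_pos[OF e(1)])
    define m where "m = Q * D / level_gap \<epsilon>1"
    have m: "0 < m" using Qp D gp by (simp add: m_def)
    have n: "0 < n" by (simp add: n_def)
    have sl: "AE t in lborel. t \<in> {\<tau>1..b} \<longrightarrow> emeasure lborel {x \<in> ball x0 \<rho>1. U x t < k - \<epsilon>1}
        \<le> ennreal (energy_factor (\<rho>0 - \<rho>1) (\<tau>1 - \<tau>0) * D / level_gap \<epsilon>1)"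
      unfolding D_def using k e R T by (intro sublevel_slices) auto
    have slices: "AE t in lborel. t \<in> {\<tau>2..b} \<longrightarrow> emeasure lborel {x \<in> ball x0 \<rho>1. U x t < k - \<epsilon>1} \<le> ennreal m"
      using sl
    proof eventually_elim
      case (elim t)
      show ?case
      proof
        assume "t \<in> {\<tau>2..b}"
        then have "t \<in> {\<tau>1..b}" using T by auto
        with elim have "emeasure lborel {x \<in> ball x0 \<rho>1. U x t < k - \<epsilon>1} \<le> ennreal (energy_factor (\<rho>0 - \<rho>1) (\<tau>1 - \<tau>0) * D / level_gap \<epsilon>1)" by simp
        also have "\<dots> \<le> ennreal m" unfolding m_def using Q(1) gp D0 by (intro ennreal_leI divide_right_mono mult_right_mono) auto
        finally show "emeasure lborel {x \<in> ball x0 \<rho>1. U x t < k - \<epsilon>1} \<le> ennreal m" .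
      qed
    qed
    define V where "V = (unit_ball_vol n / 2) powr (1 + p * s / n)"
    have "unit_ball_vol n \<noteq> 0" using unit_ball_vol_pos[of n] n by linarith
    then have V: "0 < V" by (simp add: V_def)
    have "(\<epsilon>2 powr p / \<Lambda> * (V * m powr (- (p * s) / n))) * measure lborel (sublevel \<rho>2 (k - \<epsilon>1 - \<epsilon>2) \<tau>2)
        \<le> energy_factor (\<rho>1 - \<rho>2) (\<tau>2 - \<tau>1) * measure lborel (sublevel \<rho>1 (k - \<epsilon>1) \<tau>1)"
      unfolding V_def n_def using k e R T L by (intro sublevel_measure_gain slices m) auto
    also have "\<dots> \<le> Q * D" using Q(2) D1 Qp by (intro mult_mono) auto
    finally have "measure lborel (sublevel \<rho>2 (k - \<epsilon>1 - \<epsilon>2) \<tau>2) \<le> Q * D / (\<epsilon>2 powr p / \<Lambda> * (V * m powr (- (p * s) / n)))"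
      using e V m Lam by (subst pos_le_divide_eq) (auto simp: mult.commute)
    also have "\<dots> = Q * (Q / level_gap \<epsilon>1) powr (p * s / n) * \<Lambda> / (\<epsilon>2 powr p * V) * (D * D powr (p * s / n))"
    proof -
      have "m powr (p * s / n) = (Q / level_gap \<epsilon>1) powr (p * s / n) * D powr (p * s / n)"
        unfolding m_def using Qp D gp by (subst powr_mult[symmetric]) auto
      then show ?thesis using m by (simp add: powr_minus_divide minus_divide_left[symmetric])
    qed
    also have "D * D powr (p * s / n) = D powr (1 + p * s / n)" using D by (simp add: powr_add)
    finally show ?thesis unfolding V_def .
  qed
qed

text \<open>Starting times follow the radii as \<theta> R^(p s), so the time gap is a difference of
  powers, bounded below by \<open>powr_diff_ge\<close>; this is the origin of min 1 (p s) and of the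
  exponent p s + 1. The 16 comes from the radius gap r e / 16, and e \<le> 1 lets both summands
  carry the larger power of 1/e.\<close>

lemma energy_factor_scaled:
  assumes e: "0 < e" "e \<le> 1" and th: "0 < \<theta>"
  defines "R \<equiv> r * (3 / 4 + e / 8)" and "\<rho> \<equiv> r * (3 / 4 + e / 16)"
  shows "energy_factor (R - \<rho>) (\<theta> * R powr (p * s) - \<theta> * \<rho> powr (p * s))
    \<le> energy_const p q s \<Lambda> \<mu> L CK \<theta> * e powr (- (p * s + 1)) * r powr (- (p * s))"
    and "\<theta> * \<rho> powr (p * s) < \<theta> * R powr (p * s)"
proof -
  define g where "g = p * s"
  have g: "0 < g" using p s by (simp add: g_def)
  have Rr: "0 \<le> \<rho>" "\<rho> < R" "R \<le> r"
  proof -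
    show "0 \<le> \<rho>" "\<rho> < R" using e r by (auto simp: R_def \<rho>_def intro!: mult_nonneg_nonneg)
    have "r * (3 / 4 + e / 8) \<le> r * 1" using e r by (intro mult_left_mono) auto
    then show "R \<le> r" by (simp add: R_def)
  qed
  have d: "R - \<rho> = r * (e / 16)" by (simp add: R_def \<rho>_def field_simps)
  have dp: "(R - \<rho>) powr c = r powr c * (e / 16) powr c" for c
    unfolding d using r e by (subst powr_mult) auto
  define A where "A = 4 * \<Lambda> * (2 powr p * p * L) powr p * CK"
  define B where "B = 4 * (\<bar>\<mu>\<bar> + L) * (\<bar>\<mu>\<bar> + L) powr q"
  have AB: "0 \<le> A" "0 \<le> B" using Lam CK(1) L by (auto simp: A_def B_def)
  have low: "min 1 g * (r powr g * (e / 16) powr (g + 1)) \<le> R powr g - \<rho> powr g"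
  proof -
    have "min 1 g * (R - \<rho>) powr (g + 1) / r \<le> R powr g - \<rho> powr g"
      by (rule powr_diff_ge[OF g Rr])
    moreover have "(R - \<rho>) powr (g + 1) / r = r powr g * (e / 16) powr (g + 1)"
      unfolding dp using r by (simp add: powr_add)
    ultimately show ?thesis by (metis times_divide_eq_right)
  qed
  have lp: "0 < min 1 g * (r powr g * (e / 16) powr (g + 1))" using g r e by auto
  then have lt: "\<rho> powr g < R powr g" using low by linarith
  then show "\<theta> * \<rho> powr (p * s) < \<theta> * R powr (p * s)" using low th by (simp add: g_def)
  have 1: "A * (R - \<rho>) powr (- g) \<le> A * 16 powr g * e powr (- (g + 1)) * r powr (- g)"
  proof -
    have "(R - \<rho>) powr (- g) = r powr (- g) * (e powr (- g) * 16 powr g)"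
      unfolding dp by (simp add: powr_divide powr_minus_divide)
    also have "\<dots> \<le> r powr (- g) * (e powr (- (g + 1)) * 16 powr g)"
      using e by (intro mult_left_mono mult_right_mono powr_mono') auto
    finally have "A * (R - \<rho>) powr (- g) \<le> A * (r powr (- g) * (e powr (- (g + 1)) * 16 powr g))"
      using AB by (intro mult_left_mono) auto
    then show ?thesis by (simp add: mult_ac)
  qed
  have 2: "B / (\<theta> * R powr g - \<theta> * \<rho> powr g) \<le> B * 16 powr (g + 1) / (\<theta> * min 1 g) * e powr (- (g + 1)) * r powr (- g)"
  proof -
    have "B / (\<theta> * R powr g - \<theta> * \<rho> powr g) \<le> B / (\<theta> * (min 1 g * (r powr g * (e / 16) powr (g + 1))))"
      unfolding right_diff_distrib[symmetric] using low lp lt th AB g r e by (intro divide_left_mono mult_left_mono mult_pos_pos) auto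
    also have "\<dots> = B * 16 powr (g + 1) / (\<theta> * min 1 g) * e powr (- (g + 1)) * r powr (- g)"
      using e r by (simp only: powr_divide powr_minus_divide) simp
    finally show ?thesis .
  qed
  show "energy_factor (R - \<rho>) (\<theta> * R powr (p * s) - \<theta> * \<rho> powr (p * s))
    \<le> energy_const p q s \<Lambda> \<mu> L CK \<theta> * e powr (- (p * s + 1)) * r powr (- (p * s))"
    using 1 2 unfolding energy_factor_def energy_const_def A_def[symmetric] B_def[symmetric] g_def[symmetric]
    by (simp add: distrib_right)
qed

lemma energy_const_pos: "0 < \<theta> \<Longrightarrow> 0 < energy_const p q s \<Lambda> \<mu> L CK \<theta>"
  unfolding energy_const_def using CK(1) Lam p s L
  by (intro add_pos_nonneg mult_pos_pos divide_nonneg_pos mult_nonneg_nonneg) auto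

lemma gap_const_pos: "\<sigma> < 1 \<Longrightarrow> 0 < gap_const q \<mu> L \<sigma>"
  unfolding gap_const_def using q L by (intro divide_pos_pos mult_pos_pos) auto

lemma step_const_pos: "0 < \<theta> \<Longrightarrow> \<sigma> < 1 \<Longrightarrow> 0 < step_const p q s \<Lambda> \<mu> L CK \<theta> \<sigma> (real DIM('a))"
proof -
  assume "0 < \<theta>" "\<sigma> < 1"
  then have "energy_const p q s \<Lambda> \<mu> L CK \<theta> \<noteq> 0" "gap_const q \<mu> L \<sigma> \<noteq> 0" "unit_ball_vol (real DIM('a)) \<noteq> 0"
    using energy_const_pos[of \<theta>] gap_const_pos[of \<sigma>] unit_ball_vol_pos[of "real DIM('a)"] by linarith+
  then show ?thesis
    unfolding step_const_def using Lam L \<open>\<sigma> < 1\<close> by (intro divide_pos_pos mult_pos_pos) auto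
qed

text \<open>A single parameter x drives radius, level and starting time. A step passes through x / 2
  to x / 4, one halving for each level drop; \<epsilon>1 and \<epsilon>2 are the corresponding level
  differences, and the radius gaps are r x / 16 and r x / 32.\<close>

lemma sublevel_step_scaled:
  assumes th: "0 < \<theta>" and ab: "a = b - \<theta> * r powr (p * s)" and sg: "0 < \<sigma>" "\<sigma> < 1" and x: "0 < x" "x \<le> 1"
  defines "D \<equiv> \<lambda>x. measure lborel (sublevel (r * (3 / 4 + x / 8)) (\<mu> + \<sigma> * L + (1 - \<sigma>) * L * x) (b - \<theta> * (r * (3 / 4 + x / 8)) powr (p * s)))"
    and "n \<equiv> real DIM('a)"
  shows "D (x / 4) \<le> step_const p q s \<Lambda> \<mu> L CK \<theta> \<sigma> n * x powr (- rate p q s n) * r powr (- (p * s) * (1 + p * s / n)) * D x powr (1 + p * s / n)"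
proof -
  define g where "g = p * s"
  define al where "al = p * s / n"
  define R where "R x = r * (3 / 4 + x / 8)" for x
  define k where "k = \<mu> + \<sigma> * L + (1 - \<sigma>) * L * x"
  define \<epsilon>1 where "\<epsilon>1 = (1 - \<sigma>) * L * x / 2"
  define \<epsilon>2 where "\<epsilon>2 = (1 - \<sigma>) * L * x / 4"
  define Qh where "Qh = energy_const p q s \<Lambda> \<mu> L CK \<theta>"
  \<comment> \<open>The factor \<open>2 powr (g + 1)\<close> lets one Q dominate both energy
    factors, the second being taken at e = x / 2.\<close>
  define Q where "Q = Qh * 2 powr (g + 1) * x powr (- (g + 1)) * r powr (- g)"
  have g: "0 < g" and n: "0 < n" using p s by (auto simp: g_def n_def)
  have Qh: "0 < Qh" unfolding Qh_def by (rule energy_const_pos[OF th])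
  have Qx: "Qh * x powr (- (g + 1)) * r powr (- g) \<le> Q"
  proof -
    have "1 \<le> 2 powr (g + 1)" using g by (simp add: ge_one_powr_ge_zero)
    then have "(Qh * x powr (- (g + 1)) * r powr (- g)) * 1 \<le> (Qh * x powr (- (g + 1)) * r powr (- g)) * 2 powr (g + 1)"
      using Qh by (intro mult_left_mono) auto
    then show ?thesis by (simp add: Q_def mult_ac)
  qed
  have Qx2: "Qh * (x / 2) powr (- (g + 1)) * r powr (- g) = Q"
    unfolding Q_def powr_minus_divide using x by (simp add: powr_divide)
  have R1: "R (x / 2) = r * (3 / 4 + x / 16)" "R (x / 4) = r * (3 / 4 + x / 2 / 16)" by (auto simp: R_def)
  have Rx: "0 < R (x / 4)" "R (x / 4) < R (x / 2)" "R (x / 2) < R x" "R x < r"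
  proof -
    show "0 < R (x / 4)" "R (x / 4) < R (x / 2)" "R (x / 2) < R x" using r x by (auto simp: R_def intro!: mult_pos_pos)
    have "r * (3 / 4 + x / 8) < r * 1" using r x by (intro mult_strict_left_mono) auto
    then show "R x < r" by (simp add: R_def)
  qed
  have E1: "energy_factor (R x - R (x / 2)) (\<theta> * R x powr g - \<theta> * R (x / 2) powr g) \<le> Q"
    and T1: "\<theta> * R (x / 2) powr g < \<theta> * R x powr g"
    using energy_factor_scaled[OF x th] Qx unfolding R1 R_def[of x] g_def Qh_def by auto
  have E2: "energy_factor (R (x / 2) - R (x / 4)) (\<theta> * R (x / 2) powr g - \<theta> * R (x / 4) powr g) \<le> Q"
    and T2: "\<theta> * R (x / 4) powr g < \<theta> * R (x / 2) powr g"
    using energy_factor_scaled[of "x / 2", OF _ _ th] Qx2 x unfolding R1(2) R_def[of "x / 2"] g_def Qh_def by auto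
  have T0: "a \<le> b - \<theta> * R x powr g"
    using th Rx g r unfolding ab g_def[symmetric] by (auto intro!: mult_left_mono powr_mono2)
  have gap: "level_gap \<epsilon>1 = gap_const q \<mu> L \<sigma> * x powr (q + 2)"
  proof -
    have "\<epsilon>1 / 4 = ((1 - \<sigma>) * L / 8) * x" by (simp add: \<epsilon>1_def)
    then have "(\<epsilon>1 / 4) powr (q + 2) = ((1 - \<sigma>) * L / 8) powr (q + 2) * x powr (q + 2)"
      using sg L x by (simp only:) (subst powr_mult, auto)
    then show ?thesis unfolding level_gap_def gap_const_def by simp
  qed
  have e2: "\<epsilon>2 powr p = ((1 - \<sigma>) * L / 4) powr p * x powr p"
  proof -
    have "\<epsilon>2 = ((1 - \<sigma>) * L / 4) * x" by (simp add: \<epsilon>2_def)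
    then show ?thesis using sg L x by (simp only:) (subst powr_mult, auto)
  qed
  define V where "V = (unit_ball_vol n / 2) powr (1 + al)"
  define W4 where "W4 = ((1 - \<sigma>) * L / 4) powr p"
  define cg where "cg = gap_const q \<mu> L \<sigma>"
  have kk: "k - \<epsilon>1 - \<epsilon>2 = \<mu> + \<sigma> * L + (1 - \<sigma>) * L * (x / 4)" by (simp add: k_def \<epsilon>1_def \<epsilon>2_def)
  have "D (x / 4) \<le> Q * (Q / level_gap \<epsilon>1) powr al * \<Lambda> / (\<epsilon>2 powr p * V) * D x powr (1 + al)"
    unfolding D_def kk[symmetric] k_def[symmetric] R_def[symmetric] V_def al_def n_def
  proof (rule sublevel_step[of _ _ _ _ "R (x / 2)" _ _ "b - \<theta> * R (x / 2) powr (p * s)"])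
    have "k - \<epsilon>1 = \<mu> + (\<sigma> * L + (1 - \<sigma>) * L * x / 2)" by (simp add: k_def \<epsilon>1_def)
    moreover have "0 \<le> \<sigma> * L + (1 - \<sigma>) * L * x / 2" using sg L x by simp
    ultimately show "\<mu> \<le> k - \<epsilon>1" by linarith
    have "(1 - \<sigma>) * L * x \<le> (1 - \<sigma>) * L * 1" using sg L x by (intro mult_left_mono) auto
    then show "k \<le> \<mu> + L" by (simp add: k_def algebra_simps)
    show "0 < \<epsilon>1" "0 < \<epsilon>2" using sg L x by (auto simp: \<epsilon>1_def \<epsilon>2_def)
  qed (use Rx E1 E2 T0 T1 T2 th in \<open>auto simp: g_def\<close>)
  also have "Q * (Q / level_gap \<epsilon>1) powr al * \<Lambda> / (\<epsilon>2 powr p * V)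
      = step_const p q s \<Lambda> \<mu> L CK \<theta> \<sigma> n * x powr (- rate p q s n) * r powr (- (p * s) * (1 + p * s / n))" (is "?l = ?r")
  proof -
    have pos: "0 < x" "0 < r" "0 < V" "0 < W4" "0 < cg" "0 < \<Lambda>" "0 < Qh"
    proof -
      have "unit_ball_vol n \<noteq> 0" using unit_ball_vol_pos[of n] n by linarith
      then show "0 < V" by (simp add: V_def)
    qed (use x r sg L Lam Qh gap_const_pos[OF sg(2)] in \<open>auto simp: W4_def cg_def\<close>)
    have l: "?l = Q * (Q / (cg * x powr (q + 2))) powr al * \<Lambda> / (W4 * x powr p * V)"
      unfolding gap e2 cg_def W4_def ..
    have r': "?r = (Qh * 2 powr (g + 1)) powr (1 + al) * cg powr (- al) * \<Lambda> / (W4 * V) * x powr (- ((g + 1) * (1 + al) + al * (q + 2) + p)) * r powr (- g * (1 + al))"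
      unfolding step_const_def rate_def V_def W4_def cg_def al_def g_def Qh_def ..
    \<comment> \<open>Both sides are positive products of powers, so comparing logarithms reduces
      the identity to algebra in the exponents.\<close>
    have "ln ?l = ln ?r"
      unfolding l r' unfolding Q_def using pos by (simp add: ln_mult ln_div ln_powr) (simp add: algebra_simps)
    moreover have "0 < ?l" unfolding l unfolding Q_def using pos by (intro divide_pos_pos mult_pos_pos) auto
    moreover have "0 < ?r" unfolding r' using pos by (intro divide_pos_pos mult_pos_pos) auto
    ultimately show ?thesis by (metis exp_ln)
  qed
  finally show ?thesis by (simp add: al_def)
qed

text \<open>Dividing the measures by \<open>r powr (n + p * s)\<close>, the scaling of a cylinder,
  removes r from the recursion because n * al = p s. The iteration starts at x = 1, with radius 7r/8
  and level \<mu> + L; as x = 4^-j tends to 0 it closes in on radius 3r/4 and level \<mu> + \<sigma>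
  L.\<close>

lemma sublevel_null:
  assumes th: "0 < \<theta>" and ab: "a = b - \<theta> * r powr (p * s)" and sg: "0 < \<sigma>" "\<sigma> < 1"
  defines "n \<equiv> real DIM('a)"
  assumes small: "measure lborel (sublevel (r * (7 / 8)) (\<mu> + L) (b - \<theta> * (r * (7 / 8)) powr (p * s)))
    \<le> step_const p q s \<Lambda> \<mu> L CK \<theta> \<sigma> n powr (- 1 / (p * s / n)) * (4 powr rate p q s n) powr (- 1 / (p * s / n)\<^sup>2) * r powr (n + p * s)"
  shows "measure lborel (sublevel (r * (3 / 4)) (\<mu> + \<sigma> * L) (b - \<theta> * (r * (3 / 4)) powr (p * s))) = 0"
proof -
  define al where "al = p * s / n"
  define g where "g = p * s"
  define Ch where "Ch = step_const p q s \<Lambda> \<mu> L CK \<theta> \<sigma> n"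
  define E where "E = rate p q s n"
  have g: "0 < g" and n: "0 < n" using p s by (auto simp: g_def n_def)
  have al: "0 < al" "n * al = g" using p s n by (auto simp: al_def g_def)
  have Ch: "0 < Ch" unfolding Ch_def n_def by (rule step_const_pos[OF th sg(2)])
  have E: "0 < E" unfolding E_def rate_def using p q s n by (intro add_nonneg_pos add_pos_nonneg mult_pos_pos) (auto intro!: add_pos_nonneg)
  define D where "D x = measure lborel (sublevel (r * (3 / 4 + x / 8)) (\<mu> + \<sigma> * L + (1 - \<sigma>) * L * x) (b - \<theta> * (r * (3 / 4 + x / 8)) powr (p * s)))" for x
  define Y where "Y j = D (1 / 4 ^ j) * r powr (- (n + g))" for j :: nat
  have rr: "r powr (n + g) * r powr (- (n + g)) = 1" "r powr (- (n + g)) * r powr (n + g) = 1"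
    unfolding powr_add[symmetric] using r by simp_all
  have "Y \<longlonglongrightarrow> 0"
  proof (rule fast_geometric_convergence[OF Ch _ al(1)])
    show "1 < 4 powr E" using E by simp
    show "0 \<le> Y j" for j by (simp add: Y_def D_def)
    show "Y (Suc j) \<le> Ch * (4 powr E) ^ j * Y j powr (1 + al)" for j
    proof -
      define x where "x = (1 / 4 ^ j :: real)"
      have x: "0 < x" "x \<le> 1" by (auto simp: x_def)
      have "D (x / 4) \<le> Ch * x powr (- E) * r powr (- g * (1 + al)) * D x powr (1 + al)"
        using sublevel_step_scaled[OF th ab sg x] unfolding D_def Ch_def E_def al_def g_def n_def .
      then have "D (x / 4) * r powr (- (n + g)) \<le> Ch * x powr (- E) * r powr (- g * (1 + al)) * D x powr (1 + al) * r powr (- (n + g))"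
        by (intro mult_right_mono) auto
      also have "\<dots> = Ch * x powr (- E) * (D x powr (1 + al) * (r powr (- g * (1 + al)) * r powr (- (n + g))))"
        by (simp add: mult_ac)
      also have "r powr (- g * (1 + al)) * r powr (- (n + g)) = (r powr (- (n + g))) powr (1 + al)"
      proof -
        have "- g * (1 + al) + - (n + g) = - (n + g) * (1 + al)" using al(2) by (simp add: algebra_simps)
        then show ?thesis by (simp only: powr_powr powr_add[symmetric])
      qed
      also have "D x powr (1 + al) * (r powr (- (n + g))) powr (1 + al) = Y j powr (1 + al)"
        unfolding Y_def x_def[symmetric] by (simp add: powr_mult D_def)
      also have "x powr (- E) = (4 powr E) ^ j"
      proof -
        have "x = 4 powr (- real j)" by (simp add: x_def powr_minus_divide powr_realpow)
        then have "x powr (- E) = 4 powr (E * real j)" by (simp add: powr_powr mult.commute)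
        then show ?thesis by (simp add: powr_powr[symmetric] powr_realpow)
      qed
      finally show ?thesis by (simp add: Y_def x_def mult.commute)
    qed
    have "D 1 * r powr (- (n + g)) \<le> (Ch powr (- 1 / al) * (4 powr E) powr (- 1 / al\<^sup>2) * r powr (n + g)) * r powr (- (n + g))"
      using small unfolding D_def Ch_def E_def al_def g_def by (intro mult_right_mono) (auto simp: algebra_simps)
    also have "\<dots> = Ch powr (- 1 / al) * (4 powr E) powr (- 1 / al\<^sup>2)"
      by (simp only: mult.assoc rr mult_1_right)
    finally show "Y 0 \<le> Ch powr (- 1 / al) * (4 powr E) powr (- 1 / al\<^sup>2)" by (simp add: Y_def)
  qed
  then have "(\<lambda>j. Y j * r powr (n + g)) \<longlonglongrightarrow> 0 * r powr (n + g)" by (intro tendsto_intros)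
  moreover have "Y j * r powr (n + g) = D (1 / 4 ^ j)" for j
    by (simp only: Y_def mult.assoc rr mult_1_right)
  ultimately have lim: "(\<lambda>j. D (1 / 4 ^ j)) \<longlonglongrightarrow> 0" by simp
  have le: "measure lborel (sublevel (r * (3 / 4)) (\<mu> + \<sigma> * L) (b - \<theta> * (r * (3 / 4)) powr (p * s))) \<le> D (1 / 4 ^ j)" for j
    unfolding D_def
  proof (rule sublevel_mono)
    have x: "0 \<le> (1 / 4 ^ j :: real)" by simp
    show rr: "r * (3 / 4) \<le> r * (3 / 4 + 1 / 4 ^ j / 8)" using r by (intro mult_left_mono) auto
    show "\<mu> + \<sigma> * L \<le> \<mu> + \<sigma> * L + (1 - \<sigma>) * L * (1 / 4 ^ j)" using sg L by simp
    show "b - \<theta> * (r * (3 / 4 + 1 / 4 ^ j / 8)) powr (p * s) \<le> b - \<theta> * (r * (3 / 4)) powr (p * s)"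
      using rr th r g by (intro diff_left_mono mult_left_mono powr_mono2) (auto simp: g_def)
  qed
  have "measure lborel (sublevel (r * (3 / 4)) (\<mu> + \<sigma> * L) (b - \<theta> * (r * (3 / 4)) powr (p * s))) \<le> 0"
    by (rule LIMSEQ_le_const[OF lim]) (use le in blast)
  then show ?thesis by (simp add: measure_le_0_iff)
qed

end

section \<open>Choice of the threshold, and return from the Borel version to u\<close>

theorem lemma4p3:
  fixes p q s \<Lambda> L \<theta> a \<mu> :: real
  assumes "1 < p" and "0 < q" and "0 < s" and "s < 1" and "1 \<le> \<Lambda>"
    and "0 < L" and "0 < \<theta>" and "0 < a" and "a < 1"
  shows "\<exists>\<tau>. 0 < \<tau> \<and> \<tau> < 1 \<and>
    (\<forall>(\<Omega> :: 'a::euclidean_space set) (T :: real) (K :: 'a \<Rightarrow> 'a \<Rightarrow> real \<Rightarrow> real)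
       (u :: 'a \<Rightarrow> real \<Rightarrow> real) (x0 :: 'a) (t0 :: real) (r :: real).
       bounded_domain \<Omega> \<longrightarrow> 0 < T \<longrightarrow> admissible_kernel p s \<Lambda> T K \<longrightarrow>
       weak_supersolution p q s K \<Omega> T u \<longrightarrow>
       ereal \<mu> \<le> essinf (lebesgue_on (UNIV \<times> {0<..<T})) (\<lambda>(x, t). u x t) \<longrightarrow>
       0 < r \<longrightarrow> Q_minus s p x0 t0 r \<theta> \<Subset> \<Omega> \<times> {0<..<T} \<longrightarrow>
       measure lebesgue ({(x, t). u x t \<le> \<mu> + L} \<inter> Q_minus s p x0 t0 r \<theta>)
         \<le> \<tau> * measure lebesgue (Q_minus s p x0 t0 r \<theta>) \<longrightarrow>
       (AE (x, t) in lebesgue. (x, t) \<in> Q_minus s p x0 t0 (3 * r / 4) \<theta> \<longrightarrow> \<mu> + a * L \<le> u x t))"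
proof -
  define n where "n = real DIM('a)"
  define g where "g = p * s"
  have n: "0 < n" by (simp add: n_def)
  have g: "0 < g" "g < p" using assms by (auto simp: g_def)
  obtain CK where CK: "0 < CK" "\<And>(x::'a) \<delta>. 0 < \<delta> \<Longrightarrow>
     (\<integral>\<^sup>+y. ennreal (min 1 ((norm (x - y) / \<delta>) powr p) / norm (x - y) powr (real DIM('a) + p * s)) \<partial>lborel)
       \<le> ennreal (CK * \<delta> powr (- (p * s)))"
    using truncated_kernel_scaled[OF g, where 'a = 'a] unfolding g_def by blast
  define Ch where "Ch = step_const p q s \<Lambda> \<mu> L CK \<theta> a n"
  define thr where "thr = Ch powr (- 1 / (p * s / n)) * (4 powr rate p q s n) powr (- 1 / (p * s / n)\<^sup>2)"
  define \<omega> where "\<omega> = unit_ball_vol n"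
  have w: "0 < \<omega>" using n by (simp add: \<omega>_def)
  \<comment> \<open>No solution is available yet at this point, so positivity is derived from the
    data alone rather than inside the locale.\<close>
  have Ch: "0 < Ch"
  proof -
    have "0 < energy_const p q s \<Lambda> \<mu> L CK \<theta>"
      unfolding energy_const_def using CK(1) assms
      by (intro add_pos_nonneg mult_pos_pos divide_nonneg_pos mult_nonneg_nonneg) auto
    moreover have "0 < gap_const q \<mu> L a"
      unfolding gap_const_def using assms by (intro divide_pos_pos mult_pos_pos) auto
    ultimately have "energy_const p q s \<Lambda> \<mu> L CK \<theta> \<noteq> 0" "gap_const q \<mu> L a \<noteq> 0" "unit_ball_vol n \<noteq> 0"
      using unit_ball_vol_pos[of n] n by linarith+
    then show ?thesis
      unfolding Ch_def step_const_def using assms by (intro divide_pos_pos mult_pos_pos) auto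
  qed
  then have thr: "0 < thr" by (simp add: thr_def)
  \<comment> \<open>The cylinder has measure \<omega> * \<theta> * r^(n + p s), so the second entry
    turns the smallness hypothesis into the starting condition of \<open>sublevel_null\<close>; the
    first ensures \<tau> < 1.\<close>
  define \<tau> where "\<tau> = min (1 / 2) (thr / (\<omega> * \<theta>))"
  have tau: "0 < \<tau>" "\<tau> < 1" using thr w assms by (auto simp: \<tau>_def)
  have main: "AE (x, t) in lebesgue. (x, t) \<in> Q_minus s p x0 t0 (3 * r / 4) \<theta> \<longrightarrow> \<mu> + a * L \<le> u x t"
    if K: "admissible_kernel p s \<Lambda> T K" and ws: "weak_supersolution p q s K \<Omega> T u"
      and inf: "ereal \<mu> \<le> essinf (lebesgue_on (UNIV \<times> {0<..<T})) (\<lambda>(x, t). u x t)"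
      and r: "0 < r" and cyl: "Q_minus s p x0 t0 r \<theta> \<Subset> \<Omega> \<times> {0<..<T}"
      and meas: "measure lebesgue ({(x, t). u x t \<le> \<mu> + L} \<inter> Q_minus s p x0 t0 r \<theta>)
         \<le> \<tau> * measure lebesgue (Q_minus s p x0 t0 r \<theta>)"
    for \<Omega> :: "'a set" and T K u and x0 :: 'a and t0 r
  proof -
    define Q where "Q = Q_minus s p x0 t0 r \<theta>"
    define t1 where "t1 = t0 - \<theta> * r powr (p * s)"
    have Q: "Q = ball x0 r \<times> {t1<..t0}" by (simp add: Q_def Q_minus_def t1_def mult.commute)
    have t10: "t1 < t0" using r assms by (simp add: t1_def)
    \<comment> \<open>Compact containment speaks of the closure, so the closed ball and both end
      times lie inside the domain; this leaves the room around [t1, t0] that averaging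
      needs.\<close>
    have "closure Q = cball x0 r \<times> {t1..t0}" using r t10 by (simp add: Q closure_Times)
    then have sub: "cball x0 r \<times> {t1..t0} \<subseteq> \<Omega> \<times> {0<..<T}" using cyl by (simp add: compactly_contained_def Q_def)
    have in1: "(x, t1) \<in> \<Omega> \<times> {0<..<T}" if "x \<in> cball x0 r" for x
    proof -
      have "(x, t1) \<in> cball x0 r \<times> {t1..t0}" using that t10 by simp
      then show ?thesis using sub by blast
    qed
    have "x0 \<in> cball x0 r" using r by simp
    from in1[OF this] have tt1: "0 < t1" by simp
    have "(x0, t0) \<in> cball x0 r \<times> {t1..t0}" using r t10 by simp
    then have "(x0, t0) \<in> \<Omega> \<times> {0<..<T}" using sub by blast
    then have tt: "0 < t1" "t0 < T" using tt1 by auto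
    have x0: "cball x0 r \<subseteq> \<Omega>" using in1 by blast
    obtain U \<kappa> M s1 s2 where reg: "regular_supersolution p q s \<Lambda> \<mu> M U \<kappa> x0 r t1 t0 s1 s2"
      and uU: "AE z in lborel. snd z \<in> {0<..<T} \<longrightarrow> u (fst z) (snd z) = U (fst z) (snd z)"
      by (rule weak_supersolution_regular[OF assms(1-5) K ws inf x0 r tt(1) t10 tt(2)]) (rule that; assumption)
    interpret regular_supersolution p q s \<Lambda> \<mu> M U \<kappa> x0 r t1 t0 s1 s2 by (rule reg)
    interpret levelled_supersolution p q s \<Lambda> \<mu> M U \<kappa> x0 r t1 t0 s1 s2 CK L
      by unfold_locales (use CK assms in auto)
    have Qb: "Q \<in> sets borel" unfolding Q by (simp add: borel_prod[symmetric])
    define P where "P = {z \<in> Q. U (fst z) (snd z) \<le> \<mu> + L}"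
    have Pb: "P \<in> sets borel"
    proof -
      have "P = Q \<inter> {z \<in> space borel. U (fst z) (snd z) \<le> \<mu> + L}" by (auto simp: P_def)
      moreover have "{z \<in> space borel. U (fst z) (snd z) \<le> \<mu> + L} \<in> sets borel"
        unfolding borel_prod[symmetric] by measurable
      ultimately show ?thesis using Qb by simp
    qed
    have eQ: "emeasure lborel Q = ennreal (\<omega> * r powr n * (\<theta> * r powr g))"
    proof -
      have "emeasure lborel Q = emeasure lborel (ball x0 r) * emeasure lborel {t1<..t0}"
        unfolding Q lborel_prod[symmetric] by (subst lborel.emeasure_pair_measure_Times) auto
      also have "\<dots> = ennreal (\<omega> * r powr n) * ennreal (\<theta> * r powr g)"
        using r t10 by (simp add: emeasure_ball powr_realpow n_def \<omega>_def t1_def g_def)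
      finally show ?thesis using w assms by (simp add: ennreal_mult')
    qed
    have mQ: "measure lebesgue Q = \<omega> * r powr n * (\<theta> * r powr g)"
      using eQ w assms Qb by (simp add: measure_def)
    have mP: "measure lborel P = measure lebesgue ({(x, t). u x t \<le> \<mu> + L} \<inter> Q)"
    proof -
      \<comment> \<open>Measurability of the set defined by u comes from completeness: it differs
        from the Borel set P by a null set, as u and U agree almost everywhere at times in (0,
        T).\<close>
      have ae: "AE z in lebesgue. z \<in> P \<longleftrightarrow> z \<in> {(x, t). u x t \<le> \<mu> + L} \<inter> Q"
      proof -
        have "AE z in lborel. z \<in> P \<longleftrightarrow> z \<in> {(x, t). u x t \<le> \<mu> + L} \<inter> Q"
          using uU
        proof eventually_elim
          case (elim z)
          obtain x t where z: "z = (x, t)" by (cases z)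
          show ?case
          proof (cases "z \<in> Q")
            case True
            then have "t \<in> {0<..<T}" using tt by (auto simp: z Q)
            then show ?thesis using elim True by (simp add: P_def z)
          qed (simp add: P_def)
        qed
        then show ?thesis by (simp add: AE_completion_iff)
      qed
      have Pl: "P \<in> sets lebesgue" using Pb by (intro sets_completionI_sets) simp
      have ul: "{(x, t). u x t \<le> \<mu> + L} \<inter> Q \<in> sets lebesgue"
        by (rule completion.in_sets_AE[OF ae Pl]) simp
      have "measure lebesgue P = measure lebesgue ({(x, t). u x t \<le> \<mu> + L} \<inter> Q)"
        by (rule measure_eq_AE[OF ae Pl ul])
      then show ?thesis using Pb by simp
    qed
    have "measure lborel (sublevel (r * (7 / 8)) (\<mu> + L) (t0 - \<theta> * (r * (7 / 8)) powr (p * s))) \<le> measure lborel P"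
    proof (rule measure_mono_fmeasurable)
      show "sublevel (r * (7 / 8)) (\<mu> + L) (t0 - \<theta> * (r * (7 / 8)) powr (p * s)) \<subseteq> P"
      proof
        fix z assume z: "z \<in> sublevel (r * (7 / 8)) (\<mu> + L) (t0 - \<theta> * (r * (7 / 8)) powr (p * s))"
        \<comment> \<open>The strict inequality fits the closed time interval of the sublevel set
          into the half-open cylinder; it is gained by starting from radius 7r/8.\<close>
        have "(r * (7 / 8)) powr (p * s) < r powr (p * s)"
          using r g by (intro powr_less_mono2) (auto simp: g_def)
        then have "t1 < t0 - \<theta> * (r * (7 / 8)) powr (p * s)" unfolding t1_def using assms by simp
        then show "z \<in> P" using z r by (cases z) (auto simp: sublevel_def P_def Q)
      qed
      show "P \<in> fmeasurable lborel"
      proof (rule fmeasurableI)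
        have "emeasure lborel P \<le> emeasure lborel Q" using Qb by (intro emeasure_mono) (auto simp: P_def)
        then show "emeasure lborel P < \<infinity>" using eQ by (auto intro: order.strict_trans1)
      qed (use Pb in simp)
    qed (rule sublevel_sets)
    also have "\<dots> \<le> \<tau> * (\<omega> * r powr n * (\<theta> * r powr g))"
      using meas unfolding mP mQ[symmetric] Q_def .
    also have "\<dots> \<le> (thr / (\<omega> * \<theta>)) * (\<omega> * r powr n * (\<theta> * r powr g))"
      using w assms by (intro mult_right_mono) (auto simp: \<tau>_def)
    also have "\<dots> = thr * r powr (n + g)" using w assms by (simp add: powr_add)
    finally have "measure lborel (sublevel (r * (3 / 4)) (\<mu> + a * L) (t0 - \<theta> * (r * (3 / 4)) powr (p * s))) = 0"
      using assms(7-9) unfolding thr_def Ch_def g_def n_def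
      by (intro sublevel_null) (auto simp: t1_def)
    then have "sublevel (r * (3 / 4)) (\<mu> + a * L) (t0 - \<theta> * (r * (3 / 4)) powr (p * s)) \<in> null_sets lborel"
      using sublevel_sets by (intro null_setsI) (simp_all add: sublevel_finite)
    from AE_not_in[OF this] uU
    have "AE z in lborel. case z of (x, t) \<Rightarrow> (x, t) \<in> Q_minus s p x0 t0 (3 * r / 4) \<theta> \<longrightarrow> \<mu> + a * L \<le> u x t"
    proof eventually_elim
      case (elim z)
      obtain x t where z: "z = (x, t)" by (cases z)
      have "\<mu> + a * L \<le> u x t" if m: "(x, t) \<in> Q_minus s p x0 t0 (3 * r / 4) \<theta>"
      proof -
        have x: "x \<in> ball x0 (r * (3 / 4))" and t: "t0 - \<theta> * (r * (3 / 4)) powr (p * s) < t" "t \<le> t0"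
          using m by (auto simp: Q_minus_def mult.commute)
        have "(r * (3 / 4)) powr (p * s) \<le> r powr (p * s)"
          using r g by (intro powr_mono2) (auto simp: g_def)
        then have "t1 \<le> t0 - \<theta> * (r * (3 / 4)) powr (p * s)" unfolding t1_def using assms by simp
        then have "t \<in> {0<..<T}" using t tt by auto
        then have "u x t = U x t" using elim by (simp add: z)
        moreover have "\<not> U x t < \<mu> + a * L" using elim x t by (auto simp: sublevel_def z)
        ultimately show ?thesis by simp
      qed
      then show ?case by (simp add: z)
    qed
    then show ?thesis by (simp add: AE_completion_iff)
  qed
  show ?thesis
    by (intro exI[of _ \<tau>] conjI tau allI impI) (rule main)
qed

end
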